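(* Let $M$ be a von Neumann algebra with a fixed faithful normal state $\phi$, and let $\Xi=\{\xi(t)\}_{t\ge0}$ be a unital unit of a $\phi$-spatial product system $H=\{\mathcal{H}_t\}_{t\ge0}$ of W$^*$-$M$-bimodules. Let $\mathfrak{H}$ be the inductive limit of $(H,\Xi)$, with canonical embeddings $\kappa_t:\mathcal{H}_t\to\mathfrak{H}$ and unitaries $U_t:\mathfrak{H}\otimes^M\mathcal{H}_t\to\mathfrak{H}$. The semigroup $T^{\Xi}=\{T_t^\Xi\}_{t\ge0}$ on $M$, $T_t^{\Xi}(x)=\pi_\phi(\xi(t))^*\pi_\phi(x\xi(t))$, is a CP$_0$-semigroup if and only if $$U_t(\kappa_0(x\phi^{1/2})\phi^{-1/2}\xi(t))=\kappa_t(x\xi(t))\to\kappa_0(x\phi^{1/2})\qquad(t\to+0)$$ holds for each $x\in M$.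
   Context: Inner products are linear in the second variable. $L^2(M)$ is the standard space of $M$ (an $M$-$M$-bimodule), $\phi^{1/2}\in L^2(M)$ the vector representing $\phi$; $M\phi^{1/2}$ and $\phi^{1/2}M$ are dense in $L^2(M)$. A W$^*$-$M$-bimodule is a Hilbert space with commuting normal $*$-representations of $M$ (left action) and of $M^\circ$ (right action); a right W$^*$-$M$-module has only the right action. For a right W$^*$-$M$-module $\mathcal{H}$, $\xi\in\mathcal{H}$ is $\phi$-bounded if $\|\xi x\|\le c\|\phi^{1/2}x\|$ for all $x\in M$ and some $c>0$; $\mathcal{D}(\mathcal{H};\phi)$ is the set of such vectors and $\pi_\phi(\xi):L^2(M)\to\mathcal{H}$ is the bounded operator with $\phi^{1/2}x\mapsto\xi x$. For such $\xi_1,\xi_2$, $\pi_\phi(\xi_1)^*\pi_\phi(\xi_2)\in\mathrm{End}(L^2(M)_M)=M$. The relative tensor product $\mathcal{H}\otimes^M\mathcal{K}$ (for $\mathcal{K}$ with a left $M$-action) is the separation-completion of $\mathcal{D}(\mathcal{H};\phi)\otimes_{\mathrm{alg}}\mathcal{K}$ for $\langle\xi_1\phi^{-1/2}\eta_1,\xi_2\phi^{-1/2}\eta_2\rangle=\langle\eta_1,\pi_\phi(\xi_1)^*\pi_\phi(\xi_2)\eta_2\rangle$, where $\xi\phi^{-1/2}\eta$ denotes the class of $\xi\otimes\eta$; it inherits the outer actions. One identifies $L^2(M)\otimes^M\mathcal{K}\cong\mathcal{K}$ and $\mathcal{H}\otimes^ML^2(M)\cong\mathcal{H}$ canonically. A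 product system of W$^*$-$M$-bimodules is a family $H=\{\mathcal{H}_t\}_{t\ge0}$ of W$^*$-$M$-bimodules with $\mathcal{H}_0=L^2(M)$ and bimodule unitaries $U_{s,t}:\mathcal{H}_s\otimes^M\mathcal{H}_t\to\mathcal{H}_{s+t}$ with $U_{r,s+t}(\mathrm{id}_{\mathcal{H}_r}\otimes^MU_{s,t})=U_{r+s,t}(U_{r,s}\otimes^M\mathrm{id}_{\mathcal{H}_t})$ (modulo the associativity isomorphism), $U_{0,t}$, $U_{s,0}$ being the canonical identifications. A unit (with respect to $\phi$) is a family $\Xi=\{\xi(t)\}_{t\ge0}$, $\xi(t)\in\mathcal{D}(\mathcal{H}_t;\phi)$, with $\xi(0)=\phi^{1/2}$ and $U_{s,t}(\xi(s)\phi^{-1/2}\xi(t))=\xi(s+t)$ for all $s,t\ge 0$; it is unital if $\pi_\phi(\xi(t))^*\pi_\phi(\xi(t))=1_M$ for all $t$. $H$ is $\phi$-spatial if it has a unit with respect to $\phi$. Inductive limit of $(H,\Xi)$: for $0\le s\le t$ let $b_{t,s}:\mathcal{H}_s\to\mathcal{H}_t$ be the right $M$-linear isometry $b_{t,s}(\xi)=U_{t-s,s}(\xi(t-s)\phi^{-1/2}\xi)$. $\mathfrak{H}$ is the inductive limit right W$^*$-$M$-module of $(\{\mathcal{H}_t\},\{b_{t,s}\}_{s\le t})$, with canonical isometric embeddings $\kappa_t:\mathcal{H}_t\to\mathfrak{H}$, $\kappa_tb_{t,s}=\kappa_s$. $U_t:\mathfrak{H}\otimes^M\mathcal{H}_t\to\mathfrak{H}$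 is the right $M$-linear unitary determined by $U_t((\kappa_s\xi_s)\phi^{-1/2}\eta_t)=\kappa_{s+t}U_{s,t}(\xi_s\phi^{-1/2}\eta_t)$ for $s\ge0$, $\xi_s\in\mathcal{D}(\mathcal{H}_s;\phi)$, $\eta_t\in\mathcal{H}_t$. A CP$_0$-semigroup on $M$ is a family $\{T_t\}_{t\ge0}$ of normal unital completely positive maps on $M$ with $T_0=\mathrm{id}_M$, $T_sT_t=T_{s+t}$, and $t\mapsto\omega(T_t(x))$ continuous on $[0,\infty)$ for all $x\in M$, $\omega\in M_*$. (Without the continuity condition, $T^\Xi$ always satisfies the remaining conditions.) *)

theory Defs
  imports
    "HOL-Algebra.Algebraic_Closure_Type"
    "HOL-Analysis.Abstract_Metric_Spaces"
    "HOL-Library.Poly_Mapping"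
    "HOL-Library.Nonpos_Ints"
begin

section \<open>Hilbert spaces and bounded operators\<close>

text \<open>Hilbert spaces are carrier-based, since a product system is a family of Hilbert spaces indexed
  by the real numbers, and relative tensor products depend on such terms.  The fields \<open>mult\<close> and
  \<open>one\<close>, which library modules inherit from the ring record, play no role.\<close>

record 'a hilb = "(complex, 'a) module" +
  ip :: "'a \<Rightarrow> 'a \<Rightarrow> complex"

definition vnorm :: "('a, 'z) hilb_scheme \<Rightarrow> 'a \<Rightarrow> real" where
  "vnorm H \<xi> = sqrt (Re (ip H \<xi> \<xi>))"

text \<open>The locale \<open>Metric_space\<close> wants symmetry and nonnegativity off the carrier too.\<close>

definition vdist :: "('a, 'z) hilb_scheme \<Rightarrow> 'a \<Rightarrow> 'a \<Rightarrow> real" where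
  "vdist H \<xi> \<eta> =
     (if \<xi> \<in> carrier H \<and> \<eta> \<in> carrier H then vnorm H (\<xi> \<ominus>\<^bsub>H\<^esub> \<eta>) else 0)"

definition norm_topology :: "('a, 'z) hilb_scheme \<Rightarrow> 'a topology" where
  "norm_topology H = Metric_space.mtopology (carrier H) (vdist H)"

locale hilbert_space = module "ring_of_type_algebra :: complex ring" H
  for H :: "('a, 'z) hilb_scheme" +
  assumes ip_add: "\<lbrakk>\<xi> \<in> carrier H; \<eta> \<in> carrier H; \<zeta> \<in> carrier H\<rbrakk>
      \<Longrightarrow> ip H \<xi> (\<eta> \<oplus>\<^bsub>H\<^esub> \<zeta>) = ip H \<xi> \<eta> + ip H \<xi> \<zeta>"
    and ip_smult: "\<lbrakk>\<xi> \<in> carrier H; \<eta> \<in> carrier H\<rbrakk>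
      \<Longrightarrow> ip H \<xi> (c \<odot>\<^bsub>H\<^esub> \<eta>) = c * ip H \<xi> \<eta>"
    and ip_cnj: "\<lbrakk>\<xi> \<in> carrier H; \<eta> \<in> carrier H\<rbrakk> \<Longrightarrow> ip H \<eta> \<xi> = cnj (ip H \<xi> \<eta>)"
    and ip_nonneg: "\<xi> \<in> carrier H \<Longrightarrow> 0 \<le> Re (ip H \<xi> \<xi>)"
    and ip_definite: "\<lbrakk>\<xi> \<in> carrier H; ip H \<xi> \<xi> = 0\<rbrakk> \<Longrightarrow> \<xi> = \<zero>\<^bsub>H\<^esub>"
    and complete: "Metric_space.mcomplete (carrier H) (vdist H)"

definition linear_map :: "('a, 'z) hilb_scheme \<Rightarrow> ('b, 'y) hilb_scheme \<Rightarrow> ('a \<Rightarrow> 'b) \<Rightarrow> bool" where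
  "linear_map H G f \<longleftrightarrow> f \<in> carrier H \<rightarrow> carrier G \<and>
     (\<forall>\<xi>\<in>carrier H. \<forall>\<eta>\<in>carrier H. f (\<xi> \<oplus>\<^bsub>H\<^esub> \<eta>) = f \<xi> \<oplus>\<^bsub>G\<^esub> f \<eta>) \<and>
     (\<forall>c. \<forall>\<xi>\<in>carrier H. f (c \<odot>\<^bsub>H\<^esub> \<xi>) = c \<odot>\<^bsub>G\<^esub> f \<xi>)"

text \<open>Operators are extensional functions, so that equality of operators is equality of functions and
  composition is \<^const>\<open>compose\<close>.\<close>

definition bounded_ops ::
    "('a, 'z) hilb_scheme \<Rightarrow> ('b, 'y) hilb_scheme \<Rightarrow> ('a \<Rightarrow> 'b) set" where
  "bounded_ops H G = {f \<in> extensional (carrier H). linear_map H G f \<and>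
     (\<exists>c. \<forall>\<xi>\<in>carrier H. vnorm G (f \<xi>) \<le> c * vnorm H \<xi>)}"

definition adjoint ::
    "('a, 'z) hilb_scheme \<Rightarrow> ('b, 'y) hilb_scheme \<Rightarrow> ('a \<Rightarrow> 'b) \<Rightarrow> ('b \<Rightarrow> 'a)" where
  "adjoint H G f = (\<lambda>\<eta>\<in>carrier G.
     THE \<zeta>. \<zeta> \<in> carrier H \<and> (\<forall>\<xi>\<in>carrier H. ip H \<zeta> \<xi> = ip G \<eta> (f \<xi>)))"

definition isometric_map ::
    "('a, 'z) hilb_scheme \<Rightarrow> ('b, 'y) hilb_scheme \<Rightarrow> ('a \<Rightarrow> 'b) \<Rightarrow> bool" where
  "isometric_map H G f \<longleftrightarrow> linear_map H G f \<and>
     (\<forall>\<xi>\<in>carrier H. \<forall>\<eta>\<in>carrier H. ip G (f \<xi>) (f \<eta>) = ip H \<xi> \<eta>)"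

definition unitary_map ::
    "('a, 'z) hilb_scheme \<Rightarrow> ('b, 'y) hilb_scheme \<Rightarrow> ('a \<Rightarrow> 'b) \<Rightarrow> bool" where
  "unitary_map H G f \<longleftrightarrow> isometric_map H G f \<and> f ` carrier H = carrier G"

definition op_add :: "('a, 'z) hilb_scheme \<Rightarrow> ('a \<Rightarrow> 'a) \<Rightarrow> ('a \<Rightarrow> 'a) \<Rightarrow> ('a \<Rightarrow> 'a)" where
  "op_add H x y = (\<lambda>\<xi>\<in>carrier H. x \<xi> \<oplus>\<^bsub>H\<^esub> y \<xi>)"

definition op_scale :: "('a, 'z) hilb_scheme \<Rightarrow> complex \<Rightarrow> ('a \<Rightarrow> 'a) \<Rightarrow> ('a \<Rightarrow> 'a)" where
  "op_scale H c x = (\<lambda>\<xi>\<in>carrier H. c \<odot>\<^bsub>H\<^esub> x \<xi>)"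

definition op_one :: "('a, 'z) hilb_scheme \<Rightarrow> ('a \<Rightarrow> 'a)" where
  "op_one H = (\<lambda>\<xi>\<in>carrier H. \<xi>)"

abbreviation op_mult :: "('a, 'z) hilb_scheme \<Rightarrow> ('a \<Rightarrow> 'a) \<Rightarrow> ('a \<Rightarrow> 'a) \<Rightarrow> ('a \<Rightarrow> 'a)" where
  "op_mult H x y \<equiv> compose (carrier H) x y"


section \<open>Von Neumann algebras\<close>

definition commutant :: "('a, 'z) hilb_scheme \<Rightarrow> ('a \<Rightarrow> 'a) set \<Rightarrow> ('a \<Rightarrow> 'a) set" where
  "commutant K S = {y \<in> bounded_ops K K. \<forall>x\<in>S. op_mult K x y = op_mult K y x}"

definition von_neumann_algebra :: "('a, 'z) hilb_scheme \<Rightarrow> ('a \<Rightarrow> 'a) set \<Rightarrow> bool" where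
  "von_neumann_algebra K M \<longleftrightarrow> hilbert_space K \<and> M \<subseteq> bounded_ops K K \<and>
     (\<forall>x\<in>M. adjoint K K x \<in> M) \<and> commutant K (commutant K M) = M"

text \<open>The predual: \<open>\<omega> \<in> M\<^sub>*\<close> iff \<open>\<omega>\<close> is \<open>\<sigma>\<close>-weakly continuous, that is,
  \<open>\<omega>(x) = \<Sum>\<^sub>n \<langle>\<xi>\<^sub>n, x \<eta>\<^sub>n\<rangle>\<close> with square-summable \<open>(\<xi>\<^sub>n)\<close> and \<open>(\<eta>\<^sub>n)\<close>.\<close>

definition normal_functional ::
    "('a, 'z) hilb_scheme \<Rightarrow> ('a \<Rightarrow> 'a) set \<Rightarrow> (('a \<Rightarrow> 'a) \<Rightarrow> complex) \<Rightarrow> bool" where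
  "normal_functional K M \<omega> \<longleftrightarrow> (\<exists>\<xi> \<eta> :: nat \<Rightarrow> 'a.
     (\<forall>n. \<xi> n \<in> carrier K \<and> \<eta> n \<in> carrier K) \<and>
     summable (\<lambda>n. (vnorm K (\<xi> n))\<^sup>2) \<and> summable (\<lambda>n. (vnorm K (\<eta> n))\<^sup>2) \<and>
     (\<forall>x\<in>M. (\<lambda>n. ip K (\<xi> n) (x (\<eta> n))) sums \<omega> x))"

text \<open>Normality of a linear map \<open>\<sigma> : M \<rightarrow> N\<close> is \<open>\<sigma>\<close>-weak continuity: \<open>\<omega> \<circ> \<sigma> \<in> M\<^sub>*\<close> for all
  \<open>\<omega> \<in> N\<^sub>*\<close>.\<close>

definition normal_map :: "('a, 'z) hilb_scheme \<Rightarrow> ('a \<Rightarrow> 'a) set \<Rightarrow>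
    ('b, 'y) hilb_scheme \<Rightarrow> ('b \<Rightarrow> 'b) set \<Rightarrow> (('a \<Rightarrow> 'a) \<Rightarrow> ('b \<Rightarrow> 'b)) \<Rightarrow> bool" where
  "normal_map K M H N \<sigma> \<longleftrightarrow>
     (\<forall>\<omega>. normal_functional H N \<omega> \<longrightarrow> normal_functional K M (\<lambda>x. \<omega> (\<sigma> x)))"

definition faithful_normal_state ::
    "('a, 'z) hilb_scheme \<Rightarrow> ('a \<Rightarrow> 'a) set \<Rightarrow> (('a \<Rightarrow> 'a) \<Rightarrow> complex) \<Rightarrow> bool" where
  "faithful_normal_state K M \<phi> \<longleftrightarrow> normal_functional K M \<phi> \<and> \<phi> (op_one K) = 1 \<and>
     (\<forall>x\<in>M. \<phi> (op_mult K (adjoint K K x) x) \<in> \<real>\<^sub>\<ge>\<^sub>0) \<and>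
     (\<forall>x\<in>M. \<phi> (op_mult K (adjoint K K x) x) = 0 \<longrightarrow> x = op_scale K 0 (op_one K))"

text \<open>Normal unital linear \<open>*\<close>-preserving maps into the bounded operators; multiplicative ones are the
  normal representations of \<open>M\<close>, antimultiplicative ones those of the opposite algebra of \<open>M\<close>.\<close>

definition normal_star_map :: "('a, 'z) hilb_scheme \<Rightarrow> ('a \<Rightarrow> 'a) set \<Rightarrow>
    ('b, 'y) hilb_scheme \<Rightarrow> (('a \<Rightarrow> 'a) \<Rightarrow> ('b \<Rightarrow> 'b)) \<Rightarrow> bool" where
  "normal_star_map K M H \<sigma> \<longleftrightarrow>
     \<sigma> \<in> M \<rightarrow> bounded_ops H H \<and>
     (\<forall>x\<in>M. \<forall>y\<in>M. \<sigma> (op_add K x y) = op_add H (\<sigma> x) (\<sigma> y)) \<and>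
     (\<forall>c. \<forall>x\<in>M. \<sigma> (op_scale K c x) = op_scale H c (\<sigma> x)) \<and>
     \<sigma> (op_one K) = op_one H \<and>
     (\<forall>x\<in>M. \<sigma> (adjoint K K x) = adjoint H H (\<sigma> x)) \<and>
     normal_map K M H (bounded_ops H H) \<sigma>"

definition normal_rep :: "('a, 'z) hilb_scheme \<Rightarrow> ('a \<Rightarrow> 'a) set \<Rightarrow>
    ('b, 'y) hilb_scheme \<Rightarrow> (('a \<Rightarrow> 'a) \<Rightarrow> ('b \<Rightarrow> 'b)) \<Rightarrow> bool" where
  "normal_rep K M H \<sigma> \<longleftrightarrow> normal_star_map K M H \<sigma> \<and>
     (\<forall>x\<in>M. \<forall>y\<in>M. \<sigma> (op_mult K x y) = op_mult H (\<sigma> x) (\<sigma> y))"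

definition normal_antirep :: "('a, 'z) hilb_scheme \<Rightarrow> ('a \<Rightarrow> 'a) set \<Rightarrow>
    ('b, 'y) hilb_scheme \<Rightarrow> (('a \<Rightarrow> 'a) \<Rightarrow> ('b \<Rightarrow> 'b)) \<Rightarrow> bool" where
  "normal_antirep K M H \<sigma> \<longleftrightarrow> normal_star_map K M H \<sigma> \<and>
     (\<forall>x\<in>M. \<forall>y\<in>M. \<sigma> (op_mult K x y) = op_mult H (\<sigma> y) (\<sigma> x))"

text \<open>Normality of an isomorphism and of its inverse is automatic, so that this is a \<open>*\<close>-isomorphism onto
  a von Neumann algebra \<open>N\<close>.\<close>

definition vn_isomorphism :: "('a, 'z) hilb_scheme \<Rightarrow> ('a \<Rightarrow> 'a) set \<Rightarrow>
    ('b, 'y) hilb_scheme \<Rightarrow> ('b \<Rightarrow> 'b) set \<Rightarrow> (('a \<Rightarrow> 'a) \<Rightarrow> ('b \<Rightarrow> 'b)) \<Rightarrow> bool" where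
  "vn_isomorphism K M H N \<sigma> \<longleftrightarrow> normal_rep K M H \<sigma> \<and> bij_betw \<sigma> M N \<and>
     normal_map H N K M (inv_into M \<sigma>)"

text \<open>Haagerup's standard form \<open>(N, H, J, P)\<close>: \<open>J\<close> is a conjugate-linear isometric involution and \<open>P\<close> a
  self-dual cone with \<open>J N J = N'\<close>, \<open>J c J = c\<^sup>*\<close> for central \<open>c\<close>, \<open>J \<xi> = \<xi>\<close> on \<open>P\<close>, and
  \<open>x J x J P \<subseteq> P\<close>.  It is unique up to a unique unitary.\<close>

definition standard_form ::
    "('a, 'z) hilb_scheme \<Rightarrow> ('a \<Rightarrow> 'a) set \<Rightarrow> ('a \<Rightarrow> 'a) \<Rightarrow> 'a set \<Rightarrow> bool" where
  "standard_form H N J P \<longleftrightarrow> von_neumann_algebra H N \<and>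
     J \<in> carrier H \<rightarrow> carrier H \<and>
     (\<forall>\<xi>\<in>carrier H. \<forall>\<eta>\<in>carrier H. J (\<xi> \<oplus>\<^bsub>H\<^esub> \<eta>) = J \<xi> \<oplus>\<^bsub>H\<^esub> J \<eta>) \<and>
     (\<forall>c. \<forall>\<xi>\<in>carrier H. J (c \<odot>\<^bsub>H\<^esub> \<xi>) = cnj c \<odot>\<^bsub>H\<^esub> J \<xi>) \<and>
     (\<forall>\<xi>\<in>carrier H. \<forall>\<eta>\<in>carrier H. ip H (J \<xi>) (J \<eta>) = ip H \<eta> \<xi>) \<and>
     (\<forall>\<xi>\<in>carrier H. J (J \<xi>) = \<xi>) \<and>
     P = {\<eta> \<in> carrier H. \<forall>\<xi>\<in>P. ip H \<xi> \<eta> \<in> \<real>\<^sub>\<ge>\<^sub>0} \<and>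
     (\<lambda>x. \<lambda>\<xi>\<in>carrier H. J (x (J \<xi>))) ` N = commutant H N \<and>
     (\<forall>c\<in>N \<inter> commutant H N. \<forall>\<xi>\<in>carrier H. J (c (J \<xi>)) = adjoint H H c \<xi>) \<and>
     (\<forall>\<xi>\<in>P. J \<xi> = \<xi>) \<and>
     (\<forall>x\<in>N. \<forall>\<xi>\<in>P. x (J (x (J \<xi>))) \<in> P)"

definition completely_positive ::
    "('a, 'z) hilb_scheme \<Rightarrow> ('a \<Rightarrow> 'a) set \<Rightarrow> (('a \<Rightarrow> 'a) \<Rightarrow> ('a \<Rightarrow> 'a)) \<Rightarrow> bool" where
  "completely_positive K M T \<longleftrightarrow>
     (\<forall>n::nat. \<forall>a :: nat \<Rightarrow> nat \<Rightarrow> 'a \<Rightarrow> 'a.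
        (\<forall>i<n. \<forall>j<n. a i j \<in> M) \<longrightarrow>
        (\<forall>\<eta>. (\<forall>i<n. \<eta> i \<in> carrier K) \<longrightarrow>
           (\<Sum>i<n. \<Sum>j<n. ip K (\<eta> i) (a i j (\<eta> j))) \<in> \<real>\<^sub>\<ge>\<^sub>0) \<longrightarrow>
        (\<forall>\<eta>. (\<forall>i<n. \<eta> i \<in> carrier K) \<longrightarrow>
           (\<Sum>i<n. \<Sum>j<n. ip K (\<eta> i) (T (a i j) (\<eta> j))) \<in> \<real>\<^sub>\<ge>\<^sub>0))"

definition normal_ucp ::
    "('a, 'z) hilb_scheme \<Rightarrow> ('a \<Rightarrow> 'a) set \<Rightarrow> (('a \<Rightarrow> 'a) \<Rightarrow> ('a \<Rightarrow> 'a)) \<Rightarrow> bool" where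
  "normal_ucp K M T \<longleftrightarrow> T \<in> M \<rightarrow> M \<and>
     (\<forall>x\<in>M. \<forall>y\<in>M. T (op_add K x y) = op_add K (T x) (T y)) \<and>
     (\<forall>c. \<forall>x\<in>M. T (op_scale K c x) = op_scale K c (T x)) \<and>
     T (op_one K) = op_one K \<and> completely_positive K M T \<and> normal_map K M K M T"

definition CP0_semigroup ::
    "('a, 'z) hilb_scheme \<Rightarrow> ('a \<Rightarrow> 'a) set \<Rightarrow> (real \<Rightarrow> ('a \<Rightarrow> 'a) \<Rightarrow> ('a \<Rightarrow> 'a)) \<Rightarrow> bool" where
  "CP0_semigroup K M T \<longleftrightarrow>
     (\<forall>t\<ge>0. normal_ucp K M (T t)) \<and>
     (\<forall>x\<in>M. T 0 x = x) \<and>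
     (\<forall>s\<ge>0. \<forall>t\<ge>0. \<forall>x\<in>M. T s (T t x) = T (s + t) x) \<and>
     (\<forall>x\<in>M. \<forall>\<omega>. normal_functional K M \<omega> \<longrightarrow> continuous_on {0..} (\<lambda>t. \<omega> (T t x)))"


section \<open>Modules over a von Neumann algebra\<close>

text \<open>The type \<open>'m\<close> is that of the elements of the von Neumann algebra.\<close>

record ('m, 'a) rmod = "'a hilb" +
  ract :: "'a \<Rightarrow> 'm \<Rightarrow> 'a"

record ('m, 'a) bimod = "('m, 'a) rmod" +
  lact :: "'m \<Rightarrow> 'a \<Rightarrow> 'a"

definition rop :: "('m, 'a, 'z) rmod_scheme \<Rightarrow> 'm \<Rightarrow> ('a \<Rightarrow> 'a)" where
  "rop H x = (\<lambda>\<xi>\<in>carrier H. ract H \<xi> x)"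

definition lop :: "('m, 'a, 'z) bimod_scheme \<Rightarrow> 'm \<Rightarrow> ('a \<Rightarrow> 'a)" where
  "lop H x = (\<lambda>\<xi>\<in>carrier H. lact H x \<xi>)"

definition right_W_module ::
    "('k, 'y) hilb_scheme \<Rightarrow> ('k \<Rightarrow> 'k) set \<Rightarrow> ('k \<Rightarrow> 'k, 'a, 'z) rmod_scheme \<Rightarrow> bool" where
  "right_W_module K M H \<longleftrightarrow> hilbert_space H \<and> normal_antirep K M H (rop H)"

definition W_bimodule ::
    "('k, 'y) hilb_scheme \<Rightarrow> ('k \<Rightarrow> 'k) set \<Rightarrow> ('k \<Rightarrow> 'k, 'a, 'z) bimod_scheme \<Rightarrow> bool" where
  "W_bimodule K M H \<longleftrightarrow> right_W_module K M H \<and> normal_rep K M H (lop H) \<and>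
     (\<forall>x\<in>M. \<forall>y\<in>M. \<forall>\<xi>\<in>carrier H. ract H (lact H x \<xi>) y = lact H x (ract H \<xi> y))"

definition right_linear :: "'m set \<Rightarrow>
    ('m, 'a, 'z) rmod_scheme \<Rightarrow> ('m, 'b, 'y) rmod_scheme \<Rightarrow> ('a \<Rightarrow> 'b) \<Rightarrow> bool" where
  "right_linear M H G f \<longleftrightarrow> (\<forall>x\<in>M. \<forall>\<xi>\<in>carrier H. f (ract H \<xi> x) = ract G (f \<xi>) x)"

definition left_linear :: "'m set \<Rightarrow>
    ('m, 'a, 'z) bimod_scheme \<Rightarrow> ('m, 'b, 'y) bimod_scheme \<Rightarrow> ('a \<Rightarrow> 'b) \<Rightarrow> bool" where
  "left_linear M H G f \<longleftrightarrow> (\<forall>x\<in>M. \<forall>\<xi>\<in>carrier H. f (lact H x \<xi>) = lact G x (f \<xi>))"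

definition bimodule_unitary :: "'m set \<Rightarrow>
    ('m, 'a, 'z) bimod_scheme \<Rightarrow> ('m, 'b, 'y) bimod_scheme \<Rightarrow> ('a \<Rightarrow> 'b) \<Rightarrow> bool" where
  "bimodule_unitary M H G f \<longleftrightarrow>
     unitary_map H G f \<and> left_linear M H G f \<and> right_linear M H G f"


section \<open>The standing data and the relative tensor product\<close>

text \<open>\<open>M\<close> is an arbitrary von Neumann algebra, represented on \<open>K\<close>; \<open>L2\<close> is its standard space, on
  which \<open>M\<close> acts from the left by an isomorphism onto an algebra in standard form and from the right
  by \<open>\<xi> x = J x\<^sup>* J \<xi>\<close>; \<open>\<Omega>\<close> is the vector \<open>\<phi>\<^sup>1\<^sup>/\<^sup>2\<close>, the vector of the positive cone that
  represents \<open>\<phi>\<close>.\<close>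

locale standard_space =
  fixes K :: "'k hilb"
    and M :: "('k \<Rightarrow> 'k) set"
    and \<phi> :: "('k \<Rightarrow> 'k) \<Rightarrow> complex"
    and L2 :: "('k \<Rightarrow> 'k, 'h) bimod"
    and J :: "'h \<Rightarrow> 'h"
    and P :: "'h set"
    and \<Omega> :: 'h
  assumes von_neumann: "von_neumann_algebra K M"
    and state: "faithful_normal_state K M \<phi>"
    and L2_bimodule: "W_bimodule K M L2"
    and L2_left: "vn_isomorphism K M L2 (lop L2 ` M) (lop L2)"
    and L2_standard: "standard_form L2 (lop L2 ` M) J P"
    and L2_right: "\<lbrakk>x \<in> M; \<xi> \<in> carrier L2\<rbrakk> \<Longrightarrow> ract L2 \<xi> x = J (lact L2 (adjoint K K x) (J \<xi>))"
    and Omega_cone: "\<Omega> \<in> P"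
    and Omega_state: "x \<in> M \<Longrightarrow> \<phi> x = ip L2 \<Omega> (lact L2 x \<Omega>)"
begin

definition bounded_vectors :: "('k \<Rightarrow> 'k, 'a, 'z) rmod_scheme \<Rightarrow> 'a set" where
  "bounded_vectors H = {\<xi> \<in> carrier H.
     \<exists>c>0. \<forall>x\<in>M. vnorm H (ract H \<xi> x) \<le> c * vnorm L2 (ract L2 \<Omega> x)}"

definition pi_phi :: "('k \<Rightarrow> 'k, 'a, 'z) rmod_scheme \<Rightarrow> 'a \<Rightarrow> ('h \<Rightarrow> 'a)" where
  "pi_phi H \<xi> = (THE f. f \<in> bounded_ops L2 H \<and> (\<forall>x\<in>M. f (ract L2 \<Omega> x) = ract H \<xi> x))"

text \<open>\<open>\<pi>\<^sub>\<phi>(\<xi>)\<^sup>* \<pi>\<^sub>\<phi>(\<eta>)\<close> as an element of \<open>M\<close>, under the identification of \<open>M\<close> with the right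
  \<open>M\<close>-linear bounded operators on \<open>L2\<close>.\<close>

definition pi_star_pi :: "('k \<Rightarrow> 'k, 'a, 'z) rmod_scheme \<Rightarrow> 'a \<Rightarrow> 'a \<Rightarrow> ('k \<Rightarrow> 'k)" where
  "pi_star_pi H \<xi> \<eta> = (THE m. m \<in> M \<and>
     lop L2 m = compose (carrier L2) (adjoint L2 H (pi_phi H \<xi>)) (pi_phi H \<eta>))"

text \<open>The algebraic tensor product is presented by formal linear combinations of pairs: the bilinearity
  relations lie in the kernel of the semi-inner product, so both have the same separation.\<close>

definition formal_tensors ::
    "('k \<Rightarrow> 'k, 'a, 'z) rmod_scheme \<Rightarrow> ('k \<Rightarrow> 'k, 'b, 'y) bimod_scheme \<Rightarrow>
     ('a \<times> 'b \<Rightarrow>\<^sub>0 complex) set" where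
  "formal_tensors H G = {p. Poly_Mapping.keys p \<subseteq> bounded_vectors H \<times> carrier G}"

definition tensor_form ::
    "('k \<Rightarrow> 'k, 'a, 'z) rmod_scheme \<Rightarrow> ('k \<Rightarrow> 'k, 'b, 'y) bimod_scheme \<Rightarrow>
     ('a \<times> 'b \<Rightarrow>\<^sub>0 complex) \<Rightarrow> ('a \<times> 'b \<Rightarrow>\<^sub>0 complex) \<Rightarrow> complex" where
  "tensor_form H G p q = (\<Sum>(\<xi>\<^sub>1, \<eta>\<^sub>1)\<in>Poly_Mapping.keys p. \<Sum>(\<xi>\<^sub>2, \<eta>\<^sub>2)\<in>Poly_Mapping.keys q.
     cnj (Poly_Mapping.lookup p (\<xi>\<^sub>1, \<eta>\<^sub>1)) * Poly_Mapping.lookup q (\<xi>\<^sub>2, \<eta>\<^sub>2) *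
     ip G \<eta>\<^sub>1 (lact G (pi_star_pi H \<xi>\<^sub>1 \<xi>\<^sub>2) \<eta>\<^sub>2))"

definition tensor_seminorm ::
    "('k \<Rightarrow> 'k, 'a, 'z) rmod_scheme \<Rightarrow> ('k \<Rightarrow> 'k, 'b, 'y) bimod_scheme \<Rightarrow>
     ('a \<times> 'b \<Rightarrow>\<^sub>0 complex) \<Rightarrow> real" where
  "tensor_seminorm H G p = sqrt (Re (tensor_form H G p p))"

definition cauchy_tensors ::
    "('k \<Rightarrow> 'k, 'a, 'z) rmod_scheme \<Rightarrow> ('k \<Rightarrow> 'k, 'b, 'y) bimod_scheme \<Rightarrow>
     (nat \<Rightarrow> 'a \<times> 'b \<Rightarrow>\<^sub>0 complex) set" where
  "cauchy_tensors H G = {p. (\<forall>n. p n \<in> formal_tensors H G) \<and>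
     (\<forall>e>0. \<exists>N. \<forall>m\<ge>N. \<forall>n\<ge>N. tensor_seminorm H G (p m - p n) < e)}"

definition tensor_rel ::
    "('k \<Rightarrow> 'k, 'a, 'z) rmod_scheme \<Rightarrow> ('k \<Rightarrow> 'k, 'b, 'y) bimod_scheme \<Rightarrow>
     ((nat \<Rightarrow> 'a \<times> 'b \<Rightarrow>\<^sub>0 complex) \<times> (nat \<Rightarrow> 'a \<times> 'b \<Rightarrow>\<^sub>0 complex)) set" where
  "tensor_rel H G = {(p, q). p \<in> cauchy_tensors H G \<and> q \<in> cauchy_tensors H G \<and>
     (\<lambda>n. tensor_seminorm H G (p n - q n)) \<longlonglongrightarrow> 0}"

text \<open>The formal combination obtained by applying \<open>f\<close> to the pairs and \<open>g\<close> to the coefficients.\<close>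

definition push :: "('c \<Rightarrow> 'd) \<Rightarrow> (complex \<Rightarrow> complex) \<Rightarrow> ('c \<Rightarrow>\<^sub>0 complex) \<Rightarrow> ('d \<Rightarrow>\<^sub>0 complex)" where
  "push f g p = (\<Sum>k\<in>Poly_Mapping.keys p. Poly_Mapping.single (f k) (g (Poly_Mapping.lookup p k)))"

definition rel_tensor ::
    "('k \<Rightarrow> 'k, 'a, 'z) rmod_scheme \<Rightarrow> ('k \<Rightarrow> 'k, 'b, 'y) bimod_scheme \<Rightarrow>
     ('k \<Rightarrow> 'k, (nat \<Rightarrow> 'a \<times> 'b \<Rightarrow>\<^sub>0 complex) set) rmod" (infixl \<open>\<otimes>\<^sub>R\<close> 70) where
  "H \<otimes>\<^sub>R G = \<lparr>
     carrier = cauchy_tensors H G // tensor_rel H G,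
     monoid.mult = (\<lambda>_ _. undefined),
     monoid.one = undefined,
     ring.zero = tensor_rel H G `` {\<lambda>_. 0},
     ring.add = (\<lambda>A B. \<Union>p\<in>A. \<Union>q\<in>B. tensor_rel H G `` {\<lambda>n. p n + q n}),
     module.smult = (\<lambda>c A. \<Union>p\<in>A. tensor_rel H G `` {\<lambda>n. push id (\<lambda>z. c * z) (p n)}),
     ip = (\<lambda>A B. the_elem (\<Union>p\<in>A. \<Union>q\<in>B. {lim (\<lambda>n. tensor_form H G (p n) (q n))})),
     ract = (\<lambda>A x. \<Union>p\<in>A. tensor_rel H G `` {\<lambda>n. push (\<lambda>(\<xi>, \<eta>). (\<xi>, ract G \<eta> x)) id (p n)})\<rparr>"

text \<open>The same space for a bimodule on the left, together with the inherited left action.\<close>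

definition bi_tensor ::
    "('k \<Rightarrow> 'k, 'a, 'z) bimod_scheme \<Rightarrow> ('k \<Rightarrow> 'k, 'b, 'y) bimod_scheme \<Rightarrow>
     ('k \<Rightarrow> 'k, (nat \<Rightarrow> 'a \<times> 'b \<Rightarrow>\<^sub>0 complex) set) bimod" (infixl \<open>\<otimes>\<^sub>B\<close> 70) where
  "H \<otimes>\<^sub>B G = rmod.extend (H \<otimes>\<^sub>R G) (bimod.fields
     (\<lambda>x A. \<Union>p\<in>A. tensor_rel H G `` {\<lambda>n. push (\<lambda>(\<xi>, \<eta>). (lact H x \<xi>, \<eta>)) id (p n)}))"

text \<open>The vector \<open>\<xi> \<phi>\<^sup>-\<^sup>1\<^sup>/\<^sup>2 \<eta>\<close>.\<close>

definition tens ::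
    "('k \<Rightarrow> 'k, 'a, 'z) rmod_scheme \<Rightarrow> ('k \<Rightarrow> 'k, 'b, 'y) bimod_scheme \<Rightarrow> 'a \<Rightarrow> 'b \<Rightarrow>
     (nat \<Rightarrow> 'a \<times> 'b \<Rightarrow>\<^sub>0 complex) set" where
  "tens H G \<xi> \<eta> = tensor_rel H G `` {\<lambda>_. Poly_Mapping.single (\<xi>, \<eta>) 1}"

definition tensor_map ::
    "('k \<Rightarrow> 'k, 'a) bimod \<Rightarrow> ('k \<Rightarrow> 'k, 'b) bimod \<Rightarrow>
     ('k \<Rightarrow> 'k, 'c) bimod \<Rightarrow> ('k \<Rightarrow> 'k, 'd) bimod \<Rightarrow> ('a \<Rightarrow> 'c) \<Rightarrow> ('b \<Rightarrow> 'd) \<Rightarrow>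
     ((nat \<Rightarrow> 'a \<times> 'b \<Rightarrow>\<^sub>0 complex) set \<Rightarrow> (nat \<Rightarrow> 'c \<times> 'd \<Rightarrow>\<^sub>0 complex) set)" where
  "tensor_map H G H' G' f g = (THE F. F \<in> bounded_ops (H \<otimes>\<^sub>B G) (H' \<otimes>\<^sub>B G') \<and>
     (\<forall>\<xi>\<in>bounded_vectors H. \<forall>\<eta>\<in>carrier G. F (tens H G \<xi> \<eta>) = tens H' G' (f \<xi>) (g \<eta>)))"

definition associator where
  "associator H G L = (THE F. F \<in> bounded_ops ((H \<otimes>\<^sub>B G) \<otimes>\<^sub>B L) (H \<otimes>\<^sub>B (G \<otimes>\<^sub>B L)) \<and>
     (\<forall>\<xi>\<in>bounded_vectors H. \<forall>\<eta>\<in>bounded_vectors G. \<forall>\<zeta>\<in>carrier L.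
        F (tens (H \<otimes>\<^sub>B G) L (tens H G \<xi> \<eta>) \<zeta>) = tens H (G \<otimes>\<^sub>B L) \<xi> (tens G L \<eta> \<zeta>)))"

end


section \<open>Product systems, units and inductive limits\<close>

text \<open>The canonical identifications are \<open>(x \<phi>\<^sup>1\<^sup>/\<^sup>2) \<phi>\<^sup>-\<^sup>1\<^sup>/\<^sup>2 \<eta> \<mapsto> x \<eta>\<close> and
  \<open>\<xi> \<phi>\<^sup>-\<^sup>1\<^sup>/\<^sup>2 (\<phi>\<^sup>1\<^sup>/\<^sup>2 x) \<mapsto> \<xi> x\<close>; these values determine them.\<close>

locale product_system = standard_space K M \<phi> L2 J P \<Omega>
  for K :: "'k hilb" and M \<phi> and L2 :: "('k \<Rightarrow> 'k, 'h) bimod" and J P \<Omega> +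
  fixes H :: "real \<Rightarrow> ('k \<Rightarrow> 'k, 'h) bimod"
    and U :: "real \<Rightarrow> real \<Rightarrow> (nat \<Rightarrow> 'h \<times> 'h \<Rightarrow>\<^sub>0 complex) set \<Rightarrow> 'h"
  assumes H_bimodule: "0 \<le> t \<Longrightarrow> W_bimodule K M (H t)"
    and H_0: "H 0 = L2"
    and U_unitary: "\<lbrakk>0 \<le> s; 0 \<le> t\<rbrakk>
      \<Longrightarrow> bimodule_unitary M (H s \<otimes>\<^sub>B H t) (H (s + t)) (U s t)"
    and U_assoc: "\<lbrakk>0 \<le> r; 0 \<le> s; 0 \<le> t; v \<in> carrier ((H r \<otimes>\<^sub>B H s) \<otimes>\<^sub>B H t)\<rbrakk> \<Longrightarrow>
      U r (s + t) (tensor_map (H r) (H s \<otimes>\<^sub>B H t) (H r) (H (s + t)) id (U s t)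
        (associator (H r) (H s) (H t) v)) =
      U (r + s) t (tensor_map (H r \<otimes>\<^sub>B H s) (H t) (H (r + s)) (H t) (U r s) id v)"
    and U_left: "\<lbrakk>0 \<le> t; x \<in> M; \<eta> \<in> carrier (H t)\<rbrakk>
      \<Longrightarrow> U 0 t (tens (H 0) (H t) (lact L2 x \<Omega>) \<eta>) = lact (H t) x \<eta>"
    and U_right: "\<lbrakk>0 \<le> s; x \<in> M; \<xi> \<in> bounded_vectors (H s)\<rbrakk>
      \<Longrightarrow> U s 0 (tens (H s) (H 0) \<xi> (ract L2 \<Omega> x)) = ract (H s) \<xi> x"
begin

definition phi_unit :: "(real \<Rightarrow> 'h) \<Rightarrow> bool" where
  "phi_unit \<Xi> \<longleftrightarrow> (\<forall>t\<ge>0. \<Xi> t \<in> bounded_vectors (H t)) \<and> \<Xi> 0 = \<Omega> \<and>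
     (\<forall>s\<ge>0. \<forall>t\<ge>0. U s t (tens (H s) (H t) (\<Xi> s) (\<Xi> t)) = \<Xi> (s + t))"

definition unital :: "(real \<Rightarrow> 'h) \<Rightarrow> bool" where
  "unital \<Xi> \<longleftrightarrow> (\<forall>t\<ge>0. pi_star_pi (H t) (\<Xi> t) (\<Xi> t) = op_one K)"

definition unit_semigroup :: "(real \<Rightarrow> 'h) \<Rightarrow> real \<Rightarrow> ('k \<Rightarrow> 'k) \<Rightarrow> ('k \<Rightarrow> 'k)" where
  "unit_semigroup \<Xi> t x = pi_star_pi (H t) (\<Xi> t) (lact (H t) x (\<Xi> t))"

text \<open>\<open>connecting \<Xi> t s\<close> is the map \<open>b\<^sub>t\<^sub>,\<^sub>s : H\<^sub>s \<rightarrow> H\<^sub>t\<close>, for \<open>0 \<le> s \<le> t\<close>.\<close>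

definition connecting :: "(real \<Rightarrow> 'h) \<Rightarrow> real \<Rightarrow> real \<Rightarrow> 'h \<Rightarrow> 'h" where
  "connecting \<Xi> t s \<xi> = U (t - s) s (tens (H (t - s)) (H s) (\<Xi> (t - s)) \<xi>)"

text \<open>The inductive limit of a directed system of isometries, up to a unique isomorphism: a compatible
  family of isometric embeddings with jointly dense ranges.\<close>

definition inductive_limit ::
    "(real \<Rightarrow> 'h) \<Rightarrow> ('k \<Rightarrow> 'k, 'g) rmod \<Rightarrow> (real \<Rightarrow> 'h \<Rightarrow> 'g) \<Rightarrow> bool" where
  "inductive_limit \<Xi> HH \<kappa> \<longleftrightarrow> right_W_module K M HH \<and>
     (\<forall>t\<ge>0. isometric_map (H t) HH (\<kappa> t) \<and> right_linear M (H t) HH (\<kappa> t)) \<and>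
     (\<forall>s t. 0 \<le> s \<and> s \<le> t \<longrightarrow>
        (\<forall>\<xi>\<in>carrier (H s). \<kappa> t (connecting \<Xi> t s \<xi>) = \<kappa> s \<xi>)) \<and>
     norm_topology HH closure_of (\<Union>t\<in>{0..}. \<kappa> t ` carrier (H t)) = carrier HH"

text \<open>\<open>V t\<close> is the unitary \<open>U\<^sub>t\<close>; the vectors \<open>\<kappa>\<^sub>s(\<xi>) \<phi>\<^sup>-\<^sup>1\<^sup>/\<^sup>2 \<eta>\<close> are total, so it is unique.\<close>

definition limit_unitaries :: "('k \<Rightarrow> 'k, 'g) rmod \<Rightarrow> (real \<Rightarrow> 'h \<Rightarrow> 'g) \<Rightarrow>
    (real \<Rightarrow> (nat \<Rightarrow> 'g \<times> 'h \<Rightarrow>\<^sub>0 complex) set \<Rightarrow> 'g) \<Rightarrow> bool" where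
  "limit_unitaries HH \<kappa> V \<longleftrightarrow> (\<forall>t\<ge>0.
     unitary_map (HH \<otimes>\<^sub>R H t) HH (V t) \<and> right_linear M (HH \<otimes>\<^sub>R H t) HH (V t) \<and>
     (\<forall>s\<ge>0. \<forall>\<xi>\<in>bounded_vectors (H s). \<forall>\<eta>\<in>carrier (H t).
        V t (tens HH (H t) (\<kappa> s \<xi>) \<eta>) = \<kappa> (s + t) (U s t (tens (H s) (H t) \<xi> \<eta>))))"

end

locale unit_inductive_limit = product_system K M \<phi> L2 J P \<Omega> H U
  for K :: "'k hilb" and M \<phi> and L2 :: "('k \<Rightarrow> 'k, 'h) bimod" and J P \<Omega> H U +
  fixes \<Xi> :: "real \<Rightarrow> 'h"
    and HH :: "('k \<Rightarrow> 'k, 'g) rmod"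
    and \<kappa> :: "real \<Rightarrow> 'h \<Rightarrow> 'g"
    and V :: "real \<Rightarrow> (nat \<Rightarrow> 'g \<times> 'h \<Rightarrow>\<^sub>0 complex) set \<Rightarrow> 'g"
  assumes unit: "phi_unit \<Xi>"
    and unital: "unital \<Xi>"
    and limit: "inductive_limit \<Xi> HH \<kappa>"
    and unitaries: "limit_unitaries HH \<kappa> V"

end

theory Submission
  imports Defs "HOL-Analysis.Uniform_Limit"
begin

text \<open>Write \<open>\<pi>\<^sub>t\<close> for the isometry \<open>\<pi>\<^sub>\<phi>(\<xi>(t))\<close>, so that \<open>\<langle>\<alpha>, T\<^sub>t(x) \<beta>\<rangle> = \<langle>\<pi>\<^sub>t \<alpha>, x \<pi>\<^sub>t \<beta>\<rangle>\<close>, and \<open>\<Omega>\<close> for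
  \<open>\<phi>\<^sup>1\<^sup>/\<^sup>2\<close>.  Since \<open>\<kappa>\<^sub>0 = \<kappa>\<^sub>t \<pi>\<^sub>t\<close>, the distance of \<open>\<kappa>\<^sub>t(x \<xi>(t))\<close> and \<open>\<kappa>\<^sub>0(x \<Omega>)\<close> has the square
  \<open>\<phi>(T\<^sub>t(x\<^sup>* x)) - 2 Re \<langle>x \<Omega>, T\<^sub>t(x) \<Omega>\<rangle> + \<phi>(x\<^sup>* x)\<close>, which vanishes in the limit if \<open>T\<close> is continuous.
  Conversely, this distance dominates \<open>\<parallel>T\<^sub>t(x) \<Omega> - x \<Omega>\<parallel>\<close>.  If it tends to \<open>0\<close> for all \<open>x\<close>, the semigroup law
  makes \<open>r \<mapsto> T\<^sub>r(x) \<Omega>\<close> right continuous, hence continuous at some point \<open>p\<close> of every interval; as \<open>\<Omega> M\<close>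
  is dense and \<open>T\<close> contractive, \<open>r \<mapsto> \<omega>(T\<^sub>r(x))\<close> is then continuous at \<open>p\<close> for all normal \<open>\<omega>\<close>, and by the
  semigroup law at all later times.

  Positivity of the tensor product form, complete positivity of \<open>T\<^sub>t\<close> and contractivity of
  representations all come from one principle: a matrix over \<open>M\<close> that is positive in one faithful
  normal representation is a strongly convergent sum of matrices \<open>b\<^sup>* b\<close> over \<open>M\<close>, hence is positive on all
  normal functionals that are positive on such \<open>b\<^sup>* b\<close>.\<close>

section \<open>Hilbert spaces\<close>

text \<open>Positivity has to change its space. The matrix of the elements
  \<open>\<pi>\<^sub>\<phi>(\<xi>\<^sub>i)\<^sup>* \<pi>\<^sub>\<phi>(\<xi>\<^sub>j)\<close> is
  visibly a Gram matrix on \<open>L2\<close>, but the form of the relative tensor product evaluates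
  it on the second factor. Likewise complete positivity is tested on \<open>K\<close>, whereas
  \<open>T\<^sub>t\<close> is described on \<open>L2\<close>. Without this transport there is no
  Cauchy-Schwarz inequality for formal tensors, hence no way to see that the inner product and the
  two actions, written as unions over representatives, have a value. Only elementary tensors,
  classes of constant sequences, have to be evaluated.

  The convergence at 0 is assumed for every element of \<open>M\<close>, so it may be used at
  \<open>T\<^sub>r(x)\<close>; this controls the times after \<open>r\<close>. The times before
  \<open>r\<close> would call for the same estimate at the moving elements
  \<open>T\<^sub>r\<^sub>-\<^sub>h(x)\<close>, with no uniformity in \<open>h\<close>. This is why a
  point of two-sided continuity is found first. From there normality of \<open>T\<^sub>q\<close>
  carries continuity forward: not the norm at \<open>\<Omega>\<close>, but the values of normal
  functionals.\<close>

lemma ring_of_type_algebra_simps [simp]: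
  "carrier (ring_of_type_algebra :: complex ring) = UNIV"
  "a \<oplus>\<^bsub>(ring_of_type_algebra :: complex ring)\<^esub> b = a + b"
  "a \<otimes>\<^bsub>(ring_of_type_algebra :: complex ring)\<^esub> b = a * b"
  "\<zero>\<^bsub>(ring_of_type_algebra :: complex ring)\<^esub> = 0"
  "\<one>\<^bsub>(ring_of_type_algebra :: complex ring)\<^esub> = 1"
  by (simp_all add: ring_of_type_algebra_def)

section \<open>Nonnegative complex numbers and scalar inequalities\<close>

lemma nonneg_Reals_sum: "(\<And>i. i \<in> A \<Longrightarrow> f i \<in> \<real>\<^sub>\<ge>\<^sub>0) \<Longrightarrow> sum f A \<in> (\<real>\<^sub>\<ge>\<^sub>0 :: complex set)"
  by (induction A rule: infinite_finite_induct) auto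

lemma of_real_diff_squares_nonneg:
  assumes "0 \<le> b" "b \<le> a"
  shows "complex_of_real (a\<^sup>2 - b\<^sup>2) \<in> \<real>\<^sub>\<ge>\<^sub>0"
  using power_mono[OF assms(2,1), of 2] by (subst nonneg_Reals_of_real_iff) simp

text \<open>Cancels one norm after an application of Cauchy-Schwarz. If that norm is 0, the
  conclusion is the nonnegativity of \<open>b\<close>.\<close>

lemma mult_self_le_imp_le:
  fixes a b :: real
  assumes "a * a \<le> a * b" "0 \<le> a" "0 \<le> b"
  shows "a \<le> b"
  using assms by (cases "a = 0") (auto simp: mult_le_cancel_left)

text \<open>The expression is the value of a sesquilinear form at u + c v, with \<open>a\<close>,
  \<open>b\<close>, \<open>b'\<close>, \<open>d\<close> its values at (u,u), (u,v), (v,u), (v,v). In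
  this scalar shape it serves inner products, matrices over \<open>M\<close> and formal tensors
  alike. Hermitian symmetry is a conclusion: nonnegative numbers are real, and c = 1 and c = i read
  off the imaginary and the real part.\<close>

lemma sesquilinear_Cauchy_Schwarz:
  fixes a b b' d :: complex
  assumes pos: "\<And>c. a + c * b + cnj c * b' + cnj c * c * d \<in> \<real>\<^sub>\<ge>\<^sub>0" and d: "d \<in> \<real>\<^sub>\<ge>\<^sub>0"
  shows "b' = cnj b" "(cmod b)\<^sup>2 \<le> Re a * Re d"
proof -
  have a: "Re a \<ge> 0" "Im a = 0" using pos[of 0] by (auto simp: complex_nonneg_Reals_iff)
  have d': "Re d \<ge> 0" "Im d = 0" using d by (auto simp: complex_nonneg_Reals_iff)
  have "Im b + Im b' = 0" using pos[of 1] a d' by (auto simp: complex_nonneg_Reals_iff)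
  moreover have "Re b - Re b' = 0" using pos[of \<i>] a d' by (auto simp: complex_nonneg_Reals_iff)
  ultimately show b': "b' = cnj b" by (auto simp: complex_eq_iff)
  have cc: "b * cnj b = of_real ((cmod b)\<^sup>2)" by (simp add: complex_norm_square[symmetric])
  \<comment> \<open>The choice c = -t cnj b aligns the phases and leaves a real quadratic polynomial
    in t.\<close>
  have real: "Re a - 2 * t * (cmod b)\<^sup>2 + t\<^sup>2 * (cmod b)\<^sup>2 * Re d \<ge> 0" for t :: real
  proof -
    have "a + (- of_real t * cnj b) * b + cnj (- of_real t * cnj b) * b'
          + cnj (- of_real t * cnj b) * (- of_real t * cnj b) * d
        = a - 2 * of_real t * (b * cnj b) + of_real (t\<^sup>2) * (b * cnj b) * d"
      unfolding b' by (simp add: power2_eq_square algebra_simps)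
    also have "Re \<dots> = Re a - 2 * t * (cmod b)\<^sup>2 + t\<^sup>2 * (cmod b)\<^sup>2 * Re d"
      unfolding cc by simp
    finally show ?thesis
      using pos[of "- of_real t * cnj b"] by (auto simp: complex_nonneg_Reals_iff)
  qed
  show "(cmod b)\<^sup>2 \<le> Re a * Re d"
  proof (cases "Re d = 0")
    case True
    have "b = 0"
    proof (rule ccontr)
      assume "b \<noteq> 0"
      \<comment> \<open>With d = 0 the polynomial is affine in t, and here it takes the value
        -1.\<close>
      then show False using real[of "(Re a + 1) / (2 * (cmod b)\<^sup>2)"] True
        by (simp add: field_simps)
    qed
    then show ?thesis using True by simp
  next
    case False
    then have "Re d > 0" using d' by simp
    \<comment> \<open>This t is where the quadratic polynomial is smallest.\<close>
    then show ?thesis using real[of "1 / Re d"] by (simp add: field_simps power2_eq_square)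
  qed
qed

section \<open>Algebra of the inner product and the norm\<close>

context hilbert_space
begin

lemma ip_zero_right [simp]: "\<xi> \<in> carrier H \<Longrightarrow> ip H \<xi> \<zero>\<^bsub>H\<^esub> = 0"
  using ip_add[of \<xi> "\<zero>\<^bsub>H\<^esub>" "\<zero>\<^bsub>H\<^esub>"] by simp

lemma ip_minus_right [simp]:
  "\<lbrakk>\<xi> \<in> carrier H; \<eta> \<in> carrier H\<rbrakk> \<Longrightarrow> ip H \<xi> (\<ominus>\<^bsub>H\<^esub> \<eta>) = - ip H \<xi> \<eta>"
  using ip_add[of \<xi> \<eta> "\<ominus>\<^bsub>H\<^esub> \<eta>"] by (simp add: M.r_neg add_eq_0_iff)

lemma ip_diff_right [simp]:
  "\<lbrakk>\<xi> \<in> carrier H; \<eta> \<in> carrier H; \<zeta> \<in> carrier H\<rbrakk>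
    \<Longrightarrow> ip H \<xi> (\<eta> \<ominus>\<^bsub>H\<^esub> \<zeta>) = ip H \<xi> \<eta> - ip H \<xi> \<zeta>"
  by (simp add: a_minus_def ip_add)

lemma ip_zero_left [simp]: "\<xi> \<in> carrier H \<Longrightarrow> ip H \<zero>\<^bsub>H\<^esub> \<xi> = 0"
  by (subst ip_cnj[of \<xi>]) auto

lemma ip_add_left:
  "\<lbrakk>\<xi> \<in> carrier H; \<eta> \<in> carrier H; \<zeta> \<in> carrier H\<rbrakk>
    \<Longrightarrow> ip H (\<eta> \<oplus>\<^bsub>H\<^esub> \<zeta>) \<xi> = ip H \<eta> \<xi> + ip H \<zeta> \<xi>"
  by (subst (1 2 3) ip_cnj[of \<xi>]) (auto simp: ip_add)

lemma ip_smult_left: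
  "\<lbrakk>\<xi> \<in> carrier H; \<eta> \<in> carrier H\<rbrakk> \<Longrightarrow> ip H (c \<odot>\<^bsub>H\<^esub> \<eta>) \<xi> = cnj c * ip H \<eta> \<xi>"
  by (subst (1 2) ip_cnj[of \<xi>]) (auto simp: ip_smult)

lemma ip_diff_left [simp]:
  "\<lbrakk>\<xi> \<in> carrier H; \<eta> \<in> carrier H; \<zeta> \<in> carrier H\<rbrakk>
    \<Longrightarrow> ip H (\<eta> \<ominus>\<^bsub>H\<^esub> \<zeta>) \<xi> = ip H \<eta> \<xi> - ip H \<zeta> \<xi>"
  by (subst (1 2 3) ip_cnj[of \<xi>]) auto

lemmas ip_simps = ip_add ip_smult ip_add_left ip_smult_left

lemma diff_closed [simp, intro]:
  "\<lbrakk>\<xi> \<in> carrier H; \<eta> \<in> carrier H\<rbrakk> \<Longrightarrow> \<xi> \<ominus>\<^bsub>H\<^esub> \<eta> \<in> carrier H"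
  by (simp add: a_minus_def)

lemma diff_eq_zero_iff [simp]:
  assumes "\<xi> \<in> carrier H" "\<eta> \<in> carrier H"
  shows "\<xi> \<ominus>\<^bsub>H\<^esub> \<eta> = \<zero>\<^bsub>H\<^esub> \<longleftrightarrow> \<xi> = \<eta>"
proof
  assume "\<xi> \<ominus>\<^bsub>H\<^esub> \<eta> = \<zero>\<^bsub>H\<^esub>"
  then have "\<ominus>\<^bsub>H\<^esub> (\<ominus>\<^bsub>H\<^esub> \<eta>) = \<xi>" using assms by (intro M.minus_equality) (auto simp: a_minus_def)
  then show "\<xi> = \<eta>" using assms by simp
qed (use assms in \<open>simp add: a_minus_def M.r_neg\<close>)

text \<open>The working tool for identities between linear combinations: tested against a vector,
  they become identities of complex numbers, which the simplifier can normalise.\<close>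

lemma vec_eqI:
  assumes "\<xi> \<in> carrier H" "\<eta> \<in> carrier H" "\<And>\<zeta>. \<zeta> \<in> carrier H \<Longrightarrow> ip H \<zeta> \<xi> = ip H \<zeta> \<eta>"
  shows "\<xi> = \<eta>"
proof -
  have "ip H (\<xi> \<ominus>\<^bsub>H\<^esub> \<eta>) (\<xi> \<ominus>\<^bsub>H\<^esub> \<eta>) = 0" using assms by simp
  then have "\<xi> \<ominus>\<^bsub>H\<^esub> \<eta> = \<zero>\<^bsub>H\<^esub>" using assms by (intro ip_definite) auto
  then show ?thesis using assms by simp
qed

lemma vec_eqI_left:
  assumes "\<xi> \<in> carrier H" "\<eta> \<in> carrier H" "\<And>\<zeta>. \<zeta> \<in> carrier H \<Longrightarrow> ip H \<xi> \<zeta> = ip H \<eta> \<zeta>"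
  shows "\<xi> = \<eta>"
  using assms by (intro vec_eqI) (metis ip_cnj)+

lemma ip_self: "\<xi> \<in> carrier H \<Longrightarrow> ip H \<xi> \<xi> = of_real ((vnorm H \<xi>)\<^sup>2)"
  using ip_cnj[of \<xi> \<xi>] ip_nonneg[of \<xi>] by (auto simp: vnorm_def complex_eq_iff)

lemma ip_self_nonneg_Reals: "\<xi> \<in> carrier H \<Longrightarrow> ip H \<xi> \<xi> \<in> \<real>\<^sub>\<ge>\<^sub>0"
  by (simp add: ip_self flip: of_real_power)

lemma vnorm_sq: "\<xi> \<in> carrier H \<Longrightarrow> (vnorm H \<xi>)\<^sup>2 = Re (ip H \<xi> \<xi>)"
  by (simp add: ip_self)

lemma vnorm_nonneg [simp]: "\<xi> \<in> carrier H \<Longrightarrow> 0 \<le> vnorm H \<xi>"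
  by (simp add: vnorm_def ip_nonneg)

lemma Cauchy_Schwarz:
  assumes "\<xi> \<in> carrier H" "\<eta> \<in> carrier H"
  shows "cmod (ip H \<xi> \<eta>) \<le> vnorm H \<xi> * vnorm H \<eta>"
proof -
  have "(cmod (ip H \<xi> \<eta>))\<^sup>2 \<le> Re (ip H \<xi> \<xi>) * Re (ip H \<eta> \<eta>)"
  proof (rule sesquilinear_Cauchy_Schwarz(2))
    fix c
    have "ip H (\<xi> \<oplus>\<^bsub>H\<^esub> c \<odot>\<^bsub>H\<^esub> \<eta>) (\<xi> \<oplus>\<^bsub>H\<^esub> c \<odot>\<^bsub>H\<^esub> \<eta>) \<in> \<real>\<^sub>\<ge>\<^sub>0"
      using assms by (intro ip_self_nonneg_Reals) auto
    then show "ip H \<xi> \<xi> + c * ip H \<xi> \<eta> + cnj c * ip H \<eta> \<xi> + cnj c * c * ip H \<eta> \<eta> \<in> \<real>\<^sub>\<ge>\<^sub>0"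
      using assms by (simp add: ip_simps algebra_simps)
  qed (use assms ip_self_nonneg_Reals in auto)
  then have "(cmod (ip H \<xi> \<eta>))\<^sup>2 \<le> (vnorm H \<xi> * vnorm H \<eta>)\<^sup>2"
    using assms by (simp add: power_mult_distrib vnorm_sq)
  then show ?thesis by (rule power2_le_imp_le) (use assms in auto)
qed

lemma vnorm_zero [simp]: "vnorm H \<zero>\<^bsub>H\<^esub> = 0"
  by (simp add: vnorm_def)

lemma vnorm_eq_0: "\<xi> \<in> carrier H \<Longrightarrow> vnorm H \<xi> = 0 \<longleftrightarrow> \<xi> = \<zero>\<^bsub>H\<^esub>"
  by (metis ip_definite ip_self of_real_0 power_zero_numeral vnorm_zero)

lemma vnorm_smult: "\<xi> \<in> carrier H \<Longrightarrow> vnorm H (c \<odot>\<^bsub>H\<^esub> \<xi>) = cmod c * vnorm H \<xi>"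
proof -
  assume "\<xi> \<in> carrier H"
  then have "(vnorm H (c \<odot>\<^bsub>H\<^esub> \<xi>))\<^sup>2 = (cmod c * vnorm H \<xi>)\<^sup>2"
    by (simp add: vnorm_sq power_mult_distrib ip_smult ip_smult_left cmod_power2)
      (simp add: power2_eq_square algebra_simps)
  then show ?thesis by (rule power2_eq_imp_eq) (use \<open>\<xi> \<in> carrier H\<close> in auto)
qed

lemma vnorm_add_sq:
  assumes "\<xi> \<in> carrier H" "\<eta> \<in> carrier H"
  shows "(vnorm H (\<xi> \<oplus>\<^bsub>H\<^esub> \<eta>))\<^sup>2 = (vnorm H \<xi>)\<^sup>2 + 2 * Re (ip H \<xi> \<eta>) + (vnorm H \<eta>)\<^sup>2"
  using assms ip_cnj[of \<xi> \<eta>] by (simp add: vnorm_sq ip_simps)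

lemma vnorm_diff_sq:
  assumes "\<xi> \<in> carrier H" "\<eta> \<in> carrier H"
  shows "(vnorm H (\<xi> \<ominus>\<^bsub>H\<^esub> \<eta>))\<^sup>2 = (vnorm H \<xi>)\<^sup>2 - 2 * Re (ip H \<xi> \<eta>) + (vnorm H \<eta>)\<^sup>2"
  using assms ip_cnj[of \<xi> \<eta>] by (simp add: vnorm_sq ip_simps)

lemma vnorm_triangle:
  assumes "\<xi> \<in> carrier H" "\<eta> \<in> carrier H"
  shows "vnorm H (\<xi> \<oplus>\<^bsub>H\<^esub> \<eta>) \<le> vnorm H \<xi> + vnorm H \<eta>"
proof -
  have "Re (ip H \<xi> \<eta>) \<le> vnorm H \<xi> * vnorm H \<eta>"
    using Cauchy_Schwarz[OF assms] complex_Re_le_cmod[of "ip H \<xi> \<eta>"] by linarith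
  then have "(vnorm H (\<xi> \<oplus>\<^bsub>H\<^esub> \<eta>))\<^sup>2 \<le> (vnorm H \<xi> + vnorm H \<eta>)\<^sup>2"
    using assms by (simp add: vnorm_add_sq power2_sum)
  then show ?thesis by (rule power2_le_imp_le) (use assms in auto)
qed

lemma vnorm_minus_commute:
  "\<lbrakk>\<xi> \<in> carrier H; \<eta> \<in> carrier H\<rbrakk> \<Longrightarrow> vnorm H (\<xi> \<ominus>\<^bsub>H\<^esub> \<eta>) = vnorm H (\<eta> \<ominus>\<^bsub>H\<^esub> \<xi>)"
  by (simp add: vnorm_def)

lemma vnorm_diff_triangle:
  assumes "\<xi> \<in> carrier H" "\<eta> \<in> carrier H" "\<zeta> \<in> carrier H"
  shows "vnorm H (\<xi> \<ominus>\<^bsub>H\<^esub> \<zeta>) \<le> vnorm H (\<xi> \<ominus>\<^bsub>H\<^esub> \<eta>) + vnorm H (\<eta> \<ominus>\<^bsub>H\<^esub> \<zeta>)"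
proof -
  have "\<xi> \<ominus>\<^bsub>H\<^esub> \<zeta> = (\<xi> \<ominus>\<^bsub>H\<^esub> \<eta>) \<oplus>\<^bsub>H\<^esub> (\<eta> \<ominus>\<^bsub>H\<^esub> \<zeta>)"
    using assms by (intro vec_eqI) (auto simp: ip_simps)
  then show ?thesis using assms vnorm_triangle by simp
qed

lemma vnorm_le_add_diff:
  assumes "\<xi> \<in> carrier H" "\<eta> \<in> carrier H"
  shows "vnorm H \<xi> \<le> vnorm H \<eta> + vnorm H (\<xi> \<ominus>\<^bsub>H\<^esub> \<eta>)"
proof -
  have "\<xi> = \<eta> \<oplus>\<^bsub>H\<^esub> (\<xi> \<ominus>\<^bsub>H\<^esub> \<eta>)" using assms by (intro vec_eqI) (auto simp: ip_simps)
  then show ?thesis using assms vnorm_triangle[of \<eta> "\<xi> \<ominus>\<^bsub>H\<^esub> \<eta>"] by simp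
qed

section \<open>Norm topology, completeness and limits\<close>

lemma Metric_space_vdist: "Metric_space (carrier H) (vdist H)"
proof
  fix x y z
  show "0 \<le> vdist H x y" by (auto simp: vdist_def)
  show "vdist H x y = vdist H y x" by (auto simp: vdist_def vnorm_minus_commute)
  show "x \<in> carrier H \<Longrightarrow> y \<in> carrier H \<Longrightarrow> (vdist H x y = 0) = (x = y)"
    by (auto simp: vdist_def vnorm_eq_0)
  show "\<lbrakk>x \<in> carrier H; y \<in> carrier H; z \<in> carrier H\<rbrakk> \<Longrightarrow> vdist H x z \<le> vdist H x y + vdist H y z"
    by (auto simp: vdist_def vnorm_diff_triangle)
qed

text \<open>Membership is asked only eventually, since \<open>\<kappa> t\<close> is controlled only
  for nonnegative times.\<close>

lemma limitin_norm_topology: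
  assumes f: "\<forall>\<^sub>F t in F. f t \<in> carrier H" and l: "l \<in> carrier H"
  shows "limitin (norm_topology H) f l F \<longleftrightarrow> ((\<lambda>t. vnorm H (f t \<ominus>\<^bsub>H\<^esub> l)) \<longlongrightarrow> 0) F"
proof -
  have "((\<lambda>t. vdist H (f t) l) \<longlongrightarrow> 0) F \<longleftrightarrow> ((\<lambda>t. vnorm H (f t \<ominus>\<^bsub>H\<^esub> l)) \<longlongrightarrow> 0) F"
    using f by (intro tendsto_cong) (auto simp: vdist_def l elim!: eventually_mono)
  then show ?thesis
    using assms by (simp add: norm_topology_def Metric_space.limitin_metric_dist_null[OF Metric_space_vdist])
qed

lemma Cauchy_convergent:
  assumes s: "\<And>n::nat. s n \<in> carrier H"
    and "\<And>e. e > 0 \<Longrightarrow> \<exists>N. \<forall>m\<ge>N. \<forall>n\<ge>N. vnorm H (s m \<ominus>\<^bsub>H\<^esub> s n) < e"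
  shows "\<exists>l\<in>carrier H. (\<lambda>n. vnorm H (s n \<ominus>\<^bsub>H\<^esub> l)) \<longlonglongrightarrow> 0"
proof -
  interpret MS: Metric_space "carrier H" "vdist H" by (rule Metric_space_vdist)
  have "MS.MCauchy s"
    unfolding MS.MCauchy_def using assms by (auto simp: vdist_def)
  then obtain l where l: "limitin MS.mtopology s l sequentially"
    using complete MS.mcomplete_def by blast
  then have "l \<in> carrier H" by (simp add: MS.limitin_metric)
  then show ?thesis
    using l limitin_norm_topology[of s sequentially l] s by (auto simp: norm_topology_def)
qed

lemma ip_tendsto_left:
  assumes "\<And>n. s n \<in> carrier H" "l \<in> carrier H" "\<xi> \<in> carrier H"
    and lim: "((\<lambda>n. vnorm H (s n \<ominus>\<^bsub>H\<^esub> l)) \<longlongrightarrow> 0) F"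
  shows "((\<lambda>n. ip H (s n) \<xi>) \<longlongrightarrow> ip H l \<xi>) F"
proof (rule Lim_null[THEN iffD2], rule Lim_null_comparison)
  show "\<forall>\<^sub>F n in F. cmod (ip H (s n) \<xi> - ip H l \<xi>) \<le> vnorm H (s n \<ominus>\<^bsub>H\<^esub> l) * vnorm H \<xi>"
    using assms Cauchy_Schwarz[of "s _ \<ominus>\<^bsub>H\<^esub> l" \<xi>] by (intro always_eventually) auto
  show "((\<lambda>n. vnorm H (s n \<ominus>\<^bsub>H\<^esub> l) * vnorm H \<xi>) \<longlongrightarrow> 0) F"
    using tendsto_mult_right[OF lim, of "vnorm H \<xi>"] by simp
qed

text \<open>Riesz representation is stated relative to such a set because it is applied twice: on
  the whole space it gives adjoints, and on the closure of \<open>\<Omega> M\<close> it gives the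
  orthogonal projection.\<close>

definition closed_subspace :: "'a set \<Rightarrow> bool" where
  "closed_subspace S \<longleftrightarrow> S \<subseteq> carrier H \<and> \<zero>\<^bsub>H\<^esub> \<in> S \<and>
     (\<forall>\<xi>\<in>S. \<forall>\<eta>\<in>S. \<xi> \<oplus>\<^bsub>H\<^esub> \<eta> \<in> S) \<and> (\<forall>c. \<forall>\<xi>\<in>S. c \<odot>\<^bsub>H\<^esub> \<xi> \<in> S) \<and>
     (\<forall>s l. (\<forall>n::nat. s n \<in> S) \<and> l \<in> carrier H \<and> (\<lambda>n. vnorm H (s n \<ominus>\<^bsub>H\<^esub> l)) \<longlonglongrightarrow> 0 \<longrightarrow> l \<in> S)"

lemma
  assumes "closed_subspace S"
  shows closed_subspace_subset: "\<xi> \<in> S \<Longrightarrow> \<xi> \<in> carrier H"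
    and closed_subspace_zero: "\<zero>\<^bsub>H\<^esub> \<in> S"
    and closed_subspace_add: "\<lbrakk>\<xi> \<in> S; \<eta> \<in> S\<rbrakk> \<Longrightarrow> \<xi> \<oplus>\<^bsub>H\<^esub> \<eta> \<in> S"
    and closed_subspace_smult: "\<xi> \<in> S \<Longrightarrow> a \<odot>\<^bsub>H\<^esub> \<xi> \<in> S"
    and closed_subspace_lim: "\<lbrakk>\<And>n::nat. s n \<in> S; l \<in> carrier H; (\<lambda>n. vnorm H (s n \<ominus>\<^bsub>H\<^esub> l)) \<longlonglongrightarrow> 0\<rbrakk> \<Longrightarrow> l \<in> S"
  using assms unfolding closed_subspace_def by blast+

lemma closed_subspace_carrier: "closed_subspace (carrier H)"
  by (auto simp: closed_subspace_def)

text \<open>The representing vector minimises \<open>\<parallel>\<zeta>\<parallel>\<^sup>2 - 2 Re (f \<zeta>)\<close> over \<open>S\<close>.\<close>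

lemma Riesz_representation:
  assumes S: "closed_subspace S"
    and add: "\<And>\<xi> \<eta>. \<lbrakk>\<xi> \<in> S; \<eta> \<in> S\<rbrakk> \<Longrightarrow> f (\<xi> \<oplus>\<^bsub>H\<^esub> \<eta>) = f \<xi> + f \<eta>"
    and smult: "\<And>a \<xi>. \<xi> \<in> S \<Longrightarrow> f (a \<odot>\<^bsub>H\<^esub> \<xi>) = a * f \<xi>"
    and bounded: "\<And>\<xi>. \<xi> \<in> S \<Longrightarrow> cmod (f \<xi>) \<le> c * vnorm H \<xi>"
  shows "\<exists>\<zeta>\<in>S. \<forall>\<xi>\<in>S. ip H \<zeta> \<xi> = f \<xi>"
proof -
  note SH = closed_subspace_subset[OF S] and Sadd = closed_subspace_add[OF S]
    and Ssm = closed_subspace_smult[OF S]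
  define G where "G \<zeta> = (vnorm H \<zeta>)\<^sup>2 - 2 * Re (f \<zeta>)" for \<zeta>
  have "G \<zeta> \<ge> - c\<^sup>2" if "\<zeta> \<in> S" for \<zeta>
  proof -
    have "Re (f \<zeta>) \<le> c * vnorm H \<zeta>" using bounded[OF that] complex_Re_le_cmod[of "f \<zeta>"] by linarith
    moreover have "(vnorm H \<zeta> - c)\<^sup>2 \<ge> 0" by simp
    ultimately show ?thesis by (simp add: G_def power2_diff mult.commute)
  qed
  then have bdd: "bdd_below (G ` S)" by (auto intro!: bdd_belowI)
  have ne: "G ` S \<noteq> {}" using closed_subspace_zero[OF S] by blast
  define m where "m = Inf (G ` S)"
  have m: "m \<le> G \<zeta>" if "\<zeta> \<in> S" for \<zeta> unfolding m_def using bdd that by (auto intro: cInf_lower)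
  have "\<exists>\<zeta>\<in>S. G \<zeta> < m + 1 / real (Suc n)" for n
    using cInf_lessD[OF ne, of "m + 1 / real (Suc n)"] by (auto simp: m_def)
  then obtain s where s: "\<And>n. s n \<in> S" "\<And>n. G (s n) < m + 1 / real (Suc n)" by metis
  \<comment> \<open>The parallelogram law expresses the squared distance by \<open>G\<close> at the
    two vectors and at their midpoint, where \<open>G\<close> is at least \<open>m\<close>. Hence
    the minimising sequence is Cauchy.\<close>
  have dist: "(vnorm H (s n \<ominus>\<^bsub>H\<^esub> s k))\<^sup>2 \<le> 2 / real (Suc n) + 2 / real (Suc k)" for n k
  proof -
    have mid: "(1/2) \<odot>\<^bsub>H\<^esub> (s n \<oplus>\<^bsub>H\<^esub> s k) \<in> S" using s by (intro Ssm Sadd)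
    have sn: "s n \<in> S" "s k \<in> S" "s n \<oplus>\<^bsub>H\<^esub> s k \<in> S" using s Sadd by auto
    have n: "(vnorm H ((1/2) \<odot>\<^bsub>H\<^esub> (s n \<oplus>\<^bsub>H\<^esub> s k)))\<^sup>2 = (vnorm H (s n \<oplus>\<^bsub>H\<^esub> s k))\<^sup>2 / 4"
      using sn by (simp add: vnorm_smult SH power_mult_distrib power2_eq_square)
    have f: "f ((1/2) \<odot>\<^bsub>H\<^esub> (s n \<oplus>\<^bsub>H\<^esub> s k)) = (f (s n) + f (s k)) / 2"
      using sn by (simp add: smult add)
    have "(vnorm H (s n \<oplus>\<^bsub>H\<^esub> s k))\<^sup>2 + (vnorm H (s n \<ominus>\<^bsub>H\<^esub> s k))\<^sup>2
        = 2 * (vnorm H (s n))\<^sup>2 + 2 * (vnorm H (s k))\<^sup>2"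
      using sn by (simp add: vnorm_add_sq vnorm_diff_sq SH)
    then have "G (s n) + G (s k) - 2 * G ((1/2) \<odot>\<^bsub>H\<^esub> (s n \<oplus>\<^bsub>H\<^esub> s k)) = (vnorm H (s n \<ominus>\<^bsub>H\<^esub> s k))\<^sup>2 / 2"
      unfolding G_def n f by simp
    then have "(vnorm H (s n \<ominus>\<^bsub>H\<^esub> s k))\<^sup>2 / 2 \<le> (m + 1 / real (Suc n)) + (m + 1 / real (Suc k)) - 2 * m"
      using m[OF mid] s(2)[of n] s(2)[of k] by linarith
    then show ?thesis by simp
  qed
  have "\<exists>N. \<forall>i\<ge>N. \<forall>n\<ge>N. vnorm H (s i \<ominus>\<^bsub>H\<^esub> s n) < e" if e: "e > 0" for e
  proof -
    obtain N where N: "inverse (real (Suc N)) < e\<^sup>2 / 4"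
      using reals_Archimedean[of "e\<^sup>2 / 4"] e by auto
    have "vnorm H (s i \<ominus>\<^bsub>H\<^esub> s n) < e" if "i \<ge> N" "n \<ge> N" for i n
    proof -
      have "1 / real (Suc i) \<le> 1 / real (Suc N)" "1 / real (Suc n) \<le> 1 / real (Suc N)"
        using that by (auto intro!: divide_left_mono)
      then have "(vnorm H (s i \<ominus>\<^bsub>H\<^esub> s n))\<^sup>2 < e\<^sup>2"
        using dist[of i n] N by (simp add: inverse_eq_divide)
      then show ?thesis using e by (simp add: power2_less_imp_less)
    qed
    then show ?thesis by blast
  qed
  then obtain l where l: "l \<in> carrier H" "(\<lambda>n. vnorm H (s n \<ominus>\<^bsub>H\<^esub> l)) \<longlonglongrightarrow> 0"
    using Cauchy_convergent[of s] s SH by blast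
  then have lS: "l \<in> S" using s(1) by (rule closed_subspace_lim[OF S, rotated])
  have "ip H l \<xi> = f \<xi>" if \<xi>: "\<xi> \<in> S" for \<xi>
  proof -
    define w where "w = ip H l \<xi> - f \<xi>"
    \<comment> \<open>The right-hand side is \<open>G\<close> at l + a \<xi> minus \<open>G\<close>
      at l. It is obtained as a limit along the minimising sequence, so that only inner products,
      and not \<open>f\<close>, have to pass to the limit.\<close>
    have var: "0 \<le> 2 * Re (a * w) + (cmod a)\<^sup>2 * (vnorm H \<xi>)\<^sup>2" for a
    proof (rule tendsto_le[OF trivial_limit_sequentially])
      have "(\<lambda>n. ip H (s n) \<xi>) \<longlonglongrightarrow> ip H l \<xi>"
        using s l \<xi> by (intro ip_tendsto_left) (auto simp: SH)
      then show "(\<lambda>n. 2 * Re (a * (ip H (s n) \<xi> - f \<xi>)) + (cmod a)\<^sup>2 * (vnorm H \<xi>)\<^sup>2)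
          \<longlonglongrightarrow> 2 * Re (a * w) + (cmod a)\<^sup>2 * (vnorm H \<xi>)\<^sup>2"
        unfolding w_def by (intro tendsto_intros)
      show "(\<lambda>n. - (1 / real (Suc n))) \<longlonglongrightarrow> 0"
        using LIMSEQ_inverse_real_of_nat[THEN tendsto_minus] by (simp add: inverse_eq_divide)
      have "- (1 / real (Suc n)) \<le> 2 * Re (a * (ip H (s n) \<xi> - f \<xi>)) + (cmod a)\<^sup>2 * (vnorm H \<xi>)\<^sup>2" for n
      proof -
        have "m \<le> G (s n \<oplus>\<^bsub>H\<^esub> a \<odot>\<^bsub>H\<^esub> \<xi>)" using s \<xi> by (intro m Sadd Ssm)
        moreover have "G (s n \<oplus>\<^bsub>H\<^esub> a \<odot>\<^bsub>H\<^esub> \<xi>) - G (s n) =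
            2 * Re (a * (ip H (s n) \<xi> - f \<xi>)) + (cmod a)\<^sup>2 * (vnorm H \<xi>)\<^sup>2"
          using s \<xi> by (simp add: G_def vnorm_add_sq vnorm_smult SH add Ssm smult ip_smult
              power_mult_distrib algebra_simps)
        ultimately show ?thesis using s(2)[of n] by linarith
      qed
      then show "\<forall>\<^sub>F n in sequentially. - (1 / real (Suc n))
          \<le> 2 * Re (a * (ip H (s n) \<xi> - f \<xi>)) + (cmod a)\<^sup>2 * (vnorm H \<xi>)\<^sup>2"
        by (intro always_eventually) auto
    qed
    \<comment> \<open>In the direction a = -t cnj w the linear term is negative of order t, and this
      t is small enough for the quadratic term not to make up for it. The added 1 covers \<xi> =
      0.\<close>
    define t where "t = 1 / ((vnorm H \<xi>)\<^sup>2 + 1)"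
    have t: "t > 0" "t * (vnorm H \<xi>)\<^sup>2 < 1"
      by (auto simp: t_def field_simps add_pos_nonneg add_nonneg_pos)
    have "w * cnj w = of_real ((cmod w)\<^sup>2)" by (simp add: complex_norm_square[symmetric])
    then have "- of_real t * cnj w * w = of_real (- t * (cmod w)\<^sup>2)" by (simp add: algebra_simps)
    then have re: "Re (- of_real t * cnj w * w) = - t * (cmod w)\<^sup>2" by (metis Re_complex_of_real)
    have "0 \<le> 2 * (- t * (cmod w)\<^sup>2) + (t * cmod w)\<^sup>2 * (vnorm H \<xi>)\<^sup>2"
      using var[of "- of_real t * cnj w"] t unfolding re by (simp add: norm_mult)
    also have "\<dots> = t * (cmod w)\<^sup>2 * (t * (vnorm H \<xi>)\<^sup>2 - 2)"
      by (simp add: power2_eq_square algebra_simps)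
    finally have "\<not> 0 < t * (cmod w)\<^sup>2" using t by (auto simp: zero_le_mult_iff)
    then have "w = 0" using t by (simp add: zero_less_mult_iff)
    then show ?thesis by (simp add: w_def)
  qed
  then show ?thesis using lS by blast
qed

end

lemma linear_mapD:
  assumes "linear_map H G f"
  shows "\<xi> \<in> carrier H \<Longrightarrow> f \<xi> \<in> carrier G"
    and "\<lbrakk>\<xi> \<in> carrier H; \<eta> \<in> carrier H\<rbrakk> \<Longrightarrow> f (\<xi> \<oplus>\<^bsub>H\<^esub> \<eta>) = f \<xi> \<oplus>\<^bsub>G\<^esub> f \<eta>"
    and "\<xi> \<in> carrier H \<Longrightarrow> f (c \<odot>\<^bsub>H\<^esub> \<xi>) = c \<odot>\<^bsub>G\<^esub> f \<xi>"
  using assms unfolding linear_map_def by auto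

lemma
  assumes "f \<in> bounded_ops H G"
  shows bounded_ops_closed: "\<xi> \<in> carrier H \<Longrightarrow> f \<xi> \<in> carrier G"
    and bounded_ops_add: "\<lbrakk>\<xi> \<in> carrier H; \<eta> \<in> carrier H\<rbrakk> \<Longrightarrow> f (\<xi> \<oplus>\<^bsub>H\<^esub> \<eta>) = f \<xi> \<oplus>\<^bsub>G\<^esub> f \<eta>"
    and bounded_ops_smult: "\<xi> \<in> carrier H \<Longrightarrow> f (c \<odot>\<^bsub>H\<^esub> \<xi>) = c \<odot>\<^bsub>G\<^esub> f \<xi>"
    and bounded_ops_extensional: "f \<in> extensional (carrier H)"
    and bounded_ops_linear: "linear_map H G f"
  using assms linear_mapD[of H G f] unfolding bounded_ops_def by auto

section \<open>Bounded operators\<close>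

locale hilbert_pair = H: hilbert_space H + G: hilbert_space G
  for H :: "('a, 'z) hilb_scheme" and G :: "('b, 'y) hilb_scheme"
begin

lemma linear_map_diff:
  assumes f: "linear_map H G f" and \<xi>: "\<xi> \<in> carrier H" "\<eta> \<in> carrier H"
  shows "f (\<xi> \<ominus>\<^bsub>H\<^esub> \<eta>) = f \<xi> \<ominus>\<^bsub>G\<^esub> f \<eta>"
proof -
  have "\<xi> \<ominus>\<^bsub>H\<^esub> \<eta> = \<xi> \<oplus>\<^bsub>H\<^esub> (-1) \<odot>\<^bsub>H\<^esub> \<eta>"
    using \<xi> by (intro H.vec_eqI) (auto simp: H.ip_simps)
  then have "f (\<xi> \<ominus>\<^bsub>H\<^esub> \<eta>) = f \<xi> \<oplus>\<^bsub>G\<^esub> (-1) \<odot>\<^bsub>G\<^esub> f \<eta>"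
    using \<xi> by (simp add: linear_mapD[OF f])
  also have "\<dots> = f \<xi> \<ominus>\<^bsub>G\<^esub> f \<eta>"
    using \<xi> by (intro G.vec_eqI) (auto simp: G.ip_simps linear_mapD[OF f])
  finally show ?thesis .
qed

lemmas bounded_ops_diff = linear_map_diff[OF bounded_ops_linear]

text \<open>The constant in the definition has no sign; a positive one is fixed here because later
  estimates divide by it.\<close>

lemma bounded_ops_bound:
  assumes "f \<in> bounded_ops H G"
  obtains c where "c > 0" "\<And>\<xi>. \<xi> \<in> carrier H \<Longrightarrow> vnorm G (f \<xi>) \<le> c * vnorm H \<xi>"
proof -
  obtain c where c: "\<forall>\<xi>\<in>carrier H. vnorm G (f \<xi>) \<le> c * vnorm H \<xi>"
    using assms unfolding bounded_ops_def by auto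
  show ?thesis
  proof
    show "\<bar>c\<bar> + 1 > 0" by simp
    show "vnorm G (f \<xi>) \<le> (\<bar>c\<bar> + 1) * vnorm H \<xi>" if "\<xi> \<in> carrier H" for \<xi>
    proof -
      have "c * vnorm H \<xi> \<le> (\<bar>c\<bar> + 1) * vnorm H \<xi>" using that by (intro mult_right_mono) auto
      then show ?thesis using c that by force
    qed
  qed
qed

lemma bounded_ops_eqI:
  assumes "f \<in> bounded_ops H G" "g \<in> bounded_ops H G"
    and "\<And>\<xi> \<eta>. \<lbrakk>\<xi> \<in> carrier H; \<eta> \<in> carrier G\<rbrakk> \<Longrightarrow> ip G \<eta> (f \<xi>) = ip G \<eta> (g \<xi>)"
  shows "f = g"
proof (rule extensionalityI[of _ "carrier H"])
  show "f \<xi> = g \<xi>" if "\<xi> \<in> carrier H" for \<xi>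
    using assms that by (intro G.vec_eqI) (auto intro: bounded_ops_closed)
qed (use assms in \<open>auto intro: bounded_ops_extensional\<close>)

lemma bounded_opsI:
  assumes "f \<in> extensional (carrier H)" "\<And>\<xi>. \<xi> \<in> carrier H \<Longrightarrow> f \<xi> \<in> carrier G"
    and "\<And>\<xi> \<eta>. \<lbrakk>\<xi> \<in> carrier H; \<eta> \<in> carrier H\<rbrakk> \<Longrightarrow> f (\<xi> \<oplus>\<^bsub>H\<^esub> \<eta>) = f \<xi> \<oplus>\<^bsub>G\<^esub> f \<eta>"
    and "\<And>\<xi> c. \<xi> \<in> carrier H \<Longrightarrow> f (c \<odot>\<^bsub>H\<^esub> \<xi>) = c \<odot>\<^bsub>G\<^esub> f \<xi>"
    and "\<And>\<xi>. \<xi> \<in> carrier H \<Longrightarrow> vnorm G (f \<xi>) \<le> c * vnorm H \<xi>"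
  shows "f \<in> bounded_ops H G"
  unfolding bounded_ops_def linear_map_def using assms by blast

section \<open>Adjoints of bounded operators\<close>

lemma adjoint_ex1:
  assumes f: "f \<in> bounded_ops H G" and \<eta>: "\<eta> \<in> carrier G"
  shows "\<exists>!\<zeta>. \<zeta> \<in> carrier H \<and> (\<forall>\<xi>\<in>carrier H. ip H \<zeta> \<xi> = ip G \<eta> (f \<xi>))"
proof -
  obtain c where c: "c > 0" "\<And>\<xi>. \<xi> \<in> carrier H \<Longrightarrow> vnorm G (f \<xi>) \<le> c * vnorm H \<xi>"
    using bounded_ops_bound[OF f] by blast
  have "\<exists>\<zeta>\<in>carrier H. \<forall>\<xi>\<in>carrier H. ip H \<zeta> \<xi> = ip G \<eta> (f \<xi>)"
  proof (rule H.Riesz_representation[OF H.closed_subspace_carrier])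
    fix \<xi> assume \<xi>: "\<xi> \<in> carrier H"
    have "cmod (ip G \<eta> (f \<xi>)) \<le> vnorm G \<eta> * vnorm G (f \<xi>)"
      using f \<eta> \<xi> by (intro G.Cauchy_Schwarz) (auto intro: bounded_ops_closed)
    also have "\<dots> \<le> vnorm G \<eta> * (c * vnorm H \<xi>)"
      using c \<xi> \<eta> by (intro mult_left_mono) auto
    finally show "cmod (ip G \<eta> (f \<xi>)) \<le> (vnorm G \<eta> * c) * vnorm H \<xi>" by (simp add: mult_ac)
  qed (use \<eta> in \<open>auto simp: bounded_ops_add[OF f] bounded_ops_smult[OF f] G.ip_simps bounded_ops_closed[OF f]\<close>)
  moreover have "\<zeta> = \<zeta>'" if "\<zeta> \<in> carrier H" "\<zeta>' \<in> carrier H"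
     "\<forall>\<xi>\<in>carrier H. ip H \<zeta> \<xi> = ip G \<eta> (f \<xi>)" "\<forall>\<xi>\<in>carrier H. ip H \<zeta>' \<xi> = ip G \<eta> (f \<xi>)" for \<zeta> \<zeta>'
    using that by (intro H.vec_eqI_left) auto
  ultimately show ?thesis by blast
qed

lemma
  assumes f: "f \<in> bounded_ops H G" and \<eta>: "\<eta> \<in> carrier G"
  shows adjoint_closed: "adjoint H G f \<eta> \<in> carrier H"
    and adjoint_left: "\<xi> \<in> carrier H \<Longrightarrow> ip H (adjoint H G f \<eta>) \<xi> = ip G \<eta> (f \<xi>)"
  using theI'[OF adjoint_ex1[OF f \<eta>]] \<eta> by (auto simp: adjoint_def)

lemma adjoint_right:
  assumes f: "f \<in> bounded_ops H G" and \<eta>: "\<eta> \<in> carrier G" and \<xi>: "\<xi> \<in> carrier H"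
  shows "ip H \<xi> (adjoint H G f \<eta>) = ip G (f \<xi>) \<eta>"
  using adjoint_left[OF assms] H.ip_cnj G.ip_cnj adjoint_closed[OF f \<eta>] bounded_ops_closed[OF f \<xi>] \<eta> \<xi>
  by metis

lemma adjoint_bounded_ops:
  assumes f: "f \<in> bounded_ops H G"
  shows "adjoint H G f \<in> bounded_ops G H"
proof -
  interpret flip: hilbert_pair G H ..
  obtain c where c: "c > 0" "\<And>\<xi>. \<xi> \<in> carrier H \<Longrightarrow> vnorm G (f \<xi>) \<le> c * vnorm H \<xi>"
    using bounded_ops_bound[OF f] by blast
  have ext: "adjoint H G f \<in> extensional (carrier G)" by (simp add: adjoint_def)
  note [simp] = adjoint_closed[OF f] adjoint_right[OF f] bounded_ops_closed[OF f]
  show ?thesis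
  proof (rule flip.bounded_opsI)
    fix \<eta> assume \<eta>: "\<eta> \<in> carrier G"
    let ?v = "adjoint H G f \<eta>"
    have "(vnorm H ?v)\<^sup>2 = Re (ip G (f ?v) \<eta>)" using \<eta> by (simp add: H.vnorm_sq)
    also have "\<dots> \<le> cmod (ip G (f ?v) \<eta>)" by (rule complex_Re_le_cmod)
    also have "\<dots> \<le> vnorm G (f ?v) * vnorm G \<eta>" using \<eta> by (intro G.Cauchy_Schwarz) auto
    also have "\<dots> \<le> c * vnorm H ?v * vnorm G \<eta>" using \<eta> c by (intro mult_right_mono) auto
    finally have "vnorm H ?v * vnorm H ?v \<le> vnorm H ?v * (c * vnorm G \<eta>)"
      by (simp add: power2_eq_square mult_ac)
    then show "vnorm H ?v \<le> c * vnorm G \<eta>"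
      by (rule mult_self_le_imp_le) (use adjoint_closed[OF f \<eta>] c \<eta> in auto)
  next
    fix \<xi> \<eta> assume "\<xi> \<in> carrier G" "\<eta> \<in> carrier G"
    then show "adjoint H G f (\<xi> \<oplus>\<^bsub>G\<^esub> \<eta>) = adjoint H G f \<xi> \<oplus>\<^bsub>H\<^esub> adjoint H G f \<eta>"
      by (intro H.vec_eqI) (auto simp: H.ip_simps G.ip_simps)
  next
    fix \<xi> c assume "\<xi> \<in> carrier G"
    then show "adjoint H G f (c \<odot>\<^bsub>G\<^esub> \<xi>) = c \<odot>\<^bsub>H\<^esub> adjoint H G f \<xi>"
      by (intro H.vec_eqI) (auto simp: H.ip_simps G.ip_simps)
  qed (use ext in auto)
qed

lemma adjoint_eqI:
  assumes f: "f \<in> bounded_ops H G" and g: "g \<in> bounded_ops G H"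
    and "\<And>\<xi> \<eta>. \<lbrakk>\<xi> \<in> carrier H; \<eta> \<in> carrier G\<rbrakk> \<Longrightarrow> ip H \<xi> (g \<eta>) = ip G (f \<xi>) \<eta>"
  shows "adjoint H G f = g"
proof -
  interpret flip: hilbert_pair G H ..
  show ?thesis
    using assms by (intro flip.bounded_ops_eqI) (auto simp: adjoint_bounded_ops adjoint_right)
qed

text \<open>Bounded operators extend from the dense domain of a bounded linear relation \<open>\<Gamma>\<close>; the value at
  \<open>\<alpha>\<close> is the unique \<open>l\<close> with \<open>\<parallel>v - l\<parallel> \<le> c \<parallel>u - \<alpha>\<parallel>\<close> for all \<open>(u, v)\<close> in \<open>\<Gamma>\<close>.\<close>

lemma bounded_extension:
  assumes \<Gamma>: "\<And>u v. (u, v) \<in> \<Gamma> \<Longrightarrow> u \<in> carrier H \<and> v \<in> carrier G"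
    and add: "\<And>u v u' v'. \<lbrakk>(u, v) \<in> \<Gamma>; (u', v') \<in> \<Gamma>\<rbrakk> \<Longrightarrow> (u \<oplus>\<^bsub>H\<^esub> u', v \<oplus>\<^bsub>G\<^esub> v') \<in> \<Gamma>"
    and smult: "\<And>u v a. (u, v) \<in> \<Gamma> \<Longrightarrow> (a \<odot>\<^bsub>H\<^esub> u, a \<odot>\<^bsub>G\<^esub> v) \<in> \<Gamma>"
    and bound: "\<And>u v. (u, v) \<in> \<Gamma> \<Longrightarrow> vnorm G v \<le> c * vnorm H u"
    and c: "c > 0"
    and dense: "\<And>\<alpha> e. \<lbrakk>\<alpha> \<in> carrier H; e > 0\<rbrakk> \<Longrightarrow> \<exists>u v. (u, v) \<in> \<Gamma> \<and> vnorm H (u \<ominus>\<^bsub>H\<^esub> \<alpha>) < e"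
  shows "\<exists>f\<in>bounded_ops H G. \<forall>(u, v)\<in>\<Gamma>. f u = v"
proof -
  have diff: "vnorm G (v \<ominus>\<^bsub>G\<^esub> v') \<le> c * vnorm H (u \<ominus>\<^bsub>H\<^esub> u')" if uv: "(u, v) \<in> \<Gamma>" "(u', v') \<in> \<Gamma>" for u v u' v'
  proof -
    have "(u \<oplus>\<^bsub>H\<^esub> (-1) \<odot>\<^bsub>H\<^esub> u', v \<oplus>\<^bsub>G\<^esub> (-1) \<odot>\<^bsub>G\<^esub> v') \<in> \<Gamma>" using that by (intro add smult)
    moreover have "u \<oplus>\<^bsub>H\<^esub> (-1) \<odot>\<^bsub>H\<^esub> u' = u \<ominus>\<^bsub>H\<^esub> u'" using \<Gamma>[OF uv(1)] \<Gamma>[OF uv(2)]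
      by (intro H.vec_eqI) (auto simp: H.ip_simps)
    moreover have "v \<oplus>\<^bsub>G\<^esub> (-1) \<odot>\<^bsub>G\<^esub> v' = v \<ominus>\<^bsub>G\<^esub> v'" using \<Gamma>[OF uv(1)] \<Gamma>[OF uv(2)]
      by (intro G.vec_eqI) (auto simp: G.ip_simps)
    ultimately show ?thesis using bound by metis
  qed
  define R where "R \<alpha> l \<longleftrightarrow> l \<in> carrier G \<and> (\<forall>(u, v)\<in>\<Gamma>. vnorm G (v \<ominus>\<^bsub>G\<^esub> l) \<le> c * vnorm H (u \<ominus>\<^bsub>H\<^esub> \<alpha>))" for \<alpha> l
  have ex: "\<exists>l. R \<alpha> l" if \<alpha>: "\<alpha> \<in> carrier H" for \<alpha>
  proof -
    have "\<forall>n. \<exists>u v. (u, v) \<in> \<Gamma> \<and> vnorm H (u \<ominus>\<^bsub>H\<^esub> \<alpha>) < inverse (real (Suc n))"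
      using dense[OF \<alpha>] by auto
    then obtain u v where uv: "\<And>n. (u n, v n) \<in> \<Gamma>" "\<And>n. vnorm H (u n \<ominus>\<^bsub>H\<^esub> \<alpha>) < inverse (real (Suc n))"
      by metis
    have mem: "u n \<in> carrier H" "v n \<in> carrier G" for n using \<Gamma>[OF uv(1)] by auto
    have "(\<lambda>n. vnorm H (u n \<ominus>\<^bsub>H\<^esub> \<alpha>)) \<longlonglongrightarrow> 0"
      by (rule tendsto_sandwich[OF _ _ tendsto_const LIMSEQ_inverse_real_of_nat])
        (use uv(2) mem \<alpha> in \<open>auto intro!: always_eventually less_imp_le\<close>)
    note u_lim = this
    have "\<exists>l\<in>carrier G. (\<lambda>n. vnorm G (v n \<ominus>\<^bsub>G\<^esub> l)) \<longlonglongrightarrow> 0"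
    proof (rule G.Cauchy_convergent)
      fix e :: real assume e: "e > 0"
      then have "e / (2 * c) > 0" using c by simp
      with u_lim have "\<forall>\<^sub>F n in sequentially. vnorm H (u n \<ominus>\<^bsub>H\<^esub> \<alpha>) < e / (2 * c)"
        by (intro order_tendstoD) auto
      then obtain N where N: "\<And>n. n \<ge> N \<Longrightarrow> vnorm H (u n \<ominus>\<^bsub>H\<^esub> \<alpha>) < e / (2 * c)"
        by (auto simp: eventually_sequentially)
      have "vnorm G (v m \<ominus>\<^bsub>G\<^esub> v n) < e" if "m \<ge> N" "n \<ge> N" for m n
      proof -
        have "vnorm H (u m \<ominus>\<^bsub>H\<^esub> u n) \<le> vnorm H (u m \<ominus>\<^bsub>H\<^esub> \<alpha>) + vnorm H (u n \<ominus>\<^bsub>H\<^esub> \<alpha>)"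
          using H.vnorm_diff_triangle[of "u m" \<alpha> "u n"] mem \<alpha> by (simp add: H.vnorm_minus_commute)
        also have "\<dots> < e / c" using N[OF that(1)] N[OF that(2)] by (simp add: field_simps)
        finally have "c * vnorm H (u m \<ominus>\<^bsub>H\<^esub> u n) < e" using c by (simp add: field_simps)
        then show ?thesis using diff[OF uv(1)[of m] uv(1)[of n]] by linarith
      qed
      then show "\<exists>N. \<forall>m\<ge>N. \<forall>n\<ge>N. vnorm G (v m \<ominus>\<^bsub>G\<^esub> v n) < e" by blast
    qed (rule mem)
    then obtain l where l: "l \<in> carrier G" "(\<lambda>n. vnorm G (v n \<ominus>\<^bsub>G\<^esub> l)) \<longlonglongrightarrow> 0" by blast
    have "vnorm G (v' \<ominus>\<^bsub>G\<^esub> l) \<le> c * vnorm H (u' \<ominus>\<^bsub>H\<^esub> \<alpha>)" if uv': "(u', v') \<in> \<Gamma>" for u' v'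
    proof (rule tendsto_lowerbound)
      show "(\<lambda>n. c * (vnorm H (u' \<ominus>\<^bsub>H\<^esub> \<alpha>) + vnorm H (u n \<ominus>\<^bsub>H\<^esub> \<alpha>)) + vnorm G (v n \<ominus>\<^bsub>G\<^esub> l))
          \<longlonglongrightarrow> c * vnorm H (u' \<ominus>\<^bsub>H\<^esub> \<alpha>)"
        by (rule tendsto_eq_intros u_lim l refl | simp)+
      have "vnorm G (v' \<ominus>\<^bsub>G\<^esub> l) \<le> c * (vnorm H (u' \<ominus>\<^bsub>H\<^esub> \<alpha>) + vnorm H (u n \<ominus>\<^bsub>H\<^esub> \<alpha>)) + vnorm G (v n \<ominus>\<^bsub>G\<^esub> l)" for n
      proof -
        have "vnorm G (v' \<ominus>\<^bsub>G\<^esub> l) \<le> vnorm G (v' \<ominus>\<^bsub>G\<^esub> v n) + vnorm G (v n \<ominus>\<^bsub>G\<^esub> l)"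
          using mem l \<Gamma>[OF uv'] by (intro G.vnorm_diff_triangle) auto
        moreover have "vnorm G (v' \<ominus>\<^bsub>G\<^esub> v n) \<le> c * vnorm H (u' \<ominus>\<^bsub>H\<^esub> u n)" using diff[OF uv' uv(1)] .
        moreover have "vnorm H (u' \<ominus>\<^bsub>H\<^esub> u n) \<le> vnorm H (u' \<ominus>\<^bsub>H\<^esub> \<alpha>) + vnorm H (u n \<ominus>\<^bsub>H\<^esub> \<alpha>)"
          using H.vnorm_diff_triangle[of u' \<alpha> "u n"] mem \<alpha> \<Gamma>[OF uv'] by (simp add: H.vnorm_minus_commute)
        then have "c * vnorm H (u' \<ominus>\<^bsub>H\<^esub> u n) \<le> c * (vnorm H (u' \<ominus>\<^bsub>H\<^esub> \<alpha>) + vnorm H (u n \<ominus>\<^bsub>H\<^esub> \<alpha>))"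
          using c by (intro mult_left_mono) auto
        ultimately show ?thesis by linarith
      qed
      then show "\<forall>\<^sub>F n in sequentially. vnorm G (v' \<ominus>\<^bsub>G\<^esub> l)
          \<le> c * (vnorm H (u' \<ominus>\<^bsub>H\<^esub> \<alpha>) + vnorm H (u n \<ominus>\<^bsub>H\<^esub> \<alpha>)) + vnorm G (v n \<ominus>\<^bsub>G\<^esub> l)"
        by (intro always_eventually) auto
    qed simp
    then show ?thesis using l by (auto simp: R_def)
  qed
  define f where "f = (\<lambda>\<alpha>\<in>carrier H. SOME l. R \<alpha> l)"
  have fR: "R \<alpha> (f \<alpha>)" if "\<alpha> \<in> carrier H" for \<alpha>
    using someI_ex[OF ex[OF that]] that by (simp add: f_def)
  have f_closed: "f \<alpha> \<in> carrier G" if "\<alpha> \<in> carrier H" for \<alpha> using fR[OF that] by (simp add: R_def)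
  have f_near: "vnorm G (v \<ominus>\<^bsub>G\<^esub> f \<alpha>) \<le> c * vnorm H (u \<ominus>\<^bsub>H\<^esub> \<alpha>)" if "\<alpha> \<in> carrier H" "(u, v) \<in> \<Gamma>" for \<alpha> u v
    using fR[OF that(1)] that(2) by (auto simp: R_def)
  \<comment> \<open>The value of \<open>f\<close> is identified by approximation in the graph: both
    errors go to 0, in the ratio \<open>c\<close>. Additivity, homogeneity and agreement with
    \<Gamma> are all instances.\<close>
  have f_eq: "f \<alpha> = l" if \<alpha>: "\<alpha> \<in> carrier H" and l: "l \<in> carrier G"
    and near: "\<And>e. e > 0 \<Longrightarrow> \<exists>u v. (u, v) \<in> \<Gamma> \<and> vnorm H (u \<ominus>\<^bsub>H\<^esub> \<alpha>) \<le> e \<and> vnorm G (v \<ominus>\<^bsub>G\<^esub> l) \<le> c * e" for \<alpha> l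
  proof -
    have "vnorm G (f \<alpha> \<ominus>\<^bsub>G\<^esub> l) \<le> 0 + e" if e: "e > 0" for e
    proof -
      have "e / (2 * c) > 0" using e c by simp
      from near[OF this] obtain u v where uv: "(u, v) \<in> \<Gamma>" "vnorm H (u \<ominus>\<^bsub>H\<^esub> \<alpha>) \<le> e / (2 * c)"
        "vnorm G (v \<ominus>\<^bsub>G\<^esub> l) \<le> c * (e / (2 * c))" by blast
      have "vnorm G (f \<alpha> \<ominus>\<^bsub>G\<^esub> l) \<le> vnorm G (f \<alpha> \<ominus>\<^bsub>G\<^esub> v) + vnorm G (v \<ominus>\<^bsub>G\<^esub> l)"
        using \<Gamma>[OF uv(1)] l f_closed[OF \<alpha>] by (intro G.vnorm_diff_triangle) auto
      moreover have "vnorm G (f \<alpha> \<ominus>\<^bsub>G\<^esub> v) \<le> c * vnorm H (u \<ominus>\<^bsub>H\<^esub> \<alpha>)"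
        using f_near[OF \<alpha> uv(1)] \<Gamma>[OF uv(1)] f_closed[OF \<alpha>] by (simp add: G.vnorm_minus_commute)
      moreover have "c * vnorm H (u \<ominus>\<^bsub>H\<^esub> \<alpha>) \<le> c * (e / (2 * c))" using uv c by (intro mult_left_mono) auto
      ultimately show ?thesis using uv(3) c by (simp add: field_simps)
    qed
    then have "vnorm G (f \<alpha> \<ominus>\<^bsub>G\<^esub> l) \<le> 0" by (rule field_le_epsilon)
    then have "vnorm G (f \<alpha> \<ominus>\<^bsub>G\<^esub> l) = 0"
      using G.vnorm_nonneg[OF G.diff_closed[OF f_closed[OF \<alpha>] l]] by simp
    then show ?thesis using f_closed[OF \<alpha>] l by (simp add: G.vnorm_eq_0)
  qed
  have "f \<in> bounded_ops H G"
  proof (rule bounded_opsI)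
    fix \<alpha> \<beta> assume \<alpha>: "\<alpha> \<in> carrier H" and \<beta>: "\<beta> \<in> carrier H"
    show "f (\<alpha> \<oplus>\<^bsub>H\<^esub> \<beta>) = f \<alpha> \<oplus>\<^bsub>G\<^esub> f \<beta>"
    proof (rule f_eq)
      fix e :: real assume "e > 0"
      then have e: "e / 2 > 0" by simp
      obtain u v where uv: "(u, v) \<in> \<Gamma>" "vnorm H (u \<ominus>\<^bsub>H\<^esub> \<alpha>) < e / 2" using dense[OF \<alpha> e] by blast
      obtain u' v' where uv': "(u', v') \<in> \<Gamma>" "vnorm H (u' \<ominus>\<^bsub>H\<^esub> \<beta>) < e / 2" using dense[OF \<beta> e] by blast
      note m = \<Gamma>[OF uv(1)] \<Gamma>[OF uv'(1)] f_closed[OF \<alpha>] f_closed[OF \<beta>] \<alpha> \<beta>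
      have "(u \<oplus>\<^bsub>H\<^esub> u') \<ominus>\<^bsub>H\<^esub> (\<alpha> \<oplus>\<^bsub>H\<^esub> \<beta>) = (u \<ominus>\<^bsub>H\<^esub> \<alpha>) \<oplus>\<^bsub>H\<^esub> (u' \<ominus>\<^bsub>H\<^esub> \<beta>)"
        using m by (intro H.vec_eqI) (auto simp: H.ip_simps)
      then have 1: "vnorm H ((u \<oplus>\<^bsub>H\<^esub> u') \<ominus>\<^bsub>H\<^esub> (\<alpha> \<oplus>\<^bsub>H\<^esub> \<beta>)) \<le> e"
        using H.vnorm_triangle[of "u \<ominus>\<^bsub>H\<^esub> \<alpha>" "u' \<ominus>\<^bsub>H\<^esub> \<beta>"] uv uv' m by simp
      have "(v \<oplus>\<^bsub>G\<^esub> v') \<ominus>\<^bsub>G\<^esub> (f \<alpha> \<oplus>\<^bsub>G\<^esub> f \<beta>) = (v \<ominus>\<^bsub>G\<^esub> f \<alpha>) \<oplus>\<^bsub>G\<^esub> (v' \<ominus>\<^bsub>G\<^esub> f \<beta>)"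
        using m by (intro G.vec_eqI) (auto simp: G.ip_simps)
      then have "vnorm G ((v \<oplus>\<^bsub>G\<^esub> v') \<ominus>\<^bsub>G\<^esub> (f \<alpha> \<oplus>\<^bsub>G\<^esub> f \<beta>)) \<le> c * vnorm H (u \<ominus>\<^bsub>H\<^esub> \<alpha>) + c * vnorm H (u' \<ominus>\<^bsub>H\<^esub> \<beta>)"
        using G.vnorm_triangle[of "v \<ominus>\<^bsub>G\<^esub> f \<alpha>" "v' \<ominus>\<^bsub>G\<^esub> f \<beta>"] m f_near[OF \<alpha> uv(1)] f_near[OF \<beta> uv'(1)]
        by simp
      also have "\<dots> \<le> c * (e / 2) + c * (e / 2)"
        using uv uv' c by (intro add_mono mult_left_mono) auto
      finally have 2: "vnorm G ((v \<oplus>\<^bsub>G\<^esub> v') \<ominus>\<^bsub>G\<^esub> (f \<alpha> \<oplus>\<^bsub>G\<^esub> f \<beta>)) \<le> c * e" by simp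
      show "\<exists>u v. (u, v) \<in> \<Gamma> \<and> vnorm H (u \<ominus>\<^bsub>H\<^esub> (\<alpha> \<oplus>\<^bsub>H\<^esub> \<beta>)) \<le> e \<and> vnorm G (v \<ominus>\<^bsub>G\<^esub> (f \<alpha> \<oplus>\<^bsub>G\<^esub> f \<beta>)) \<le> c * e"
        using add[OF uv(1) uv'(1)] 1 2 by blast
    qed (use \<alpha> \<beta> f_closed in auto)
  next
    fix \<alpha> and a :: complex assume \<alpha>: "\<alpha> \<in> carrier H"
    show "f (a \<odot>\<^bsub>H\<^esub> \<alpha>) = a \<odot>\<^bsub>G\<^esub> f \<alpha>"
    proof (rule f_eq)
      fix e :: real assume e: "e > 0"
      then have "e / (cmod a + 1) > 0" by (simp add: add_nonneg_pos)
      from dense[OF \<alpha> this] obtain u v where uv: "(u, v) \<in> \<Gamma>" "vnorm H (u \<ominus>\<^bsub>H\<^esub> \<alpha>) < e / (cmod a + 1)" by blast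
      note m = \<Gamma>[OF uv(1)] f_closed[OF \<alpha>] \<alpha>
      have "cmod a * vnorm H (u \<ominus>\<^bsub>H\<^esub> \<alpha>) \<le> (cmod a + 1) * vnorm H (u \<ominus>\<^bsub>H\<^esub> \<alpha>)"
        using m by (intro mult_right_mono) auto
      also have "\<dots> = vnorm H (u \<ominus>\<^bsub>H\<^esub> \<alpha>) * (cmod a + 1)" by (rule mult.commute)
      also have "\<dots> \<le> e"
        using uv(2) by (simp add: pos_less_divide_eq[THEN iffD1] add_nonneg_pos less_imp_le del: distrib_left)
      finally have a: "cmod a * vnorm H (u \<ominus>\<^bsub>H\<^esub> \<alpha>) \<le> e" .
      have "(a \<odot>\<^bsub>H\<^esub> u) \<ominus>\<^bsub>H\<^esub> (a \<odot>\<^bsub>H\<^esub> \<alpha>) = a \<odot>\<^bsub>H\<^esub> (u \<ominus>\<^bsub>H\<^esub> \<alpha>)"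
        using m by (intro H.vec_eqI) (auto simp: H.ip_simps algebra_simps)
      then have 1: "vnorm H ((a \<odot>\<^bsub>H\<^esub> u) \<ominus>\<^bsub>H\<^esub> (a \<odot>\<^bsub>H\<^esub> \<alpha>)) \<le> e" using a m by (simp add: H.vnorm_smult)
      have "(a \<odot>\<^bsub>G\<^esub> v) \<ominus>\<^bsub>G\<^esub> (a \<odot>\<^bsub>G\<^esub> f \<alpha>) = a \<odot>\<^bsub>G\<^esub> (v \<ominus>\<^bsub>G\<^esub> f \<alpha>)"
        using m by (intro G.vec_eqI) (auto simp: G.ip_simps algebra_simps)
      then have "vnorm G ((a \<odot>\<^bsub>G\<^esub> v) \<ominus>\<^bsub>G\<^esub> (a \<odot>\<^bsub>G\<^esub> f \<alpha>)) = cmod a * vnorm G (v \<ominus>\<^bsub>G\<^esub> f \<alpha>)"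
        using m by (simp add: G.vnorm_smult)
      also have "\<dots> \<le> cmod a * (c * vnorm H (u \<ominus>\<^bsub>H\<^esub> \<alpha>))" using f_near[OF \<alpha> uv(1)] by (intro mult_left_mono) auto
      also have "\<dots> = c * (cmod a * vnorm H (u \<ominus>\<^bsub>H\<^esub> \<alpha>))" by simp
      also have "\<dots> \<le> c * e" using a c by (intro mult_left_mono) auto
      finally have 2: "vnorm G ((a \<odot>\<^bsub>G\<^esub> v) \<ominus>\<^bsub>G\<^esub> (a \<odot>\<^bsub>G\<^esub> f \<alpha>)) \<le> c * e" .
      show "\<exists>u v. (u, v) \<in> \<Gamma> \<and> vnorm H (u \<ominus>\<^bsub>H\<^esub> (a \<odot>\<^bsub>H\<^esub> \<alpha>)) \<le> e \<and> vnorm G (v \<ominus>\<^bsub>G\<^esub> (a \<odot>\<^bsub>G\<^esub> f \<alpha>)) \<le> c * e"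
        using smult[OF uv(1)] 1 2 by blast
    qed (use \<alpha> f_closed in auto)
  next
    fix \<alpha> assume \<alpha>: "\<alpha> \<in> carrier H"
    show "vnorm G (f \<alpha>) \<le> c * vnorm H \<alpha>"
    proof (rule field_le_epsilon)
      fix e :: real assume "e > 0"
      then have "e / (2 * c) > 0" using c by simp
      from dense[OF \<alpha> this] obtain u v where uv: "(u, v) \<in> \<Gamma>" "vnorm H (u \<ominus>\<^bsub>H\<^esub> \<alpha>) < e / (2 * c)" by blast
      note m = \<Gamma>[OF uv(1)] f_closed[OF \<alpha>] \<alpha>
      have "vnorm G (f \<alpha>) \<le> vnorm G v + vnorm G (f \<alpha> \<ominus>\<^bsub>G\<^esub> v)" using m by (intro G.vnorm_le_add_diff) auto
      moreover have "vnorm G (f \<alpha> \<ominus>\<^bsub>G\<^esub> v) \<le> c * vnorm H (u \<ominus>\<^bsub>H\<^esub> \<alpha>)"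
        using f_near[OF \<alpha> uv(1)] m by (simp add: G.vnorm_minus_commute)
      moreover have "vnorm G v \<le> c * vnorm H u" using bound[OF uv(1)] .
      moreover have "c * vnorm H u \<le> c * (vnorm H \<alpha> + vnorm H (u \<ominus>\<^bsub>H\<^esub> \<alpha>))"
        using m c by (intro mult_left_mono H.vnorm_le_add_diff) auto
      moreover have "2 * (c * vnorm H (u \<ominus>\<^bsub>H\<^esub> \<alpha>)) \<le> e" using uv(2) c by (simp add: field_simps)
      ultimately show "vnorm G (f \<alpha>) \<le> c * vnorm H \<alpha> + e" by (simp add: algebra_simps)
    qed
  qed (auto simp: f_closed, simp add: f_def)
  moreover have "f u = v" if uv: "(u, v) \<in> \<Gamma>" for u v
  proof (rule f_eq)
    fix e :: real assume e: "e > 0"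
    show "\<exists>u' v'. (u', v') \<in> \<Gamma> \<and> vnorm H (u' \<ominus>\<^bsub>H\<^esub> u) \<le> e \<and> vnorm G (v' \<ominus>\<^bsub>G\<^esub> v) \<le> c * e"
      using \<Gamma>[OF uv] uv e c by (intro exI[of _ u] exI[of _ v]) (simp add: H.vnorm_eq_0[THEN iffD2] G.vnorm_eq_0[THEN iffD2])
  qed (use \<Gamma>[OF uv] in auto)
  ultimately show ?thesis by blast
qed

end

lemma compose_bounded_ops:
  assumes "hilbert_space H" "hilbert_space G" "hilbert_space L"
    and f: "f \<in> bounded_ops H G" and g: "g \<in> bounded_ops G L"
  shows "compose (carrier H) g f \<in> bounded_ops H L"
proof -
  interpret HG: hilbert_pair H G using assms by (simp add: hilbert_pair_def)
  interpret GL: hilbert_pair G L using assms by (simp add: hilbert_pair_def)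
  interpret HL: hilbert_pair H L using assms by (simp add: hilbert_pair_def)
  obtain c where c: "c > 0" "\<And>\<xi>. \<xi> \<in> carrier H \<Longrightarrow> vnorm G (f \<xi>) \<le> c * vnorm H \<xi>"
    using HG.bounded_ops_bound[OF f] by blast
  obtain d where d: "d > 0" "\<And>\<xi>. \<xi> \<in> carrier G \<Longrightarrow> vnorm L (g \<xi>) \<le> d * vnorm G \<xi>"
    using GL.bounded_ops_bound[OF g] by blast
  note [simp] = bounded_ops_closed[OF f] bounded_ops_closed[OF g] bounded_ops_add[OF f]
    bounded_ops_add[OF g] bounded_ops_smult[OF f] bounded_ops_smult[OF g]
  show ?thesis
  proof (rule HL.bounded_opsI)
    fix \<xi> assume \<xi>: "\<xi> \<in> carrier H"
    have "vnorm L (g (f \<xi>)) \<le> d * vnorm G (f \<xi>)" using \<xi> d by simp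
    also have "\<dots> \<le> d * (c * vnorm H \<xi>)" using \<xi> c d by (intro mult_left_mono) auto
    finally show "vnorm L (compose (carrier H) g f \<xi>) \<le> (d * c) * vnorm H \<xi>"
      using \<xi> by (simp add: compose_eq mult_ac)
  qed (auto simp: compose_eq)
qed

lemma commutant_iff:
  "y \<in> commutant K S \<longleftrightarrow> y \<in> bounded_ops K K \<and> (\<forall>x\<in>S. \<forall>\<xi>\<in>carrier K. x (y \<xi>) = y (x \<xi>))"
  by (auto simp: commutant_def compose_def restrict_def fun_eq_iff)

section \<open>Von Neumann algebras and normal functionals\<close>

locale vn_algebra =
  fixes K :: "('a, 'z) hilb_scheme" and M :: "('a \<Rightarrow> 'a) set"
  assumes vn: "von_neumann_algebra K M"
begin

sublocale K: hilbert_space K using vn by (simp add: von_neumann_algebra_def)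
sublocale KK: hilbert_pair K K ..

lemma M_bounded: "x \<in> M \<Longrightarrow> x \<in> bounded_ops K K"
  using vn by (auto simp: von_neumann_algebra_def)

lemma M_adjoint [simp, intro]: "x \<in> M \<Longrightarrow> adjoint K K x \<in> M"
  using vn by (auto simp: von_neumann_algebra_def)

lemma bicommutant: "commutant K (commutant K M) = M"
  using vn by (simp add: von_neumann_algebra_def)

lemma M_iff: "y \<in> M \<longleftrightarrow> y \<in> bounded_ops K K \<and> (\<forall>x\<in>commutant K M. \<forall>\<xi>\<in>carrier K. x (y \<xi>) = y (x \<xi>))"
  by (subst bicommutant[symmetric]) (rule commutant_iff)

text \<open>The bicommutant property as an introduction rule. Closure of \<open>M\<close> under
  sums, scalars, products and the unit comes from it, as the definition of a von Neumann algebra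
  speaks only of adjoints and the bicommutant.\<close>

lemma M_I:
  assumes "y \<in> bounded_ops K K"
    and "\<And>x \<xi>. \<lbrakk>x \<in> bounded_ops K K; \<And>z \<zeta>. \<lbrakk>z \<in> M; \<zeta> \<in> carrier K\<rbrakk> \<Longrightarrow> x (z \<zeta>) = z (x \<zeta>); \<xi> \<in> carrier K\<rbrakk>
      \<Longrightarrow> x (y \<xi>) = y (x \<xi>)"
  shows "y \<in> M"
  unfolding M_iff[of y] by (auto simp: assms(1) commutant_iff intro!: assms(2))

lemma M_closed [simp]: "\<lbrakk>x \<in> M; \<xi> \<in> carrier K\<rbrakk> \<Longrightarrow> x \<xi> \<in> carrier K"
  by (rule bounded_ops_closed[OF M_bounded])

lemma M_linear:
  assumes "x \<in> M"
  shows "\<lbrakk>\<xi> \<in> carrier K; \<eta> \<in> carrier K\<rbrakk> \<Longrightarrow> x (\<xi> \<oplus>\<^bsub>K\<^esub> \<eta>) = x \<xi> \<oplus>\<^bsub>K\<^esub> x \<eta>"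
    and "\<xi> \<in> carrier K \<Longrightarrow> x (c \<odot>\<^bsub>K\<^esub> \<xi>) = c \<odot>\<^bsub>K\<^esub> x \<xi>"
  using bounded_ops_add[OF M_bounded[OF assms]] bounded_ops_smult[OF M_bounded[OF assms]] by auto

lemma adjoint_ip:
  assumes "x \<in> M" "\<xi> \<in> carrier K" "\<eta> \<in> carrier K"
  shows "ip K (adjoint K K x \<xi>) \<eta> = ip K \<xi> (x \<eta>)"
    and "ip K \<xi> (adjoint K K x \<eta>) = ip K (x \<xi>) \<eta>"
  using assms KK.adjoint_left KK.adjoint_right M_bounded by auto

lemma adjoint_adjoint [simp]:
  assumes "x \<in> M" shows "adjoint K K (adjoint K K x) = x"
  by (rule KK.adjoint_eqI) (use assms in \<open>auto intro: M_bounded simp: adjoint_ip\<close>)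

lemma op_one_bounded: "op_one K \<in> bounded_ops K K"
  by (rule KK.bounded_opsI[of _ 1]) (auto simp: op_one_def)

lemma
  assumes "x \<in> bounded_ops K K"
  shows op_add_bounded: "y \<in> bounded_ops K K \<Longrightarrow> op_add K x y \<in> bounded_ops K K"
    and op_scale_bounded: "op_scale K c x \<in> bounded_ops K K"
proof -
  note [simp] = bounded_ops_closed bounded_ops_add bounded_ops_smult
  obtain a where a: "a > 0" "\<And>\<xi>. \<xi> \<in> carrier K \<Longrightarrow> vnorm K (x \<xi>) \<le> a * vnorm K \<xi>"
    using KK.bounded_ops_bound[OF assms] by blast
  show "op_add K x y \<in> bounded_ops K K" if y: "y \<in> bounded_ops K K"
  proof -
    obtain b where b: "b > 0" "\<And>\<xi>. \<xi> \<in> carrier K \<Longrightarrow> vnorm K (y \<xi>) \<le> b * vnorm K \<xi>"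
      using KK.bounded_ops_bound[OF y] by blast
    show ?thesis
    proof (rule KK.bounded_opsI)
      fix \<xi> assume \<xi>: "\<xi> \<in> carrier K"
      have "vnorm K (x \<xi> \<oplus>\<^bsub>K\<^esub> y \<xi>) \<le> vnorm K (x \<xi>) + vnorm K (y \<xi>)" using \<xi> y assms by (intro K.vnorm_triangle) auto
      then show "vnorm K (op_add K x y \<xi>) \<le> (a + b) * vnorm K \<xi>"
        using a(2)[OF \<xi>] b(2)[OF \<xi>] \<xi> y assms by (simp add: op_add_def algebra_simps)
    qed (use assms y in \<open>auto simp: op_add_def intro!: K.vec_eqI simp: K.ip_simps algebra_simps\<close>)
  qed
  show "op_scale K c x \<in> bounded_ops K K"
  proof (rule KK.bounded_opsI)
    fix \<xi> assume \<xi>: "\<xi> \<in> carrier K"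
    show "vnorm K (op_scale K c x \<xi>) \<le> (cmod c * a) * vnorm K \<xi>"
      using mult_left_mono[OF a(2)[OF \<xi>], of "cmod c"] \<xi> assms by (simp add: op_scale_def K.vnorm_smult mult_ac)
  qed (use assms in \<open>auto simp: op_scale_def intro!: K.vec_eqI simp: K.ip_simps algebra_simps\<close>)
qed

lemma op_apply [simp]:
  assumes "\<xi> \<in> carrier K"
  shows "op_add K x y \<xi> = x \<xi> \<oplus>\<^bsub>K\<^esub> y \<xi>" "op_scale K c x \<xi> = c \<odot>\<^bsub>K\<^esub> x \<xi>" "op_one K \<xi> = \<xi>"
    "op_mult K x y \<xi> = x (y \<xi>)"
  using assms by (auto simp: op_add_def op_scale_def op_one_def compose_eq)

lemma M_add [simp, intro]: "\<lbrakk>x \<in> M; y \<in> M\<rbrakk> \<Longrightarrow> op_add K x y \<in> M"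
  by (rule M_I) (simp_all add: op_add_bounded M_bounded bounded_ops_closed bounded_ops_add)

lemma M_scale [simp, intro]: "x \<in> M \<Longrightarrow> op_scale K c x \<in> M"
  by (rule M_I) (simp_all add: op_scale_bounded M_bounded bounded_ops_closed bounded_ops_smult)

lemma M_mult [simp, intro]: "\<lbrakk>x \<in> M; y \<in> M\<rbrakk> \<Longrightarrow> op_mult K x y \<in> M"
  using compose_bounded_ops[OF K.hilbert_space_axioms K.hilbert_space_axioms K.hilbert_space_axioms]
  by (intro M_I) (simp_all add: M_bounded bounded_ops_closed)

lemma M_one [simp, intro]: "op_one K \<in> M"
  by (rule M_I) (simp_all add: bounded_ops_closed op_one_bounded)

end

section \<open>Vector functionals, and limits under normal functionals\<close>

lemma normal_functional_cong:
  assumes "\<And>x. x \<in> N \<Longrightarrow> \<omega> x = \<omega>' x" "normal_functional K N \<omega>"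
  shows "normal_functional K N \<omega>'"
proof -
  have "(\<forall>x\<in>N. (f x :: nat \<Rightarrow> complex) sums \<omega> x) \<longleftrightarrow> (\<forall>x\<in>N. f x sums \<omega>' x)" for f
    using assms(1) by simp
  then show ?thesis using assms(2) unfolding normal_functional_def by simp
qed

lemma normal_functionalE:
  assumes "normal_functional K N \<omega>"
  obtains \<xi> \<eta> where "\<forall>n::nat. \<xi> n \<in> carrier K \<and> \<eta> n \<in> carrier K"
    "summable (\<lambda>n. (vnorm K (\<xi> n))\<^sup>2)" "summable (\<lambda>n. (vnorm K (\<eta> n))\<^sup>2)"
    "\<forall>x\<in>N. (\<lambda>n. ip K (\<xi> n) (x (\<eta> n))) sums \<omega> x"
  using assms unfolding normal_functional_def by (elim exE conjE)

context hilbert_space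
begin

text \<open>Both terms are placed into one pair of sequences, the sign going into the left vector.
  The difference is what \<open>rep_form_bound\<close> needs, where a vector is compared with its
  image under \<open>B\<close>.\<close>

lemma normal_functional_vector2:
  assumes "\<xi> \<in> carrier H" "\<eta> \<in> carrier H" "\<xi>' \<in> carrier H" "\<eta>' \<in> carrier H" and N: "N \<subseteq> bounded_ops H H"
  shows "normal_functional H N (\<lambda>x. ip H \<xi> (x \<eta>) - ip H \<xi>' (x \<eta>'))"
proof -
  define u where "u n = (if n = (0::nat) then \<xi> else if n = 1 then \<ominus>\<^bsub>H\<^esub> \<xi>' else \<zero>\<^bsub>H\<^esub>)" for n
  define v where "v n = (if n = (0::nat) then \<eta> else if n = 1 then \<eta>' else \<zero>\<^bsub>H\<^esub>)" for n
  have "summable (\<lambda>n. (vnorm H (u n))\<^sup>2)" "summable (\<lambda>n. (vnorm H (v n))\<^sup>2)"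
    by (rule summable_finite[of "{0, 1}"], simp, simp add: u_def v_def)+
  moreover have "(\<lambda>n. ip H (u n) (x (v n))) sums (ip H \<xi> (x \<eta>) - ip H \<xi>' (x \<eta>'))" if "x \<in> N" for x
  proof -
    have x: "\<And>\<zeta>. \<zeta> \<in> carrier H \<Longrightarrow> x \<zeta> \<in> carrier H" using bounded_ops_closed[of x H H] that N by auto
    have "ip H (\<ominus>\<^bsub>H\<^esub> \<xi>') (x \<eta>') = - ip H \<xi>' (x \<eta>')"
      using assms x by (subst (1 2) ip_cnj[of "x \<eta>'"]) auto
    then have "(\<Sum>n\<in>{0, 1}. ip H (u n) (x (v n))) = ip H \<xi> (x \<eta>) - ip H \<xi>' (x \<eta>')"
      by (simp add: u_def v_def)
    moreover have "(\<lambda>n. ip H (u n) (x (v n))) sums (\<Sum>n\<in>{0, 1}. ip H (u n) (x (v n)))"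
      by (rule sums_finite) (auto simp: u_def v_def x)
    ultimately show ?thesis by simp
  qed
  moreover have "u n \<in> carrier H \<and> v n \<in> carrier H" for n using assms by (auto simp: u_def v_def)
  ultimately show ?thesis unfolding normal_functional_def by (intro exI[of _ u] exI[of _ v]) simp
qed

lemma normal_functional_vector:
  assumes "\<xi> \<in> carrier H" "\<eta> \<in> carrier H" and N: "N \<subseteq> bounded_ops H H"
  shows "normal_functional H N (\<lambda>x. ip H \<xi> (x \<eta>))"
proof (rule normal_functional_cong[OF _ normal_functional_vector2[OF assms(1,2) M.zero_closed M.zero_closed N]])
  fix x assume "x \<in> N"
  then have "x \<zero>\<^bsub>H\<^esub> \<in> carrier H" using N bounded_ops_closed[of x H H "\<zero>\<^bsub>H\<^esub>"] by auto
  then show "ip H \<xi> (x \<eta>) - ip H \<zero>\<^bsub>H\<^esub> (x \<zero>\<^bsub>H\<^esub>) = ip H \<xi> (x \<eta>)" by simp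
qed

lemma summable_vnorm_mult:
  assumes "\<And>n. \<xi> n \<in> carrier H" "\<And>n. \<eta> n \<in> carrier H"
    and "summable (\<lambda>n. (vnorm H (\<xi> n))\<^sup>2)" "summable (\<lambda>n. (vnorm H (\<eta> n))\<^sup>2)"
  shows "summable (\<lambda>n. vnorm H (\<xi> n) * vnorm H (\<eta> n))"
proof (rule summable_comparison_test')
  show "summable (\<lambda>n. (vnorm H (\<xi> n))\<^sup>2 + (vnorm H (\<eta> n))\<^sup>2)" using assms by (intro summable_add)
  show "norm (vnorm H (\<xi> n) * vnorm H (\<eta> n)) \<le> (vnorm H (\<xi> n))\<^sup>2 + (vnorm H (\<eta> n))\<^sup>2" for n
  proof -
    have "2 * (vnorm H (\<xi> n) * vnorm H (\<eta> n)) \<le> (vnorm H (\<xi> n))\<^sup>2 + (vnorm H (\<eta> n))\<^sup>2"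
      using sum_squares_bound[of "vnorm H (\<xi> n)" "vnorm H (\<eta> n)"] by (simp add: mult.assoc)
    moreover have "0 \<le> vnorm H (\<xi> n) * vnorm H (\<eta> n)" using assms(1,2)[of n] by simp
    ultimately show ?thesis by (simp only: real_norm_def abs_of_nonneg)
  qed
qed

text \<open>On bounded sets weak and sigma-weak convergence agree: the common bound \<open>C\<close>
  dominates the series of vector functionals, so the limit may be taken term by term.\<close>

lemma normal_functional_tendsto:
  assumes \<omega>: "normal_functional H N \<omega>" and N: "N \<subseteq> bounded_ops H H"
    and x: "\<And>r. x r \<in> N" "y \<in> N"
    and C: "\<And>r \<xi>. \<xi> \<in> carrier H \<Longrightarrow> vnorm H (x r \<xi>) \<le> C * vnorm H \<xi>"
    and lim: "\<And>\<xi> \<eta>. \<lbrakk>\<xi> \<in> carrier H; \<eta> \<in> carrier H\<rbrakk> \<Longrightarrow> ((\<lambda>r. ip H \<xi> (x r \<eta>)) \<longlongrightarrow> ip H \<xi> (y \<eta>)) F"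
    and F: "F \<noteq> bot"
  shows "((\<lambda>r. \<omega> (x r)) \<longlongrightarrow> \<omega> y) F"
proof -
  obtain \<xi> \<eta> where "\<forall>n. \<xi> n \<in> carrier H \<and> \<eta> n \<in> carrier H"
    and s: "summable (\<lambda>n. (vnorm H (\<xi> n))\<^sup>2)" "summable (\<lambda>n. (vnorm H (\<eta> n))\<^sup>2)"
    and sums: "\<forall>x\<in>N. (\<lambda>n. ip H (\<xi> n) (x (\<eta> n))) sums \<omega> x"
    by (rule normal_functionalE[OF \<omega>])
  then have \<xi>: "\<xi> n \<in> carrier H" "\<eta> n \<in> carrier H" for n by auto
  have "((\<lambda>r. suminf (\<lambda>k. ip H (\<xi> k) (x r (\<eta> k)))) \<longlongrightarrow> suminf (\<lambda>k. ip H (\<xi> k) (y (\<eta> k)))) F"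
  proof (rule tannerys_theorem[THEN conjunct2, THEN conjunct2])
    show "((\<lambda>r. ip H (\<xi> k) (x r (\<eta> k))) \<longlongrightarrow> ip H (\<xi> k) (y (\<eta> k))) F" for k
      using \<xi> by (intro lim)
    show "summable (\<lambda>k. C * (vnorm H (\<xi> k) * vnorm H (\<eta> k)))"
      using summable_vnorm_mult[OF \<xi> s] by (rule summable_mult)
    have "cmod (ip H (\<xi> k) (x r (\<eta> k))) \<le> C * (vnorm H (\<xi> k) * vnorm H (\<eta> k))" for k r
    proof -
      have "cmod (ip H (\<xi> k) (x r (\<eta> k))) \<le> vnorm H (\<xi> k) * vnorm H (x r (\<eta> k))"
        using \<xi> bounded_ops_closed[of "x r" H H] x(1)[of r] N by (intro Cauchy_Schwarz) auto
      also have "\<dots> \<le> vnorm H (\<xi> k) * (C * vnorm H (\<eta> k))"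
        using C \<xi> by (intro mult_left_mono) auto
      finally show ?thesis by (simp add: mult_ac)
    qed
    then show "\<forall>\<^sub>F (k, r) in at_top \<times>\<^sub>F F. cmod (ip H (\<xi> k) (x r (\<eta> k))) \<le> C * (vnorm H (\<xi> k) * vnorm H (\<eta> k))"
      by (intro always_eventually) auto
  qed (rule F)
  moreover have "suminf (\<lambda>k. ip H (\<xi> k) (x r (\<eta> k))) = \<omega> (x r)" for r
    by (rule sums_unique[symmetric], rule bspec[OF sums], rule x)
  moreover have "suminf (\<lambda>k. ip H (\<xi> k) (y (\<eta> k))) = \<omega> y"
    by (rule sums_unique[symmetric], rule bspec[OF sums], rule x)
  ultimately show ?thesis by simp
qed

end

text \<open>Linearity is not part of the definition; it is inherited from the terms of the
  representing series.\<close>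

lemma (in vn_algebra) normal_functional_linear:
  assumes "normal_functional K M \<omega>" "x \<in> M" "y \<in> M"
  shows "\<omega> (op_add K x y) = \<omega> x + \<omega> y" "\<omega> (op_scale K c x) = c * \<omega> x"
proof -
  obtain \<xi> \<eta> where \<xi>: "\<forall>n. \<xi> n \<in> carrier K \<and> \<eta> n \<in> carrier K"
    and "summable (\<lambda>n. (vnorm K (\<xi> n))\<^sup>2)" "summable (\<lambda>n. (vnorm K (\<eta> n))\<^sup>2)"
    and sums: "\<forall>x\<in>M. (\<lambda>n. ip K (\<xi> n) (x (\<eta> n))) sums \<omega> x"
    by (rule normal_functionalE[OF assms(1)])
  note \<omega> = bspec[OF sums]
  have "(\<lambda>n. ip K (\<xi> n) (op_add K x y (\<eta> n))) sums (\<omega> x + \<omega> y)"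
    using sums_add[OF \<omega>[OF assms(2)] \<omega>[OF assms(3)]] \<xi> assms by (simp add: K.ip_simps)
  then show "\<omega> (op_add K x y) = \<omega> x + \<omega> y"
    by (rule sums_unique2[OF \<omega>[OF M_add[OF assms(2,3)]]])
  have "(\<lambda>n. ip K (\<xi> n) (op_scale K c x (\<eta> n))) sums (c * \<omega> x)"
    using sums_mult[OF \<omega>[OF assms(2)], of c] \<xi> assms by (simp add: K.ip_simps)
  then show "\<omega> (op_scale K c x) = c * \<omega> x"
    by (rule sums_unique2[OF \<omega>[OF M_scale[OF assms(2)]]])
qed

section \<open>Positive matrices\<close>

lemma closed_nonneg_Reals: "closed (\<real>\<^sub>\<ge>\<^sub>0 :: complex set)"
proof -
  have "(\<real>\<^sub>\<ge>\<^sub>0 :: complex set) = {z. 0 \<le> Re z} \<inter> {z. Im z = 0}"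
    by (auto simp: complex_nonneg_Reals_iff)
  moreover have "closed {z. 0 \<le> Re z}" "closed {z. Im z = 0}"
    by (intro closed_Collect_le closed_Collect_eq continuous_on_const continuous_on_Re continuous_on_Im continuous_on_id)+
  ultimately show ?thesis by (metis closed_Int)
qed

section \<open>Finite sums of vectors\<close>

lemma (in hilbert_space)
  assumes "finite A" "\<And>i. i \<in> A \<Longrightarrow> f i \<in> carrier H"
  shows finsum_mem: "finsum H f A \<in> carrier H"
    and ip_finsum_right: "\<xi> \<in> carrier H \<Longrightarrow> ip H \<xi> (finsum H f A) = (\<Sum>i\<in>A. ip H \<xi> (f i))"
    and ip_finsum_left: "\<xi> \<in> carrier H \<Longrightarrow> ip H (finsum H f A) \<xi> = (\<Sum>i\<in>A. ip H (f i) \<xi>)"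
proof -
  have *: "finsum H f B \<in> carrier H" if "\<And>i. i \<in> B \<Longrightarrow> f i \<in> carrier H" for B
    using that by (intro M.finsum_closed) auto
  show "finsum H f A \<in> carrier H" using assms by (intro *)
  show "ip H \<xi> (finsum H f A) = (\<Sum>i\<in>A. ip H \<xi> (f i))" if "\<xi> \<in> carrier H"
    using assms
  proof (induction A)
    case (insert i A)
    then have "finsum H f (insert i A) = f i \<oplus>\<^bsub>H\<^esub> finsum H f A" by (intro M.finsum_insert) auto
    with insert show ?case using that by (simp add: ip_add *)
  qed (use that in simp)
  show "ip H (finsum H f A) \<xi> = (\<Sum>i\<in>A. ip H (f i) \<xi>)" if "\<xi> \<in> carrier H"
    using assms
  proof (induction A)
    case (insert i A)
    then have "finsum H f (insert i A) = f i \<oplus>\<^bsub>H\<^esub> finsum H f A" by (intro M.finsum_insert) auto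
    with insert show ?case using that by (simp add: ip_add_left *)
  qed (use that in simp)
qed

lemma (in hilbert_space) ip_finsum_finsum:
  assumes "finite A" "\<And>i. i \<in> A \<Longrightarrow> u i \<in> carrier H"
  shows "(\<Sum>i\<in>A. \<Sum>j\<in>A. ip H (u i) (u j)) = ip H (finsum H u A) (finsum H u A)"
  using assms by (simp add: ip_finsum_right[symmetric] ip_finsum_left[symmetric] finsum_mem)

lemma (in hilbert_pair) bounded_ops_finsum:
  assumes f: "f \<in> bounded_ops H G" and u: "finite A" "\<And>i. i \<in> A \<Longrightarrow> u i \<in> carrier H"
  shows "f (finsum H u A) = finsum G (\<lambda>i. f (u i)) A"
proof (rule G.vec_eqI)
  note [simp] = bounded_ops_closed[OF f] adjoint_closed[OF f]
  show "f (finsum H u A) \<in> carrier G" "finsum G (\<lambda>i. f (u i)) A \<in> carrier G"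
    using u by (simp_all add: H.finsum_mem G.finsum_mem)
  fix \<zeta> assume \<zeta>: "\<zeta> \<in> carrier G"
  have "ip G \<zeta> (f (finsum H u A)) = ip H (adjoint H G f \<zeta>) (finsum H u A)"
    using u \<zeta> by (simp add: adjoint_left[OF f] H.finsum_mem)
  also have "\<dots> = (\<Sum>i\<in>A. ip G \<zeta> (f (u i)))"
    using u \<zeta> by (simp add: H.ip_finsum_right adjoint_left[OF f])
  also have "\<dots> = ip G \<zeta> (finsum G (\<lambda>i. f (u i)) A)" using u \<zeta> by (simp add: G.ip_finsum_right)
  finally show "ip G \<zeta> (f (finsum H u A)) = ip G \<zeta> (finsum G (\<lambda>i. f (u i)) A)" .
qed

context vn_algebra
begin

lemma M_zero [simp]: "x \<in> M \<Longrightarrow> x \<zero>\<^bsub>K\<^esub> = \<zero>\<^bsub>K\<^esub>"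
  using M_linear(2)[of x "\<zero>\<^bsub>K\<^esub>" 0] by (simp add: K.smult_l_null[simplified])

text \<open>\<open>M\<close> is a set of functions, with addition \<open>op_add\<close> but no
  summation of its own. The iterated sum is recorded through the two properties by which it is used:
  its matrix coefficients and its values under normal functionals.\<close>

lemma M_finite_sum:
  fixes m :: nat
  assumes "\<And>l. l < m \<Longrightarrow> g l \<in> M"
  shows "\<exists>s\<in>M. (\<forall>\<xi>\<in>carrier K. \<forall>\<zeta>\<in>carrier K. ip K \<xi> (s \<zeta>) = (\<Sum>l<m. ip K \<xi> (g l \<zeta>))) \<and>
    (\<forall>\<omega>. normal_functional K M \<omega> \<longrightarrow> \<omega> s = (\<Sum>l<m. \<omega> (g l)))"
  using assms
proof (induction m)
  case 0
  show ?case
  proof (intro bexI conjI allI impI ballI)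
    show "\<omega> (op_scale K 0 (op_one K)) = (\<Sum>l<0. \<omega> (g l))" if "normal_functional K M \<omega>" for \<omega>
      using normal_functional_linear(2)[OF that M_one M_one, of 0] by simp
  qed (auto simp: K.ip_simps)
next
  case (Suc m)
  then obtain s where s: "s \<in> M" "\<And>\<xi> \<zeta>. \<xi> \<in> carrier K \<Longrightarrow> \<zeta> \<in> carrier K \<Longrightarrow> ip K \<xi> (s \<zeta>) = (\<Sum>l<m. ip K \<xi> (g l \<zeta>))"
    "\<And>\<omega>. normal_functional K M \<omega> \<Longrightarrow> \<omega> s = (\<Sum>l<m. \<omega> (g l))"
    by (metis less_Suc_eq)
  show ?case
  proof (intro bexI conjI allI impI ballI)
    show "\<omega> (op_add K s (g m)) = (\<Sum>l<Suc m. \<omega> (g l))" if "normal_functional K M \<omega>" for \<omega>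
      using normal_functional_linear(1)[OF that s(1) Suc.prems[of m]] s(3)[OF that] by simp
  qed (use s Suc.prems in \<open>auto simp: K.ip_simps\<close>)
qed

text \<open>A family \<eta> restricted to indices below \<open>n\<close> stands for a vector of the
  n-fold direct sum of \<open>K\<close>. Then \<open>mform\<close> is the sesquilinear form of the
  operator matrix \<open>a\<close>, \<open>mapply\<close> its action and \<open>msq\<close> the
  squared norm, and \<open>positive_contraction\<close> means that \<open>a\<close> lies between 0
  and 1.\<close>

definition mform :: "nat \<Rightarrow> (nat \<Rightarrow> nat \<Rightarrow> 'a \<Rightarrow> 'a) \<Rightarrow> (nat \<Rightarrow> 'a) \<Rightarrow> (nat \<Rightarrow> 'a) \<Rightarrow> complex" where
  "mform n a \<xi> \<eta> = (\<Sum>i<n. \<Sum>j<n. ip K (\<xi> i) (a i j (\<eta> j)))"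

definition mapply :: "nat \<Rightarrow> (nat \<Rightarrow> nat \<Rightarrow> 'a \<Rightarrow> 'a) \<Rightarrow> (nat \<Rightarrow> 'a) \<Rightarrow> nat \<Rightarrow> 'a" where
  "mapply n a \<eta> i = finsum K (\<lambda>j. a i j (\<eta> j)) {..<n}"

definition msq :: "nat \<Rightarrow> (nat \<Rightarrow> 'a) \<Rightarrow> real" where
  "msq n \<eta> = (\<Sum>i<n. (vnorm K (\<eta> i))\<^sup>2)"

definition positive_contraction :: "nat \<Rightarrow> (nat \<Rightarrow> nat \<Rightarrow> 'a \<Rightarrow> 'a) \<Rightarrow> bool" where
  "positive_contraction n a \<longleftrightarrow> (\<forall>i<n. \<forall>j<n. a i j \<in> M) \<and>
     (\<forall>\<eta>. (\<forall>i<n. \<eta> i \<in> carrier K) \<longrightarrow> mform n a \<eta> \<eta> \<in> \<real>\<^sub>\<ge>\<^sub>0 \<and> Re (mform n a \<eta> \<eta>) \<le> msq n \<eta>)"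

lemma msq_nonneg: "0 \<le> msq n \<eta>"
  by (simp add: msq_def sum_nonneg)

lemma mapply_closed:
  assumes "\<And>i j. \<lbrakk>i < n; j < n\<rbrakk> \<Longrightarrow> a i j \<in> M" "\<And>i. i < n \<Longrightarrow> \<eta> i \<in> carrier K" "i < n"
  shows "mapply n a \<eta> i \<in> carrier K"
  unfolding mapply_def using assms by (intro K.finsum_mem) auto

lemma ip_mapply:
  assumes "\<And>i j. \<lbrakk>i < n; j < n\<rbrakk> \<Longrightarrow> a i j \<in> M" "\<And>i. i < n \<Longrightarrow> \<eta> i \<in> carrier K" "i < n" "\<xi> \<in> carrier K"
  shows "ip K \<xi> (mapply n a \<eta> i) = (\<Sum>j<n. ip K \<xi> (a i j (\<eta> j)))"
    and "ip K (mapply n a \<eta> i) \<xi> = (\<Sum>j<n. ip K (a i j (\<eta> j)) \<xi>)"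
  unfolding mapply_def
  by (rule K.ip_finsum_right, use assms in auto) (rule K.ip_finsum_left, use assms in auto)

lemma mform_Cauchy_Schwarz:
  assumes a: "\<And>i j. \<lbrakk>i < n; j < n\<rbrakk> \<Longrightarrow> a i j \<in> M"
    and pos: "\<And>\<eta>. (\<And>i. i < n \<Longrightarrow> \<eta> i \<in> carrier K) \<Longrightarrow> mform n a \<eta> \<eta> \<in> \<real>\<^sub>\<ge>\<^sub>0"
    and \<xi>: "\<And>i. i < n \<Longrightarrow> \<xi> i \<in> carrier K" and \<eta>: "\<And>i. i < n \<Longrightarrow> \<eta> i \<in> carrier K"
  shows "(cmod (mform n a \<xi> \<eta>))\<^sup>2 \<le> Re (mform n a \<xi> \<xi>) * Re (mform n a \<eta> \<eta>)"
proof (rule sesquilinear_Cauchy_Schwarz(2)[of _ _ "mform n a \<eta> \<xi>"])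
  fix c
  let ?v = "\<lambda>i. \<xi> i \<oplus>\<^bsub>K\<^esub> c \<odot>\<^bsub>K\<^esub> \<eta> i"
  have "mform n a ?v ?v = (\<Sum>i<n. \<Sum>j<n. ip K (\<xi> i) (a i j (\<xi> j)) + c * ip K (\<xi> i) (a i j (\<eta> j))
      + cnj c * ip K (\<eta> i) (a i j (\<xi> j)) + cnj c * c * ip K (\<eta> i) (a i j (\<eta> j)))"
    unfolding mform_def
    by (intro sum.cong refl) (simp add: a \<xi> \<eta> M_linear K.ip_simps algebra_simps)
  also have "\<dots> = mform n a \<xi> \<xi> + c * mform n a \<xi> \<eta> + cnj c * mform n a \<eta> \<xi> + cnj c * c * mform n a \<eta> \<eta>"
    by (simp add: mform_def sum.distrib sum_distrib_left)
  finally show "mform n a \<xi> \<xi> + c * mform n a \<xi> \<eta> + cnj c * mform n a \<eta> \<xi> + cnj c * c * mform n a \<eta> \<eta> \<in> \<real>\<^sub>\<ge>\<^sub>0"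
    using pos[of ?v] \<xi> \<eta> by simp
qed (rule pos, rule \<eta>)

lemma msq_mapply_le:
  assumes a: "positive_contraction n a" and \<eta>: "\<And>i. i < n \<Longrightarrow> \<eta> i \<in> carrier K"
  shows "msq n (mapply n a \<eta>) \<le> Re (mform n a \<eta> \<eta>)"
proof -
  let ?w = "mapply n a \<eta>"
  have aM: "\<And>i j. \<lbrakk>i < n; j < n\<rbrakk> \<Longrightarrow> a i j \<in> M"
    and pos: "\<And>\<eta>. (\<And>i. i < n \<Longrightarrow> \<eta> i \<in> carrier K) \<Longrightarrow> mform n a \<eta> \<eta> \<in> \<real>\<^sub>\<ge>\<^sub>0"
    and le: "\<And>\<eta>. (\<And>i. i < n \<Longrightarrow> \<eta> i \<in> carrier K) \<Longrightarrow> Re (mform n a \<eta> \<eta>) \<le> msq n \<eta>"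
    using a by (auto simp: positive_contraction_def)
  have w: "?w i \<in> carrier K" if "i < n" for i using mapply_closed[OF aM \<eta> that] by simp
  have "mform n a ?w \<eta> = (\<Sum>i<n. ip K (?w i) (?w i))"
    unfolding mform_def using ip_mapply(1)[OF aM \<eta>] w by simp
  also have "\<dots> = of_real (msq n ?w)"
    using w by (simp add: msq_def K.ip_self)
  finally have "mform n a ?w \<eta> = of_real (msq n ?w)" .
  then have "(msq n ?w)\<^sup>2 \<le> Re (mform n a ?w ?w) * Re (mform n a \<eta> \<eta>)"
    using mform_Cauchy_Schwarz[of n a ?w \<eta>, OF aM pos w \<eta>] by simp
  also have "\<dots> \<le> msq n ?w * Re (mform n a \<eta> \<eta>)"
    using le[of ?w] w pos[OF \<eta>] by (intro mult_right_mono) (auto simp: complex_nonneg_Reals_iff)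
  finally have "msq n ?w * msq n ?w \<le> msq n ?w * Re (mform n a \<eta> \<eta>)"
    by (simp add: power2_eq_square)
  then show ?thesis
    by (rule mult_self_le_imp_le) (use msq_nonneg[of n ?w] pos[OF \<eta>] in \<open>auto simp: complex_nonneg_Reals_iff\<close>)
qed

text \<open>The witness is a - a* a, which is positive by \<open>msq_mapply_le\<close>. The entries
  of a* a are sums over \<open>l\<close> of the products \<open>g i j l\<close>; for a fixed
  \<open>l\<close> these form the matrix c* c built from row \<open>l\<close> of \<open>a\<close>,
  where \<open>f\<close> is nonnegative by assumption.\<close>

lemma positive_contraction_step:
  assumes a: "positive_contraction n a"
  shows "\<exists>b. positive_contraction n b \<and>
    (\<forall>\<eta>. (\<forall>i<n. \<eta> i \<in> carrier K) \<longrightarrow>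
       Re (mform n b \<eta> \<eta>) = Re (mform n a \<eta> \<eta>) - msq n (mapply n a \<eta>)) \<and>
    (\<forall>f. (\<forall>i<n. \<forall>j<n. normal_functional K M (f i j)) \<longrightarrow>
       (\<forall>c. (\<forall>i<n. c i \<in> M) \<longrightarrow> (\<Sum>i<n. \<Sum>j<n. f i j (op_mult K (adjoint K K (c i)) (c j))) \<in> \<real>\<^sub>\<ge>\<^sub>0) \<longrightarrow>
       (\<Sum>i<n. \<Sum>j<n. f i j (a i j)) - (\<Sum>i<n. \<Sum>j<n. f i j (b i j)) \<in> \<real>\<^sub>\<ge>\<^sub>0)"
proof -
  have aM: "\<And>i j. \<lbrakk>i < n; j < n\<rbrakk> \<Longrightarrow> a i j \<in> M"
    and pos: "\<And>\<eta>. (\<And>i. i < n \<Longrightarrow> \<eta> i \<in> carrier K) \<Longrightarrow> mform n a \<eta> \<eta> \<in> \<real>\<^sub>\<ge>\<^sub>0"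
    and le: "\<And>\<eta>. (\<And>i. i < n \<Longrightarrow> \<eta> i \<in> carrier K) \<Longrightarrow> Re (mform n a \<eta> \<eta>) \<le> msq n \<eta>"
    using a by (auto simp: positive_contraction_def)
  define g where "g i j l = op_mult K (adjoint K K (a l i)) (a l j)" for i j l
  have gM: "g i j l \<in> M" if "i < n" "j < n" "l < n" for i j l using that aM by (simp add: g_def)
  define P where "P i j s \<longleftrightarrow> s \<in> M \<and>
     (\<forall>\<xi>\<in>carrier K. \<forall>\<zeta>\<in>carrier K. ip K \<xi> (s \<zeta>) = (\<Sum>l<n. ip K \<xi> (g i j l \<zeta>))) \<and>
     (\<forall>\<omega>. normal_functional K M \<omega> \<longrightarrow> \<omega> s = (\<Sum>l<n. \<omega> (g i j l)))" for i j s
  have ex: "\<exists>s. P i j s" if "i < n" "j < n" for i j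
    unfolding P_def using M_finite_sum[of n "g i j"] gM that by blast
  define s where "s i j = (SOME s. P i j s)" for i j
  have Ps: "P i j (s i j)" if "i < n" "j < n" for i j
    unfolding s_def using ex[OF that] by (rule someI_ex)
  have sM: "s i j \<in> M" if "i < n" "j < n" for i j using Ps[OF that] by (simp add: P_def)
  have s_ip: "ip K \<xi> (s i j \<zeta>) = (\<Sum>l<n. ip K (a l i \<xi>) (a l j \<zeta>))"
    if "i < n" "j < n" "\<xi> \<in> carrier K" "\<zeta> \<in> carrier K" for i j \<xi> \<zeta>
  proof -
    have "ip K \<xi> (s i j \<zeta>) = (\<Sum>l<n. ip K \<xi> (g i j l \<zeta>))" using Ps[OF that(1,2)] that by (simp add: P_def)
    also have "\<dots> = (\<Sum>l<n. ip K (a l i \<xi>) (a l j \<zeta>))"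
      using that aM by (intro sum.cong refl) (simp add: g_def adjoint_ip)
    finally show ?thesis .
  qed
  have s_f: "\<omega> (s i j) = (\<Sum>l<n. \<omega> (g i j l))" if "i < n" "j < n" "normal_functional K M \<omega>" for i j \<omega>
    using Ps[OF that(1,2)] that by (simp add: P_def)
  define b where "b i j = op_add K (a i j) (op_scale K (-1) (s i j))" for i j
  have bM: "b i j \<in> M" if "i < n" "j < n" for i j using that aM sM by (simp add: b_def)
  have form: "mform n b \<eta> \<eta> = mform n a \<eta> \<eta> - of_real (msq n (mapply n a \<eta>))"
    if \<eta>: "\<And>i. i < n \<Longrightarrow> \<eta> i \<in> carrier K" for \<eta>
  proof -
    have w: "mapply n a \<eta> i \<in> carrier K" if "i < n" for i using mapply_closed[OF aM \<eta> that] by simp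
    have "mform n b \<eta> \<eta> = (\<Sum>i<n. \<Sum>j<n. ip K (\<eta> i) (a i j (\<eta> j)) - ip K (\<eta> i) (s i j (\<eta> j)))"
      unfolding mform_def b_def using aM sM \<eta> by (intro sum.cong refl) (simp add: K.ip_simps)
    also have "\<dots> = mform n a \<eta> \<eta> - (\<Sum>i<n. \<Sum>j<n. ip K (\<eta> i) (s i j (\<eta> j)))"
      by (simp add: mform_def sum_subtractf)
    also have "(\<Sum>i<n. \<Sum>j<n. ip K (\<eta> i) (s i j (\<eta> j)))
        = (\<Sum>i<n. \<Sum>j<n. \<Sum>l<n. ip K (a l i (\<eta> i)) (a l j (\<eta> j)))"
      using \<eta> by (intro sum.cong refl) (simp add: s_ip)
    also have "\<dots> = (\<Sum>i<n. \<Sum>l<n. \<Sum>j<n. ip K (a l i (\<eta> i)) (a l j (\<eta> j)))"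
      by (intro sum.cong refl sum.swap)
    also have "\<dots> = (\<Sum>l<n. \<Sum>i<n. \<Sum>j<n. ip K (a l i (\<eta> i)) (a l j (\<eta> j)))"
      by (rule sum.swap)
    also have "\<dots> = (\<Sum>l<n. ip K (mapply n a \<eta> l) (mapply n a \<eta> l))"
    proof (intro sum.cong refl)
      fix l assume "l \<in> {..<n}"
      then have l: "l < n" by simp
      have "ip K (mapply n a \<eta> l) (mapply n a \<eta> l) = (\<Sum>i<n. ip K (a l i (\<eta> i)) (mapply n a \<eta> l))"
        using ip_mapply(2)[OF aM \<eta> l w[OF l]] by simp
      also have "\<dots> = (\<Sum>i<n. \<Sum>j<n. ip K (a l i (\<eta> i)) (a l j (\<eta> j)))"
        using l aM \<eta> by (intro sum.cong refl ip_mapply(1)) auto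
      finally show "(\<Sum>i<n. \<Sum>j<n. ip K (a l i (\<eta> i)) (a l j (\<eta> j))) = ip K (mapply n a \<eta> l) (mapply n a \<eta> l)" ..
    qed
    also have "\<dots> = of_real (msq n (mapply n a \<eta>))"
      using w by (simp add: msq_def K.ip_self)
    finally show ?thesis .
  qed
  have "positive_contraction n b"
    unfolding positive_contraction_def
  proof (intro conjI allI impI)
    fix \<eta> assume \<eta>: "\<forall>i<n. \<eta> i \<in> carrier K"
    show "mform n b \<eta> \<eta> \<in> \<real>\<^sub>\<ge>\<^sub>0"
      using msq_mapply_le[OF a, of \<eta>] pos[of \<eta>] form[of \<eta>] \<eta> by (simp add: complex_nonneg_Reals_iff)
    show "Re (mform n b \<eta> \<eta>) \<le> msq n \<eta>"
      using msq_nonneg[of n "mapply n a \<eta>"] le[of \<eta>] form[of \<eta>] \<eta> by simp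
  qed (rule bM)
  moreover have "(\<Sum>i<n. \<Sum>j<n. f i j (a i j)) - (\<Sum>i<n. \<Sum>j<n. f i j (b i j)) \<in> \<real>\<^sub>\<ge>\<^sub>0"
    if f: "\<forall>i<n. \<forall>j<n. normal_functional K M (f i j)"
      and sq: "\<forall>c. (\<forall>i<n. c i \<in> M) \<longrightarrow> (\<Sum>i<n. \<Sum>j<n. f i j (op_mult K (adjoint K K (c i)) (c j))) \<in> \<real>\<^sub>\<ge>\<^sub>0" for f
  proof -
    have fb: "f i j (b i j) = f i j (a i j) - (\<Sum>l<n. f i j (g i j l))" if ij: "i < n" "j < n" for i j
    proof -
      have nf: "normal_functional K M (f i j)" using f ij by simp
      show ?thesis
        using normal_functional_linear(1)[OF nf aM[OF ij] M_scale[OF sM[OF ij]]]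
          normal_functional_linear(2)[OF nf sM[OF ij] sM[OF ij], of "-1"] s_f[OF ij nf]
        by (simp add: b_def)
    qed
    have "(\<Sum>i<n. \<Sum>j<n. f i j (b i j)) = (\<Sum>i<n. \<Sum>j<n. f i j (a i j) - (\<Sum>l<n. f i j (g i j l)))"
      by (intro sum.cong refl) (simp add: fb)
    then have "(\<Sum>i<n. \<Sum>j<n. f i j (a i j)) - (\<Sum>i<n. \<Sum>j<n. f i j (b i j)) = (\<Sum>i<n. \<Sum>j<n. \<Sum>l<n. f i j (g i j l))"
      by (simp add: sum_subtractf)
    also have "\<dots> = (\<Sum>i<n. \<Sum>l<n. \<Sum>j<n. f i j (g i j l))"
      by (intro sum.cong refl sum.swap)
    also have "\<dots> = (\<Sum>l<n. \<Sum>i<n. \<Sum>j<n. f i j (g i j l))" by (rule sum.swap)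
    also have "\<dots> \<in> \<real>\<^sub>\<ge>\<^sub>0"
      unfolding g_def by (rule nonneg_Reals_sum) (use sq aM in auto)
    finally show ?thesis .
  qed
  ultimately show ?thesis
    using form by (intro exI[of _ b] conjI allI impI) auto
qed

text \<open>With \<open>a\<^sub>0 = a\<close> and \<open>a\<^sub>k\<^sub>+\<^sub>1 = a\<^sub>k - a\<^sub>k\<^sup>* a\<^sub>k\<close>, a positive contraction \<open>a\<close> is \<open>\<Sum>\<^sub>k a\<^sub>k\<^sup>* a\<^sub>k\<close> in the strong
  topology; this replaces the square root in the usual argument.\<close>

lemma positive_contraction_normal:
  assumes a: "positive_contraction n a"
    and f: "\<forall>i<n. \<forall>j<n. normal_functional K M (f i j)"
    and sq: "\<forall>c. (\<forall>i<n. c i \<in> M) \<longrightarrow> (\<Sum>i<n. \<Sum>j<n. f i j (op_mult K (adjoint K K (c i)) (c j))) \<in> \<real>\<^sub>\<ge>\<^sub>0"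
  shows "(\<Sum>i<n. \<Sum>j<n. f i j (a i j)) \<in> \<real>\<^sub>\<ge>\<^sub>0"
proof -
  define Q where "Q a b \<longleftrightarrow> positive_contraction n b \<and>
    (\<forall>\<eta>. (\<forall>i<n. \<eta> i \<in> carrier K) \<longrightarrow>
       Re (mform n b \<eta> \<eta>) = Re (mform n a \<eta> \<eta>) - msq n (mapply n a \<eta>)) \<and>
    (\<Sum>i<n. \<Sum>j<n. f i j (a i j)) - (\<Sum>i<n. \<Sum>j<n. f i j (b i j)) \<in> \<real>\<^sub>\<ge>\<^sub>0" for a b
  have ex: "\<exists>b. Q a b" if "positive_contraction n a" for a
    unfolding Q_def using positive_contraction_step[OF that] f sq by blast
  define A where "A = rec_nat a (\<lambda>_ a. SOME b. Q a b)"
  have A0: "A 0 = a" and AS: "A (Suc k) = (SOME b. Q (A k) b)" for k by (simp_all add: A_def)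
  have Apc: "positive_contraction n (A k)" for k
  proof (induction k)
    case (Suc k)
    then show ?case using someI_ex[OF ex[OF Suc]] by (simp add: AS Q_def)
  qed (simp add: A0 a)
  have AQ: "Q (A k) (A (Suc k))" for k using someI_ex[OF ex[OF Apc]] by (simp add: AS)
  have AM: "A k i j \<in> M" if "i < n" "j < n" for k i j
    using Apc[of k] that by (simp add: positive_contraction_def)
  have pos: "Re (mform n (A k) \<eta> \<eta>) \<ge> 0" "Re (mform n (A k) \<eta> \<eta>) \<le> msq n \<eta>"
    if "\<And>i. i < n \<Longrightarrow> \<eta> i \<in> carrier K" for k \<eta>
    using Apc[of k] that by (auto simp: positive_contraction_def complex_nonneg_Reals_iff)
  \<comment> \<open>Telescoping: the values \<open>q k\<close> decrease by exactly these squared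
    norms and stay nonnegative, so the decrements tend to 0.\<close>
  have null: "(\<lambda>k. msq n (mapply n (A k) \<eta>)) \<longlonglongrightarrow> 0" if \<eta>: "\<And>i. i < n \<Longrightarrow> \<eta> i \<in> carrier K" for \<eta>
  proof -
    define q where "q k = Re (mform n (A k) \<eta> \<eta>)" for k
    have q: "q (Suc k) = q k - msq n (mapply n (A k) \<eta>)" for k
      using AQ[of k] \<eta> by (simp add: Q_def q_def)
    have dec: "decseq q" by (rule decseq_SucI) (simp add: q msq_nonneg)
    have nonneg: "0 \<le> q k" for k unfolding q_def using pos(1)[of \<eta>, OF \<eta>] by simp
    obtain l where l: "q \<longlonglongrightarrow> l" "\<forall>i. l \<le> q i" by (rule decseq_convergent[OF dec allI[OF nonneg]]) (rule that)
    have "(\<lambda>k. q k - q (Suc k)) \<longlonglongrightarrow> l - l" by (intro tendsto_diff l(1) LIMSEQ_Suc)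
    then show ?thesis by (simp add: q)
  qed
  \<comment> \<open>A vector concentrated in slot \<open>j\<close> isolates column \<open>j\<close>,
    so that the squared norm of the whole image bounds a single entry.\<close>
  have entry: "(vnorm K (A k i j \<zeta>))\<^sup>2 \<le> msq n (mapply n (A k) (\<lambda>l. if l = j then \<zeta> else \<zero>\<^bsub>K\<^esub>))"
    if ij: "i < n" "j < n" and \<zeta>: "\<zeta> \<in> carrier K" for i j k \<zeta>
  proof -
    let ?\<eta> = "\<lambda>l. if l = j then \<zeta> else \<zero>\<^bsub>K\<^esub>"
    have "mapply n (A k) ?\<eta> i = A k i j \<zeta>"
    proof (rule K.vec_eqI)
      fix \<xi> assume \<xi>: "\<xi> \<in> carrier K"
      have "ip K \<xi> (mapply n (A k) ?\<eta> i) = (\<Sum>l<n. ip K \<xi> (A k i l (?\<eta> l)))"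
        using ij \<zeta> \<xi> AM by (intro ip_mapply(1)) auto
      also have "\<dots> = (\<Sum>l<n. if l = j then ip K \<xi> (A k i j \<zeta>) else 0)"
        using ij \<xi> AM by (intro sum.cong refl) auto
      finally show "ip K \<xi> (mapply n (A k) ?\<eta> i) = ip K \<xi> (A k i j \<zeta>)" using ij by simp
    qed (use ij \<zeta> AM in \<open>auto intro!: mapply_closed\<close>)
    moreover have "(vnorm K (mapply n (A k) ?\<eta> i))\<^sup>2 \<le> msq n (mapply n (A k) ?\<eta>)"
      unfolding msq_def using ij by (intro member_le_sum) auto
    ultimately show ?thesis by simp
  qed
  \<comment> \<open>Each entry of the matrices \<open>A k\<close> tends strongly to 0 and is a
    contraction, since the square of \<open>A k\<close> is below \<open>A k\<close> and
    \<open>A k\<close> is below 1. The bounded convergence lemma therefore applies with constant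
    1.\<close>
  have lim: "(\<lambda>k. f i j (A k i j)) \<longlonglongrightarrow> 0" if ij: "i < n" "j < n" for i j
  proof -
    have nf: "normal_functional K M (f i j)" using f ij by simp
    have f0: "f i j (op_scale K 0 (op_one K)) = 0"
      using normal_functional_linear(2)[OF nf M_one M_one, of 0] by simp
    have "(\<lambda>k. f i j (A k i j)) \<longlonglongrightarrow> f i j (op_scale K 0 (op_one K))"
    proof (rule K.normal_functional_tendsto[OF nf, where C = 1])
      show "M \<subseteq> bounded_ops K K" using M_bounded by blast
      show "A k i j \<in> M" for k using AM ij by simp
      fix \<zeta> assume \<zeta>: "\<zeta> \<in> carrier K"
      let ?\<eta> = "\<lambda>l. if l = j then \<zeta> else \<zero>\<^bsub>K\<^esub>"
      have sq\<eta>: "msq n ?\<eta> = (vnorm K \<zeta>)\<^sup>2"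
      proof -
        have "msq n ?\<eta> = (\<Sum>l<n. if l = j then (vnorm K \<zeta>)\<^sup>2 else 0)"
          unfolding msq_def by (intro sum.cong refl) auto
        then show ?thesis using ij by simp
      qed
      show "vnorm K (A k i j \<zeta>) \<le> 1 * vnorm K \<zeta>" for k
      proof -
        have "(vnorm K (A k i j \<zeta>))\<^sup>2 \<le> msq n (mapply n (A k) ?\<eta>)" by (rule entry[OF ij \<zeta>])
        also have "\<dots> \<le> Re (mform n (A k) ?\<eta> ?\<eta>)" using \<zeta> by (intro msq_mapply_le Apc) auto
        also have "\<dots> \<le> (vnorm K \<zeta>)\<^sup>2" unfolding sq\<eta>[symmetric] using \<zeta> by (intro pos(2)) auto
        finally have "vnorm K (A k i j \<zeta>) \<le> vnorm K \<zeta>" by (rule power2_le_imp_le) (use \<zeta> in simp)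
        then show ?thesis by simp
      qed
      fix \<xi> assume \<xi>: "\<xi> \<in> carrier K"
      have "(\<lambda>k. (vnorm K (A k i j \<zeta>))\<^sup>2) \<longlonglongrightarrow> 0"
      proof (rule tendsto_sandwich[OF _ _ tendsto_const null[of ?\<eta>]])
        show "\<forall>\<^sub>F k in sequentially. (vnorm K (A k i j \<zeta>))\<^sup>2 \<le> msq n (mapply n (A k) ?\<eta>)"
          using entry[OF ij \<zeta>] by simp
      qed (use \<zeta> in auto)
      then have "(\<lambda>k. sqrt ((vnorm K (A k i j \<zeta>))\<^sup>2)) \<longlonglongrightarrow> sqrt 0" by (rule tendsto_real_sqrt)
      then have z: "(\<lambda>k. vnorm K (A k i j \<zeta>)) \<longlonglongrightarrow> 0" using \<zeta> AM[OF ij] by simp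
      have "(\<lambda>k. ip K \<xi> (A k i j \<zeta>)) \<longlonglongrightarrow> 0"
      proof (rule Lim_null_comparison)
        show "\<forall>\<^sub>F k in sequentially. cmod (ip K \<xi> (A k i j \<zeta>)) \<le> vnorm K \<xi> * vnorm K (A k i j \<zeta>)"
          using \<xi> \<zeta> AM[OF ij] by (intro always_eventually allI K.Cauchy_Schwarz) auto
        show "(\<lambda>k. vnorm K \<xi> * vnorm K (A k i j \<zeta>)) \<longlonglongrightarrow> 0"
          using tendsto_mult_left[OF z, of "vnorm K \<xi>"] by simp
      qed
      then show "(\<lambda>k. ip K \<xi> (A k i j \<zeta>)) \<longlonglongrightarrow> ip K \<xi> (op_scale K 0 (op_one K) \<zeta>)"
        using \<xi> \<zeta> by (simp add: K.ip_simps)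
    qed auto
    then show ?thesis by (simp add: f0)
  qed
  have lim': "(\<lambda>k. (\<Sum>i<n. \<Sum>j<n. f i j (a i j)) - (\<Sum>i<n. \<Sum>j<n. f i j (A k i j)))
      \<longlonglongrightarrow> (\<Sum>i<n. \<Sum>j<n. f i j (a i j)) - (\<Sum>i<n. \<Sum>j<n. 0)"
    by (intro tendsto_diff tendsto_const tendsto_sum lim) auto
  have "(\<Sum>i<n. \<Sum>j<n. f i j (a i j)) - (\<Sum>i<n. \<Sum>j<n. f i j (A k i j)) \<in> \<real>\<^sub>\<ge>\<^sub>0" for k
  proof (induction k)
    case (Suc k)
    then show ?case using nonneg_Reals_add_I[OF Suc, of "(\<Sum>i<n. \<Sum>j<n. f i j (A k i j)) - (\<Sum>i<n. \<Sum>j<n. f i j (A (Suc k) i j))"]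
        AQ[of k] by (simp add: Q_def)
  qed (simp add: A0)
  then have "(\<Sum>i<n. \<Sum>j<n. f i j (a i j)) - (\<Sum>i<n. \<Sum>j<n. 0) \<in> \<real>\<^sub>\<ge>\<^sub>0"
    by (intro Lim_in_closed_set[OF closed_nonneg_Reals _ trivial_limit_sequentially lim'] always_eventually) auto
  then show ?thesis by simp
qed

text \<open>Division by a bound for the norm of the matrix reduces this to positive
  contractions.\<close>

lemma positive_normal:
  fixes n :: nat
  assumes aM: "\<And>i j. \<lbrakk>i < n; j < n\<rbrakk> \<Longrightarrow> a i j \<in> M"
    and pos: "\<And>\<eta>. (\<And>i. i < n \<Longrightarrow> \<eta> i \<in> carrier K) \<Longrightarrow> (\<Sum>i<n. \<Sum>j<n. ip K (\<eta> i) (a i j (\<eta> j))) \<in> \<real>\<^sub>\<ge>\<^sub>0"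
    and f: "\<And>i j. \<lbrakk>i < n; j < n\<rbrakk> \<Longrightarrow> normal_functional K M (f i j)"
    and sq: "\<And>c. (\<And>i. i < n \<Longrightarrow> c i \<in> M) \<Longrightarrow> (\<Sum>i<n. \<Sum>j<n. f i j (op_mult K (adjoint K K (c i)) (c j))) \<in> \<real>\<^sub>\<ge>\<^sub>0"
  shows "(\<Sum>i<n. \<Sum>j<n. f i j (a i j)) \<in> \<real>\<^sub>\<ge>\<^sub>0"
proof -
  have "\<exists>c. c > 0 \<and> (\<forall>\<xi>\<in>carrier K. vnorm K (a i j \<xi>) \<le> c * vnorm K \<xi>)" if "i < n" "j < n" for i j
    using KK.bounded_ops_bound[OF M_bounded[OF aM[OF that]]] by metis
  then obtain c where c: "\<And>i j. \<lbrakk>i < n; j < n\<rbrakk> \<Longrightarrow> c i j > 0"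
    "\<And>i j \<xi>. \<lbrakk>i < n; j < n; \<xi> \<in> carrier K\<rbrakk> \<Longrightarrow> vnorm K (a i j \<xi>) \<le> c i j * vnorm K \<xi>"
    by metis
  \<comment> \<open>The sum of the entry bounds dominates the form, because a product of two
    coordinate norms is at most \<open>msq\<close>. The added 1 keeps \<open>C\<close> positive for
    \<open>n = 0\<close> as well.\<close>
  define C where "C = 1 + (\<Sum>i<n. \<Sum>j<n. c i j)"
  have C: "C > 0" unfolding C_def using c(1) by (intro add_pos_nonneg sum_nonneg) (auto intro: less_imp_le)
  have bound: "Re (mform n a \<eta> \<eta>) \<le> C * msq n \<eta>" if \<eta>: "\<And>i. i < n \<Longrightarrow> \<eta> i \<in> carrier K" for \<eta>
  proof -
    have "Re (ip K (\<eta> i) (a i j (\<eta> j))) \<le> c i j * msq n \<eta>" if ij: "i < n" "j < n" for i j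
    proof -
      have le: "(vnorm K (\<eta> l))\<^sup>2 \<le> msq n \<eta>" if "l < n" for l
        unfolding msq_def using that by (intro member_le_sum) auto
      have "Re (ip K (\<eta> i) (a i j (\<eta> j))) \<le> cmod (ip K (\<eta> i) (a i j (\<eta> j)))" by (rule complex_Re_le_cmod)
      also have "\<dots> \<le> vnorm K (\<eta> i) * vnorm K (a i j (\<eta> j))"
        using \<eta> ij aM by (intro K.Cauchy_Schwarz) auto
      also have "\<dots> \<le> vnorm K (\<eta> i) * (c i j * vnorm K (\<eta> j))"
        using \<eta> ij c by (intro mult_left_mono) auto
      also have "\<dots> = c i j * (vnorm K (\<eta> i) * vnorm K (\<eta> j))" by simp
      also have "\<dots> \<le> c i j * msq n \<eta>"
      proof (intro mult_left_mono)
        show "vnorm K (\<eta> i) * vnorm K (\<eta> j) \<le> msq n \<eta>"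
          using sum_squares_bound[of "vnorm K (\<eta> i)" "vnorm K (\<eta> j)"] le[OF ij(1)] le[OF ij(2)] by linarith
      qed (use c(1)[OF ij] in simp)
      finally show ?thesis .
    qed
    then have "Re (mform n a \<eta> \<eta>) \<le> (\<Sum>i<n. \<Sum>j<n. c i j * msq n \<eta>)"
      unfolding mform_def Re_sum by (intro sum_mono) auto
    also have "\<dots> = (\<Sum>i<n. \<Sum>j<n. c i j) * msq n \<eta>" by (simp add: sum_distrib_right)
    also have "\<dots> \<le> C * msq n \<eta>" by (simp add: C_def algebra_simps msq_nonneg)
    finally show ?thesis .
  qed
  define b where "b i j = op_scale K (of_real (1 / C)) (a i j)" for i j
  have form: "mform n b \<eta> \<eta> = of_real (1 / C) * mform n a \<eta> \<eta>" if \<eta>: "\<And>i. i < n \<Longrightarrow> \<eta> i \<in> carrier K" for \<eta>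
    unfolding mform_def b_def sum_distrib_left
    using \<eta> aM by (intro sum.cong refl) (simp add: K.ip_simps)
  have "positive_contraction n b"
    unfolding positive_contraction_def
  proof (intro conjI allI impI)
    fix \<eta> assume "\<forall>i<n. \<eta> i \<in> carrier K"
    then have \<eta>: "\<And>i. i < n \<Longrightarrow> \<eta> i \<in> carrier K" by simp
    have form\<eta>: "mform n b \<eta> \<eta> = of_real (1 / C) * mform n a \<eta> \<eta>" by (rule form) (rule \<eta>)
    have bound\<eta>: "Re (mform n a \<eta> \<eta>) \<le> C * msq n \<eta>" by (rule bound) (rule \<eta>)
    have "mform n a \<eta> \<eta> \<in> \<real>\<^sub>\<ge>\<^sub>0" unfolding mform_def by (rule pos) (rule \<eta>)
    then have "of_real (1 / C) * mform n a \<eta> \<eta> \<in> \<real>\<^sub>\<ge>\<^sub>0"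
      using C by (simp add: complex_nonneg_Reals_iff)
    then show "mform n b \<eta> \<eta> \<in> \<real>\<^sub>\<ge>\<^sub>0" by (simp only: form\<eta>)
    have "Re (mform n b \<eta> \<eta>) = Re (mform n a \<eta> \<eta>) / C" using form\<eta> by simp
    also have "\<dots> \<le> msq n \<eta>" using bound\<eta> C by (simp add: pos_divide_le_eq mult.commute)
    finally show "Re (mform n b \<eta> \<eta>) \<le> msq n \<eta>" .
  qed (use aM in \<open>simp add: b_def\<close>)
  then have pos_b: "(\<Sum>i<n. \<Sum>j<n. f i j (b i j)) \<in> \<real>\<^sub>\<ge>\<^sub>0"
    by (rule positive_contraction_normal) (simp_all add: f sq)
  have "of_real C * f i j (b i j) = f i j (a i j)" if ij: "i < n" "j < n" for i j
    using normal_functional_linear(2)[OF f[OF ij] aM[OF ij] aM[OF ij], of "of_real (1 / C)"] C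
    by (simp add: b_def)
  then have "of_real C * (\<Sum>i<n. \<Sum>j<n. f i j (b i j)) = (\<Sum>i<n. \<Sum>j<n. f i j (a i j))"
    unfolding sum_distrib_left by (intro sum.cong refl) simp
  moreover have "of_real C * (\<Sum>i<n. \<Sum>j<n. f i j (b i j)) \<in> \<real>\<^sub>\<ge>\<^sub>0"
    using C pos_b by (simp only: complex_nonneg_Reals_iff Re_complex_of_real Im_complex_of_real
        times_complex.sel) simp
  ultimately show ?thesis by simp
qed

end

section \<open>Modules and the standard space\<close>

locale right_module = vn_algebra K M for K :: "('a, 'z) hilb_scheme" and M +
  fixes G :: "('a \<Rightarrow> 'a, 'b, 'y) rmod_scheme"
  assumes right_module: "right_W_module K M G"
begin

sublocale G: hilbert_space G using right_module by (simp add: right_W_module_def)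
sublocale GG: hilbert_pair G G ..

lemma rop_star_map: "normal_star_map K M G (rop G)"
  using right_module by (simp add: right_W_module_def normal_antirep_def)

lemma rop_bounded: "x \<in> M \<Longrightarrow> rop G x \<in> bounded_ops G G"
  using rop_star_map by (auto simp: normal_star_map_def)

lemma rop_apply [simp]: "\<xi> \<in> carrier G \<Longrightarrow> rop G x \<xi> = ract G \<xi> x"
  by (simp add: rop_def)

context
  fixes x \<xi> assumes x: "x \<in> M" and \<xi>: "\<xi> \<in> carrier G"
begin

lemma ract_closed [simp]: "ract G \<xi> x \<in> carrier G"
  using bounded_ops_closed[OF rop_bounded[OF x] \<xi>] \<xi> by simp

lemma ract_smult: "ract G (c \<odot>\<^bsub>G\<^esub> \<xi>) x = c \<odot>\<^bsub>G\<^esub> ract G \<xi> x"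
  using bounded_ops_smult[OF rop_bounded[OF x] \<xi>, of c] \<xi> by simp

lemma ract_diff: "\<eta> \<in> carrier G \<Longrightarrow> ract G (\<xi> \<ominus>\<^bsub>G\<^esub> \<eta>) x = ract G \<xi> x \<ominus>\<^bsub>G\<^esub> ract G \<eta> x"
  using GG.bounded_ops_diff[OF rop_bounded[OF x] \<xi>, of \<eta>] \<xi> by simp

lemma ract_op_add: "y \<in> M \<Longrightarrow> ract G \<xi> (op_add K x y) = ract G \<xi> x \<oplus>\<^bsub>G\<^esub> ract G \<xi> y"
  using rop_star_map x \<xi> rop_apply[OF \<xi>, of "op_add K x y"]
  by (auto simp: normal_star_map_def op_add_def[of G])

lemma ract_op_scale: "ract G \<xi> (op_scale K c x) = c \<odot>\<^bsub>G\<^esub> ract G \<xi> x"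
  using rop_star_map x \<xi> rop_apply[OF \<xi>, of "op_scale K c x"]
  by (auto simp: normal_star_map_def op_scale_def[of G])

lemma ract_op_mult: "y \<in> M \<Longrightarrow> ract G \<xi> (op_mult K x y) = ract G (ract G \<xi> x) y"
proof -
  assume y: "y \<in> M"
  have "rop G (op_mult K x y) = op_mult G (rop G y) (rop G x)"
    using right_module x y by (simp add: right_W_module_def normal_antirep_def)
  then have "rop G (op_mult K x y) \<xi> = op_mult G (rop G y) (rop G x) \<xi>" by simp
  then show ?thesis using \<xi> x by (simp add: compose_eq)
qed

lemma ract_adjoint: "\<eta> \<in> carrier G \<Longrightarrow> ip G (ract G \<xi> x) \<eta> = ip G \<xi> (ract G \<eta> (adjoint K K x))"
proof -
  assume \<eta>: "\<eta> \<in> carrier G"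
  have "rop G (adjoint K K x) = adjoint G G (rop G x)"
    using rop_star_map x by (simp add: normal_star_map_def)
  then show ?thesis
    using GG.adjoint_right[OF rop_bounded[OF x] \<eta> \<xi>] \<eta> \<xi> rop_apply[OF \<eta>, of "adjoint K K x"] by simp
qed

end

lemma ract_one [simp]: "\<xi> \<in> carrier G \<Longrightarrow> ract G \<xi> (op_one K) = \<xi>"
  using rop_star_map rop_apply[of \<xi> "op_one K"]
  by (auto simp: normal_star_map_def op_one_def[of G])

lemma ract_bound:
  assumes "x \<in> M"
  obtains c where "c > 0" "\<And>\<xi>. \<xi> \<in> carrier G \<Longrightarrow> vnorm G (ract G \<xi> x) \<le> c * vnorm G \<xi>"
proof -
  obtain c where "c > 0" "\<And>\<xi>. \<xi> \<in> carrier G \<Longrightarrow> vnorm G (rop G x \<xi>) \<le> c * vnorm G \<xi>"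
    by (rule GG.bounded_ops_bound[OF rop_bounded[OF assms]]) blast
  then show ?thesis by (intro that[of c]) auto
qed

end

locale bimodule = vn_algebra K M for K :: "('a, 'z) hilb_scheme" and M +
  fixes G :: "('a \<Rightarrow> 'a, 'b, 'y) bimod_scheme"
  assumes bimodule: "W_bimodule K M G"
begin

sublocale right_module K M G using bimodule by unfold_locales (simp add: W_bimodule_def)

lemma lop_rep: "normal_rep K M G (lop G)"
  using bimodule by (simp add: W_bimodule_def)

lemma lop_star_map: "normal_star_map K M G (lop G)"
  using lop_rep by (simp add: normal_rep_def)

lemma lop_bounded: "x \<in> M \<Longrightarrow> lop G x \<in> bounded_ops G G"
  using lop_star_map by (auto simp: normal_star_map_def)

lemma lop_apply [simp]: "\<xi> \<in> carrier G \<Longrightarrow> lop G x \<xi> = lact G x \<xi>"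
  by (simp add: lop_def)

context
  fixes x \<xi> assumes x: "x \<in> M" and \<xi>: "\<xi> \<in> carrier G"
begin

lemma lact_closed [simp]: "lact G x \<xi> \<in> carrier G"
  using bounded_ops_closed[OF lop_bounded[OF x] \<xi>] \<xi> by simp

lemma lact_smult: "lact G x (c \<odot>\<^bsub>G\<^esub> \<xi>) = c \<odot>\<^bsub>G\<^esub> lact G x \<xi>"
  using bounded_ops_smult[OF lop_bounded[OF x] \<xi>, of c] \<xi> by simp

lemma lact_diff: "\<eta> \<in> carrier G \<Longrightarrow> lact G x (\<xi> \<ominus>\<^bsub>G\<^esub> \<eta>) = lact G x \<xi> \<ominus>\<^bsub>G\<^esub> lact G x \<eta>"
  using GG.bounded_ops_diff[OF lop_bounded[OF x] \<xi>, of \<eta>] \<xi> by simp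

lemma lact_op_add: "y \<in> M \<Longrightarrow> lact G (op_add K x y) \<xi> = lact G x \<xi> \<oplus>\<^bsub>G\<^esub> lact G y \<xi>"
  using lop_star_map x \<xi> lop_apply[OF \<xi>, of "op_add K x y"]
  by (auto simp: normal_star_map_def op_add_def[of G])

lemma lact_op_scale: "lact G (op_scale K c x) \<xi> = c \<odot>\<^bsub>G\<^esub> lact G x \<xi>"
  using lop_star_map x \<xi> lop_apply[OF \<xi>, of "op_scale K c x"]
  by (auto simp: normal_star_map_def op_scale_def[of G])

lemma lact_op_mult: "y \<in> M \<Longrightarrow> lact G (op_mult K y x) \<xi> = lact G y (lact G x \<xi>)"
proof -
  assume y: "y \<in> M"
  have "lop G (op_mult K y x) = op_mult G (lop G y) (lop G x)"
    using lop_rep x y by (simp add: normal_rep_def)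
  then have "lop G (op_mult K y x) \<xi> = op_mult G (lop G y) (lop G x) \<xi>" by simp
  then show ?thesis using \<xi> x by (simp add: compose_eq)
qed

lemma lact_adjoint: "\<eta> \<in> carrier G \<Longrightarrow> ip G (lact G x \<xi>) \<eta> = ip G \<xi> (lact G (adjoint K K x) \<eta>)"
proof -
  assume \<eta>: "\<eta> \<in> carrier G"
  have "lop G (adjoint K K x) = adjoint G G (lop G x)"
    using lop_star_map x by (simp add: normal_star_map_def)
  then show ?thesis
    using GG.adjoint_right[OF lop_bounded[OF x] \<eta> \<xi>] \<eta> \<xi> lop_apply[OF \<eta>, of "adjoint K K x"] by simp
qed

lemma lact_ract: "y \<in> M \<Longrightarrow> ract G (lact G x \<xi>) y = lact G x (ract G \<xi> y)"
  using bimodule x \<xi> by (simp add: W_bimodule_def)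

end

lemma lact_one [simp]: "\<xi> \<in> carrier G \<Longrightarrow> lact G (op_one K) \<xi> = \<xi>"
  using lop_star_map lop_apply[of \<xi> "op_one K"]
  by (auto simp: normal_star_map_def op_one_def[of G])

lemma lact_bound:
  assumes "x \<in> M"
  obtains c where "c > 0" "\<And>\<xi>. \<xi> \<in> carrier G \<Longrightarrow> vnorm G (lact G x \<xi>) \<le> c * vnorm G \<xi>"
proof -
  obtain c where "c > 0" "\<And>\<xi>. \<xi> \<in> carrier G \<Longrightarrow> vnorm G (lop G x \<xi>) \<le> c * vnorm G \<xi>"
    by (rule GG.bounded_ops_bound[OF lop_bounded[OF assms]]) blast
  then show ?thesis by (intro that[of c]) auto
qed

end

section \<open>The standard space: the commutant of M, and density of Omega M\<close>

context standard_space
begin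

sublocale vn_algebra K M by unfold_locales (rule von_neumann)
sublocale L2: bimodule K M L2 by unfold_locales (rule L2_bimodule)
sublocale N: vn_algebra L2 "lop L2 ` M" using L2_standard by unfold_locales (simp add: standard_form_def)

lemma lop_inj: "inj_on (lop L2) M"
  using L2_left by (simp add: vn_isomorphism_def bij_betw_def)

lemma J_closed: "\<xi> \<in> carrier L2 \<Longrightarrow> J \<xi> \<in> carrier L2"
  using L2_standard by (auto simp: standard_form_def)

lemma Omega_closed [simp]: "\<Omega> \<in> carrier L2"
proof -
  have "P = {\<eta> \<in> carrier L2. \<forall>\<xi>\<in>P. ip L2 \<xi> \<eta> \<in> \<real>\<^sub>\<ge>\<^sub>0}" using L2_standard by (simp only: standard_form_def)
  then show ?thesis using Omega_cone by blast
qed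

text \<open>The standard form gives the commutant as the conjugate of the left copy of
  \<open>M\<close> under \<open>J\<close>, and the right action of x is by definition that conjugate
  of x*. As x runs through \<open>M\<close>, so does x*.\<close>

lemma commutant_left: "commutant L2 (lop L2 ` M) = rop L2 ` M"
proof -
  have *: "(\<lambda>\<xi>\<in>carrier L2. J (lop L2 x (J \<xi>))) = rop L2 (adjoint K K x)" if "x \<in> M" for x
    using that by (auto simp: fun_eq_iff rop_def J_closed L2_right)
  have "commutant L2 (lop L2 ` M) = (\<lambda>x. \<lambda>\<xi>\<in>carrier L2. J (x (J \<xi>))) ` (lop L2 ` M)"
    using L2_standard by (simp only: standard_form_def)
  also have "\<dots> = (\<lambda>x. rop L2 (adjoint K K x)) ` M" unfolding image_image using * by (intro image_cong) auto
  also have "\<dots> = rop L2 ` M"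
  proof
    show "rop L2 ` M \<subseteq> (\<lambda>x. rop L2 (adjoint K K x)) ` M"
    proof
      fix z assume "z \<in> rop L2 ` M"
      then obtain y where "y \<in> M" "z = rop L2 y" by blast
      then show "z \<in> (\<lambda>x. rop L2 (adjoint K K x)) ` M" by (intro image_eqI[of _ _ "adjoint K K y"]) auto
    qed
  qed auto
  finally show ?thesis .
qed

text \<open>The right action is the whole commutant of the left copy of \<open>M\<close>, so right
  linearity puts \<open>f\<close> into the bicommutant of that copy.\<close>

lemma right_linear_op_in_M:
  assumes f: "f \<in> bounded_ops L2 L2"
    and r: "\<And>x \<xi>. \<lbrakk>x \<in> M; \<xi> \<in> carrier L2\<rbrakk> \<Longrightarrow> f (ract L2 \<xi> x) = ract L2 (f \<xi>) x"
  obtains m where "m \<in> M" "lop L2 m = f"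
proof -
  have "f \<in> lop L2 ` M"
    unfolding N.M_iff commutant_left using f r bounded_ops_closed[OF f] by simp
  then show ?thesis using that by blast
qed

lemma lop_eqI:
  assumes "m \<in> M" "m' \<in> M" "\<And>\<alpha> \<beta>. \<lbrakk>\<alpha> \<in> carrier L2; \<beta> \<in> carrier L2\<rbrakk> \<Longrightarrow> ip L2 \<alpha> (lact L2 m \<beta>) = ip L2 \<alpha> (lact L2 m' \<beta>)"
  shows "m = m'"
proof (rule inj_onD[OF lop_inj _ assms(1,2)])
  show "lop L2 m = lop L2 m'"
    using assms by (intro L2.GG.bounded_ops_eqI) (auto simp: L2.lop_bounded)
qed

text \<open>\<open>\<Omega>\<close> is separating for \<open>M\<close>, since \<open>\<phi>\<close> is faithful, and hence cyclic for the commutant: the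
  projection onto the closure of \<open>\<Omega> M\<close> is an element of \<open>M\<close> that fixes \<open>\<Omega>\<close>.\<close>

lemma Omega_dense:
  assumes "\<alpha> \<in> carrier L2" "e > 0"
  shows "\<exists>x\<in>M. vnorm L2 (ract L2 \<Omega> x \<ominus>\<^bsub>L2\<^esub> \<alpha>) < e"
proof -
  define S where "S = {\<alpha> \<in> carrier L2. \<forall>e>0. \<exists>x\<in>M. vnorm L2 (ract L2 \<Omega> x \<ominus>\<^bsub>L2\<^esub> \<alpha>) < e}"
  have SI: "\<alpha> \<in> S" if "\<alpha> \<in> carrier L2" "\<And>e. e > 0 \<Longrightarrow> \<exists>x\<in>M. vnorm L2 (ract L2 \<Omega> x \<ominus>\<^bsub>L2\<^esub> \<alpha>) < e" for \<alpha>
    using that by (simp add: S_def)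
  have SL: "\<alpha> \<in> carrier L2" if "\<alpha> \<in> S" for \<alpha> using that by (simp add: S_def)
  have SD: "\<exists>x\<in>M. vnorm L2 (ract L2 \<Omega> x \<ominus>\<^bsub>L2\<^esub> \<alpha>) < e" if "\<alpha> \<in> S" "e > 0" for \<alpha> e
    using that by (simp add: S_def)
  have range_S: "ract L2 \<Omega> x \<in> S" if "x \<in> M" for x
    using that by (intro SI) (auto intro!: bexI[of _ x] simp: L2.G.vnorm_eq_0[THEN iffD2])
  have S_smult: "c \<odot>\<^bsub>L2\<^esub> \<alpha> \<in> S" if \<alpha>: "\<alpha> \<in> S" for c \<alpha>
  proof (rule SI)
    fix e :: real assume e: "e > 0"
    then have "e / (cmod c + 1) > 0" by (simp add: add_nonneg_pos)
    from SD[OF \<alpha> this] obtain x where x: "x \<in> M" "vnorm L2 (ract L2 \<Omega> x \<ominus>\<^bsub>L2\<^esub> \<alpha>) < e / (cmod c + 1)" by blast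
    let ?d = "ract L2 \<Omega> x \<ominus>\<^bsub>L2\<^esub> \<alpha>"
    have "cmod c * vnorm L2 ?d \<le> (cmod c + 1) * vnorm L2 ?d"
      using SL[OF \<alpha>] x by (intro mult_right_mono) auto
    also have "\<dots> = vnorm L2 ?d * (cmod c + 1)" by (rule mult.commute)
    also have "\<dots> < e" using x(2) by (subst (asm) pos_less_divide_eq) (auto simp: add_nonneg_pos)
    finally have *: "cmod c * vnorm L2 ?d < e" .
    have "ract L2 \<Omega> (op_scale K c x) \<ominus>\<^bsub>L2\<^esub> c \<odot>\<^bsub>L2\<^esub> \<alpha> = c \<odot>\<^bsub>L2\<^esub> ?d"
      using x SL[OF \<alpha>] by (intro L2.G.vec_eqI) (auto simp: L2.ract_op_scale L2.G.ip_simps algebra_simps)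
    then show "\<exists>x\<in>M. vnorm L2 (ract L2 \<Omega> x \<ominus>\<^bsub>L2\<^esub> c \<odot>\<^bsub>L2\<^esub> \<alpha>) < e"
      using x SL[OF \<alpha>] * by (intro bexI[of _ "op_scale K c x"]) (auto simp: L2.G.vnorm_smult)
  qed (use SL[OF \<alpha>] in simp)
  have S: "L2.G.closed_subspace S"
    unfolding L2.G.closed_subspace_def
  proof (intro conjI ballI allI impI)
    show "S \<subseteq> carrier L2" using SL by blast
    show "\<zero>\<^bsub>L2\<^esub> \<in> S" using S_smult[OF range_S[OF M_one], of 0] by (simp add: L2.G.smult_l_null[simplified])
    show "c \<odot>\<^bsub>L2\<^esub> \<alpha> \<in> S" if "\<alpha> \<in> S" for c \<alpha> by (rule S_smult[OF that])
  next
    fix \<alpha> \<beta> assume \<alpha>: "\<alpha> \<in> S" and \<beta>: "\<beta> \<in> S"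
    show "\<alpha> \<oplus>\<^bsub>L2\<^esub> \<beta> \<in> S"
    proof (rule SI)
      fix e :: real assume e: "e > 0"
      then have e2: "e / 2 > 0" by simp
      obtain x where x: "x \<in> M" "vnorm L2 (ract L2 \<Omega> x \<ominus>\<^bsub>L2\<^esub> \<alpha>) < e / 2" using SD[OF \<alpha> e2] by blast
      obtain y where y: "y \<in> M" "vnorm L2 (ract L2 \<Omega> y \<ominus>\<^bsub>L2\<^esub> \<beta>) < e / 2" using SD[OF \<beta> e2] by blast
      have "ract L2 \<Omega> (op_add K x y) \<ominus>\<^bsub>L2\<^esub> (\<alpha> \<oplus>\<^bsub>L2\<^esub> \<beta>) = (ract L2 \<Omega> x \<ominus>\<^bsub>L2\<^esub> \<alpha>) \<oplus>\<^bsub>L2\<^esub> (ract L2 \<Omega> y \<ominus>\<^bsub>L2\<^esub> \<beta>)"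
        using x y SL[OF \<alpha>] SL[OF \<beta>] by (intro L2.G.vec_eqI) (auto simp: L2.ract_op_add L2.G.ip_simps)
      then have "vnorm L2 (ract L2 \<Omega> (op_add K x y) \<ominus>\<^bsub>L2\<^esub> (\<alpha> \<oplus>\<^bsub>L2\<^esub> \<beta>)) < e"
        using L2.G.vnorm_triangle[of "ract L2 \<Omega> x \<ominus>\<^bsub>L2\<^esub> \<alpha>" "ract L2 \<Omega> y \<ominus>\<^bsub>L2\<^esub> \<beta>"] x y SL[OF \<alpha>] SL[OF \<beta>] by simp
      then show "\<exists>x\<in>M. vnorm L2 (ract L2 \<Omega> x \<ominus>\<^bsub>L2\<^esub> (\<alpha> \<oplus>\<^bsub>L2\<^esub> \<beta>)) < e"
        using x y by (intro bexI[of _ "op_add K x y"]) auto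
    qed (use SL \<alpha> \<beta> in simp)
  next
    fix s :: "nat \<Rightarrow> 'h" and l
    assume "(\<forall>n. s n \<in> S) \<and> l \<in> carrier L2 \<and> (\<lambda>n. vnorm L2 (s n \<ominus>\<^bsub>L2\<^esub> l)) \<longlonglongrightarrow> 0"
    then have s: "\<forall>n. s n \<in> S" and l: "l \<in> carrier L2" and lim: "(\<lambda>n. vnorm L2 (s n \<ominus>\<^bsub>L2\<^esub> l)) \<longlonglongrightarrow> 0" by auto
    show "l \<in> S"
    proof (rule SI[OF l])
      fix e :: real assume "e > 0"
      then have e2: "e / 2 > 0" by simp
      obtain n where n: "vnorm L2 (s n \<ominus>\<^bsub>L2\<^esub> l) < e / 2"
        using order_tendstoD(2)[OF lim e2] by (auto simp: eventually_sequentially)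
      obtain x where x: "x \<in> M" "vnorm L2 (ract L2 \<Omega> x \<ominus>\<^bsub>L2\<^esub> s n) < e / 2" using SD[of "s n", OF _ e2] s by blast
      have "vnorm L2 (ract L2 \<Omega> x \<ominus>\<^bsub>L2\<^esub> l) < e"
        using L2.G.vnorm_diff_triangle[of "ract L2 \<Omega> x" "s n" l] x n l SL[of "s n"] s by simp
      then show "\<exists>x\<in>M. vnorm L2 (ract L2 \<Omega> x \<ominus>\<^bsub>L2\<^esub> l) < e" using x by blast
    qed
  qed
  \<comment> \<open>\<open>S\<close> is invariant under the right action of \<open>M\<close>, hence
    also under that of adjoints. This will make the projection onto \<open>S\<close> right
    linear.\<close>
  have S_ract: "ract L2 \<alpha> z \<in> S" if \<alpha>: "\<alpha> \<in> S" and z: "z \<in> M" for \<alpha> z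
  proof (rule SI)
    fix e :: real assume e: "e > 0"
    obtain c where c: "c > 0" "\<And>\<xi>. \<xi> \<in> carrier L2 \<Longrightarrow> vnorm L2 (ract L2 \<xi> z) \<le> c * vnorm L2 \<xi>"
      by (rule L2.ract_bound[OF z]) blast
    have "e / c > 0" using e c by simp
    from SD[OF \<alpha> this] obtain x where x: "x \<in> M" "vnorm L2 (ract L2 \<Omega> x \<ominus>\<^bsub>L2\<^esub> \<alpha>) < e / c" by blast
    have "ract L2 \<Omega> (op_mult K x z) \<ominus>\<^bsub>L2\<^esub> ract L2 \<alpha> z = ract L2 (ract L2 \<Omega> x \<ominus>\<^bsub>L2\<^esub> \<alpha>) z"
      using x z SL[OF \<alpha>] by (simp add: L2.ract_op_mult L2.ract_diff)
    moreover have "vnorm L2 (ract L2 (ract L2 \<Omega> x \<ominus>\<^bsub>L2\<^esub> \<alpha>) z) \<le> c * vnorm L2 (ract L2 \<Omega> x \<ominus>\<^bsub>L2\<^esub> \<alpha>)"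
      using x SL[OF \<alpha>] by (intro c(2)) auto
    moreover have "c * vnorm L2 (ract L2 \<Omega> x \<ominus>\<^bsub>L2\<^esub> \<alpha>) < e" using x(2) c(1) by (simp add: field_simps)
    ultimately show "\<exists>x\<in>M. vnorm L2 (ract L2 \<Omega> x \<ominus>\<^bsub>L2\<^esub> ract L2 \<alpha> z) < e"
      using x z by (intro bexI[of _ "op_mult K x z"]) auto
  qed (use SL[OF \<alpha>] z in simp)
  \<comment> \<open>Riesz representation on \<open>S\<close> of the functional given by \<eta>
    produces the orthogonal projection of \<eta>.\<close>
  have "\<exists>\<zeta>. \<zeta> \<in> S \<and> (\<forall>\<xi>\<in>S. ip L2 \<zeta> \<xi> = ip L2 \<eta> \<xi>)" if \<eta>: "\<eta> \<in> carrier L2" for \<eta>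
    using L2.G.Riesz_representation[OF S, of "ip L2 \<eta>" "vnorm L2 \<eta>"] \<eta> SL
    by (auto simp: L2.G.ip_add L2.G.ip_smult L2.G.Cauchy_Schwarz)
  then obtain q where q: "\<And>\<eta>. \<eta> \<in> carrier L2 \<Longrightarrow> q \<eta> \<in> S"
    "\<And>\<eta> \<xi>. \<eta> \<in> carrier L2 \<Longrightarrow> \<xi> \<in> S \<Longrightarrow> ip L2 (q \<eta>) \<xi> = ip L2 \<eta> \<xi>" by metis
  have q_eq: "q \<eta> = \<zeta>" if "\<eta> \<in> carrier L2" "\<zeta> \<in> S" "\<And>\<xi>. \<xi> \<in> S \<Longrightarrow> ip L2 \<zeta> \<xi> = ip L2 \<eta> \<xi>" for \<eta> \<zeta>
  proof -
    note m = SL[OF q(1)[OF that(1)]] SL[OF that(2)]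
    have "ip L2 (q \<eta> \<ominus>\<^bsub>L2\<^esub> \<zeta>) (q \<eta> \<ominus>\<^bsub>L2\<^esub> \<zeta>) = 0"
      using m q that by simp
    then have "q \<eta> \<ominus>\<^bsub>L2\<^esub> \<zeta> = \<zero>\<^bsub>L2\<^esub>" using m by (intro L2.G.ip_definite) auto
    then show ?thesis using m by simp
  qed
  note S_add = L2.G.closed_subspace_add[OF S]
  define p where "p = restrict q (carrier L2)"
  have p: "p \<in> bounded_ops L2 L2"
  proof (rule L2.GG.bounded_opsI[where c = 1])
    fix \<eta> assume \<eta>: "\<eta> \<in> carrier L2"
    have m: "q \<eta> \<in> carrier L2" using SL q \<eta> by blast
    have "(vnorm L2 (q \<eta>))\<^sup>2 = Re (ip L2 \<eta> (q \<eta>))" using m q \<eta> by (simp add: L2.G.vnorm_sq)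
    also have "\<dots> \<le> vnorm L2 \<eta> * vnorm L2 (q \<eta>)"
      using L2.G.Cauchy_Schwarz[OF \<eta> m] complex_Re_le_cmod[of "ip L2 \<eta> (q \<eta>)"] by linarith
    finally have "vnorm L2 (q \<eta>) * vnorm L2 (q \<eta>) \<le> vnorm L2 (q \<eta>) * vnorm L2 \<eta>"
      by (simp add: power2_eq_square mult.commute)
    then have "vnorm L2 (q \<eta>) \<le> vnorm L2 \<eta>" by (rule mult_self_le_imp_le) (use m \<eta> in auto)
    then show "vnorm L2 (p \<eta>) \<le> 1 * vnorm L2 \<eta>" using \<eta> by (simp add: p_def)
  next
    fix \<xi> \<eta> assume "\<xi> \<in> carrier L2" "\<eta> \<in> carrier L2"
    then show "p (\<xi> \<oplus>\<^bsub>L2\<^esub> \<eta>) = p \<xi> \<oplus>\<^bsub>L2\<^esub> p \<eta>"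
      unfolding p_def using q SL by (simp add: q_eq S_add L2.G.ip_simps)
  next
    fix \<xi> c assume "\<xi> \<in> carrier L2"
    then show "p (c \<odot>\<^bsub>L2\<^esub> \<xi>) = c \<odot>\<^bsub>L2\<^esub> p \<xi>"
      unfolding p_def using q SL by (simp add: q_eq S_smult L2.G.ip_simps)
  qed (use SL q in \<open>auto simp: p_def\<close>)
  have "p (ract L2 \<eta> z) = ract L2 (p \<eta>) z" if z: "z \<in> M" and \<eta>: "\<eta> \<in> carrier L2" for z \<eta>
  proof -
    have "q (ract L2 \<eta> z) = ract L2 (q \<eta>) z"
    proof (rule q_eq)
      fix \<xi> assume \<xi>: "\<xi> \<in> S"
      have "ip L2 (ract L2 (q \<eta>) z) \<xi> = ip L2 (q \<eta>) (ract L2 \<xi> (adjoint K K z))"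
        using SL q \<eta> \<xi> z by (intro L2.ract_adjoint) auto
      also have "\<dots> = ip L2 \<eta> (ract L2 \<xi> (adjoint K K z))" using q \<eta> \<xi> z S_ract by simp
      also have "\<dots> = ip L2 (ract L2 \<eta> z) \<xi>" using SL \<eta> \<xi> z by (intro L2.ract_adjoint[symmetric]) auto
      finally show "ip L2 (ract L2 (q \<eta>) z) \<xi> = ip L2 (ract L2 \<eta> z) \<xi>" .
    qed (use q \<eta> z S_ract in auto)
    then show ?thesis using \<eta> z by (simp add: p_def)
  qed
  then obtain m where m: "m \<in> M" "lop L2 m = p" using right_linear_op_in_M[OF p] by blast
  have m_apply: "lact L2 m \<eta> = q \<eta>" if "\<eta> \<in> carrier L2" for \<eta>
    using that m(2) L2.lop_apply[OF that, of m] by (simp add: p_def)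
  \<comment> \<open>The complementary projection, as an element of \<open>M\<close>. It annihilates
    \<open>\<Omega>\<close>, so \<phi> vanishes at d* d and faithfulness forces d = 0: the
    projection is the identity.\<close>
  define d where "d = op_add K (op_one K) (op_scale K (-1) m)"
  have d: "d \<in> M" using m by (simp add: d_def)
  have d_apply: "lact L2 d \<eta> = \<eta> \<ominus>\<^bsub>L2\<^esub> q \<eta>" if \<eta>: "\<eta> \<in> carrier L2" for \<eta>
    unfolding d_def using \<eta> m SL q(1)[OF \<eta>]
    by (intro L2.G.vec_eqI) (auto simp: L2.lact_op_add L2.lact_op_scale m_apply L2.G.ip_simps)
  have "\<Omega> \<in> S" using range_S[OF M_one] by simp
  then have "q \<Omega> = \<Omega>" by (intro q_eq) auto
  then have d\<Omega>: "lact L2 d \<Omega> = \<zero>\<^bsub>L2\<^esub>" using d_apply[of \<Omega>] by simp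
  have "\<phi> (op_mult K (adjoint K K d) d) = ip L2 \<Omega> (lact L2 (adjoint K K d) (lact L2 d \<Omega>))"
    using d by (simp add: Omega_state L2.lact_op_mult)
  also have "\<dots> = ip L2 (lact L2 d \<Omega>) (lact L2 d \<Omega>)"
    using d by (intro L2.lact_adjoint[symmetric]) auto
  finally have "\<phi> (op_mult K (adjoint K K d) d) = 0" by (simp add: d\<Omega>)
  then have "d = op_scale K 0 (op_one K)" using state d by (simp add: faithful_normal_state_def)
  then have "lact L2 d \<alpha> = \<zero>\<^bsub>L2\<^esub>" using assms(1) by (simp add: L2.lact_op_scale L2.G.smult_l_null[simplified])
  then have "\<alpha> = q \<alpha>" using d_apply[OF assms(1)] assms(1) SL[OF q(1)[OF assms(1)]] by simp
  then have "\<alpha> \<in> S" using q(1)[OF assms(1)] by simp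
  then show ?thesis using SD assms(2) by blast
qed

text \<open>A nonzero difference d would be orthogonal to \<open>\<Omega> M\<close> and yet closer
  to some vector of it than its own norm, against Cauchy-Schwarz.\<close>

lemma Omega_total:
  assumes \<xi>: "\<xi> \<in> carrier L2" "\<eta> \<in> carrier L2"
    and eq: "\<And>x. x \<in> M \<Longrightarrow> ip L2 (ract L2 \<Omega> x) \<xi> = ip L2 (ract L2 \<Omega> x) \<eta>"
  shows "\<xi> = \<eta>"
proof (rule ccontr)
  assume "\<xi> \<noteq> \<eta>"
  define d where "d = \<xi> \<ominus>\<^bsub>L2\<^esub> \<eta>"
  have d: "d \<in> carrier L2" using \<xi> by (simp add: d_def)
  have "d \<noteq> \<zero>\<^bsub>L2\<^esub>" using \<open>\<xi> \<noteq> \<eta>\<close> \<xi> by (simp add: d_def)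
  then have pos: "vnorm L2 d > 0" using L2.G.vnorm_eq_0[OF d] L2.G.vnorm_nonneg[OF d] by linarith
  obtain x where x: "x \<in> M" "vnorm L2 (ract L2 \<Omega> x \<ominus>\<^bsub>L2\<^esub> d) < vnorm L2 d"
    using Omega_dense[OF d pos] by blast
  have "ip L2 (ract L2 \<Omega> x) d = 0" using eq[OF x(1)] x \<xi> by (simp add: d_def)
  then have "(vnorm L2 d)\<^sup>2 = Re (- ip L2 (ract L2 \<Omega> x \<ominus>\<^bsub>L2\<^esub> d) d)" using d x by (simp add: L2.G.vnorm_sq)
  also have "\<dots> \<le> cmod (ip L2 (ract L2 \<Omega> x \<ominus>\<^bsub>L2\<^esub> d) d)"
    using complex_Re_le_cmod[of "- ip L2 (ract L2 \<Omega> x \<ominus>\<^bsub>L2\<^esub> d) d"] by simp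
  also have "\<dots> \<le> vnorm L2 (ract L2 \<Omega> x \<ominus>\<^bsub>L2\<^esub> d) * vnorm L2 d" using d x by (intro L2.G.Cauchy_Schwarz) auto
  also have "\<dots> < vnorm L2 d * vnorm L2 d" using x(2) pos by (rule mult_strict_right_mono)
  finally show False by (simp add: power2_eq_square)
qed

text \<open>Passing to adjoints turns the equality of two operators into equalities of vectors in
  \<open>L2\<close>, where \<open>Omega_total\<close> decides.\<close>

lemma bounded_ops_eq_on_Omega:
  assumes G: "hilbert_space G" and f: "f \<in> bounded_ops L2 G" and g: "g \<in> bounded_ops L2 G"
    and eq: "\<And>x. x \<in> M \<Longrightarrow> f (ract L2 \<Omega> x) = g (ract L2 \<Omega> x)"
  shows "f = g"
proof -
  interpret LG: hilbert_pair L2 G using G by (simp add: hilbert_pair_def L2.G.hilbert_space_axioms)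
  show ?thesis
  proof (rule LG.bounded_ops_eqI[OF f g])
    fix \<alpha> \<beta> assume \<alpha>: "\<alpha> \<in> carrier L2" and \<beta>: "\<beta> \<in> carrier G"
    have "adjoint L2 G f \<beta> = adjoint L2 G g \<beta>"
      using \<beta> eq by (intro Omega_total) (auto simp: LG.adjoint_closed f g LG.adjoint_right)
    then show "ip G \<beta> (f \<alpha>) = ip G \<beta> (g \<alpha>)"
      using LG.adjoint_left[OF f \<beta> \<alpha>] LG.adjoint_left[OF g \<beta> \<alpha>] by simp
  qed
qed

lemma M_eqI_Omega:
  assumes m: "m \<in> M" "m' \<in> M"
    and eq: "\<And>x y. \<lbrakk>x \<in> M; y \<in> M\<rbrakk> \<Longrightarrow>
      ip L2 (ract L2 \<Omega> x) (lact L2 m (ract L2 \<Omega> y)) = ip L2 (ract L2 \<Omega> x) (lact L2 m' (ract L2 \<Omega> y))"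
  shows "m = m'"
proof (rule inj_onD[OF lop_inj _ m])
  show "lop L2 m = lop L2 m'"
  proof (rule bounded_ops_eq_on_Omega[OF L2.G.hilbert_space_axioms L2.lop_bounded[OF m(1)] L2.lop_bounded[OF m(2)]])
    fix y assume y: "y \<in> M"
    show "lop L2 m (ract L2 \<Omega> y) = lop L2 m' (ract L2 \<Omega> y)"
      using m y eq by (intro Omega_total) auto
  qed
qed

end

section \<open>Bounded vectors, their operators and their Gram matrices\<close>

context standard_space
begin

lemma bounded_vectorsD:
  assumes "\<xi> \<in> bounded_vectors G"
  shows "\<xi> \<in> carrier G" "\<exists>c>0. \<forall>x\<in>M. vnorm G (ract G \<xi> x) \<le> c * vnorm L2 (ract L2 \<Omega> x)"
  using assms by (auto simp: bounded_vectors_def)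

context
  fixes G :: "('k \<Rightarrow> 'k, 'a, 'z) rmod_scheme"
  assumes G: "right_W_module K M G"
begin

interpretation G: right_module K M G by unfold_locales (rule G)
interpretation LG: hilbert_pair L2 G ..

text \<open>The bound of a bounded vector makes the assignment of \<xi> x to \<open>\<Omega>\<close>
  x a bounded linear relation, and \<open>Omega_dense\<close> supplies its dense domain; density
  also gives uniqueness.\<close>

lemma pi_phi_ex1:
  assumes \<xi>: "\<xi> \<in> bounded_vectors G"
  shows "\<exists>!f. f \<in> bounded_ops L2 G \<and> (\<forall>x\<in>M. f (ract L2 \<Omega> x) = ract G \<xi> x)"
proof -
  have \<xi>G: "\<xi> \<in> carrier G" using bounded_vectorsD(1)[OF \<xi>] .
  obtain c where c: "c > 0" "\<And>x. x \<in> M \<Longrightarrow> vnorm G (ract G \<xi> x) \<le> c * vnorm L2 (ract L2 \<Omega> x)"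
    using bounded_vectorsD(2)[OF \<xi>] by blast
  define \<Gamma> where "\<Gamma> = (\<lambda>x. (ract L2 \<Omega> x, ract G \<xi> x)) ` M"
  have "\<exists>f\<in>bounded_ops L2 G. \<forall>(u, v)\<in>\<Gamma>. f u = v"
  proof (rule LG.bounded_extension[where c = c])
    fix u v u' v' assume "(u, v) \<in> \<Gamma>" "(u', v') \<in> \<Gamma>"
    then obtain x y where x: "x \<in> M" "u = ract L2 \<Omega> x" "v = ract G \<xi> x"
      and y: "y \<in> M" "u' = ract L2 \<Omega> y" "v' = ract G \<xi> y" by (auto simp: \<Gamma>_def)
    then show "(u \<oplus>\<^bsub>L2\<^esub> u', v \<oplus>\<^bsub>G\<^esub> v') \<in> \<Gamma>"
      unfolding \<Gamma>_def using \<xi>G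
      by (intro image_eqI[of _ _ "op_add K x y"]) (auto simp: L2.ract_op_add G.ract_op_add)
  next
    fix u v a assume "(u, v) \<in> \<Gamma>"
    then obtain x where x: "x \<in> M" "u = ract L2 \<Omega> x" "v = ract G \<xi> x" by (auto simp: \<Gamma>_def)
    then show "(a \<odot>\<^bsub>L2\<^esub> u, a \<odot>\<^bsub>G\<^esub> v) \<in> \<Gamma>"
      unfolding \<Gamma>_def using \<xi>G
      by (intro image_eqI[of _ _ "op_scale K a x"]) (auto simp: L2.ract_op_scale G.ract_op_scale)
  next
    fix \<alpha> and e :: real assume "\<alpha> \<in> carrier L2" "e > 0"
    then show "\<exists>u v. (u, v) \<in> \<Gamma> \<and> vnorm L2 (u \<ominus>\<^bsub>L2\<^esub> \<alpha>) < e"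
      unfolding \<Gamma>_def using Omega_dense by blast
  qed (use c \<xi>G in \<open>auto simp: \<Gamma>_def\<close>)
  then obtain f where f: "f \<in> bounded_ops L2 G" "\<And>x. x \<in> M \<Longrightarrow> f (ract L2 \<Omega> x) = ract G \<xi> x"
    by (auto simp: \<Gamma>_def)
  moreover have "g = f" if "g \<in> bounded_ops L2 G" "\<forall>x\<in>M. g (ract L2 \<Omega> x) = ract G \<xi> x" for g
    using that f by (intro bounded_ops_eq_on_Omega[OF G.G.hilbert_space_axioms]) auto
  ultimately show ?thesis by blast
qed

context
  fixes \<xi> assumes \<xi>: "\<xi> \<in> bounded_vectors G"
begin

lemma pi_phi_bounded: "pi_phi G \<xi> \<in> bounded_ops L2 G"
  and pi_phi_Omega: "x \<in> M \<Longrightarrow> pi_phi G \<xi> (ract L2 \<Omega> x) = ract G \<xi> x"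
  using theI'[OF pi_phi_ex1[OF \<xi>]] by (auto simp: pi_phi_def)

lemma pi_phi_closed: "\<alpha> \<in> carrier L2 \<Longrightarrow> pi_phi G \<xi> \<alpha> \<in> carrier G"
  by (rule bounded_ops_closed[OF pi_phi_bounded])

lemma pi_phi_self: "pi_phi G \<xi> \<Omega> = \<xi>"
  using pi_phi_Omega[OF M_one] bounded_vectorsD(1)[OF \<xi>] by simp

lemma pi_phi_eqI:
  assumes "f \<in> bounded_ops L2 G" "\<And>x. x \<in> M \<Longrightarrow> f (ract L2 \<Omega> x) = ract G \<xi> x"
  shows "pi_phi G \<xi> = f"
  using assms by (intro bounded_ops_eq_on_Omega[OF G.G.hilbert_space_axioms pi_phi_bounded])
    (auto simp: pi_phi_Omega)

lemma pi_phi_ract: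
  assumes x: "x \<in> M" and \<alpha>: "\<alpha> \<in> carrier L2"
  shows "pi_phi G \<xi> (ract L2 \<alpha> x) = ract G (pi_phi G \<xi> \<alpha>) x"
proof -
  note hs = L2.G.hilbert_space_axioms G.G.hilbert_space_axioms
  have "compose (carrier L2) (pi_phi G \<xi>) (rop L2 x) = compose (carrier L2) (rop G x) (pi_phi G \<xi>)"
  proof (rule bounded_ops_eq_on_Omega[OF hs(2)])
    show "compose (carrier L2) (pi_phi G \<xi>) (rop L2 x) \<in> bounded_ops L2 G"
      by (rule compose_bounded_ops[OF hs(1) hs(1) hs(2) L2.rop_bounded[OF x] pi_phi_bounded])
    show "compose (carrier L2) (rop G x) (pi_phi G \<xi>) \<in> bounded_ops L2 G"
      by (rule compose_bounded_ops[OF hs(1) hs(2) hs(2) pi_phi_bounded G.rop_bounded[OF x]])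
    fix y assume y: "y \<in> M"
    have "ract L2 (ract L2 \<Omega> y) x = ract L2 \<Omega> (op_mult K y x)" "ract G (ract G \<xi> y) x = ract G \<xi> (op_mult K y x)"
      using x y bounded_vectorsD(1)[OF \<xi>] by (simp_all add: L2.ract_op_mult G.ract_op_mult)
    then show "compose (carrier L2) (pi_phi G \<xi>) (rop L2 x) (ract L2 \<Omega> y) =
        compose (carrier L2) (rop G x) (pi_phi G \<xi>) (ract L2 \<Omega> y)"
      using x y bounded_vectorsD(1)[OF \<xi>] by (simp add: compose_eq pi_phi_Omega)
  qed
  then have "compose (carrier L2) (pi_phi G \<xi>) (rop L2 x) \<alpha> = compose (carrier L2) (rop G x) (pi_phi G \<xi>) \<alpha>"
    by simp
  then show ?thesis using \<alpha> by (simp add: compose_eq pi_phi_closed)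
qed

end

context
  fixes \<xi> \<eta> assumes \<xi>: "\<xi> \<in> bounded_vectors G" and \<eta>: "\<eta> \<in> bounded_vectors G"
begin

text \<open>Both factors are right linear, so the product is a right linear operator on
  \<open>L2\<close> and comes from \<open>M\<close>; injectivity of the left action makes the
  description unique.\<close>

lemma pi_star_pi_spec:
  "pi_star_pi G \<xi> \<eta> \<in> M \<and>
    lop L2 (pi_star_pi G \<xi> \<eta>) = compose (carrier L2) (adjoint L2 G (pi_phi G \<xi>)) (pi_phi G \<eta>)"
proof -
  interpret GL: hilbert_pair G L2 ..
  let ?f = "compose (carrier L2) (adjoint L2 G (pi_phi G \<xi>)) (pi_phi G \<eta>)"
  have f: "?f \<in> bounded_ops L2 L2"
    by (rule compose_bounded_ops[OF _ _ _ pi_phi_bounded[OF \<eta>] LG.adjoint_bounded_ops[OF pi_phi_bounded[OF \<xi>]]])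
      unfold_locales
  note [simp] = LG.adjoint_closed[OF pi_phi_bounded[OF \<xi>]] LG.adjoint_right[OF pi_phi_bounded[OF \<xi>]]
    pi_phi_closed[OF \<xi>] pi_phi_closed[OF \<eta>]
  have "?f (ract L2 \<alpha> x) = ract L2 (?f \<alpha>) x" if x: "x \<in> M" and \<alpha>: "\<alpha> \<in> carrier L2" for x \<alpha>
  proof (rule L2.G.vec_eqI)
    fix \<beta> assume \<beta>: "\<beta> \<in> carrier L2"
    have "ip L2 \<beta> (?f (ract L2 \<alpha> x)) = ip G (pi_phi G \<xi> \<beta>) (ract G (pi_phi G \<eta> \<alpha>) x)"
      using x \<alpha> \<beta> by (simp add: compose_eq pi_phi_ract[OF \<eta>])
    also have "\<dots> = ip G (pi_phi G \<xi> (ract L2 \<beta> (adjoint K K x))) (pi_phi G \<eta> \<alpha>)"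
      using x \<alpha> \<beta> by (simp add: pi_phi_ract[OF \<xi>] G.ract_adjoint)
    also have "\<dots> = ip L2 (ract L2 \<beta> (adjoint K K x)) (?f \<alpha>)"
      using x \<alpha> \<beta> by (simp add: compose_eq)
    also have "\<dots> = ip L2 \<beta> (ract L2 (?f \<alpha>) x)"
      using x \<alpha> \<beta> bounded_ops_closed[OF f \<alpha>] by (subst L2.ract_adjoint) auto
    finally show "ip L2 \<beta> (?f (ract L2 \<alpha> x)) = ip L2 \<beta> (ract L2 (?f \<alpha>) x)" .
  qed (use x \<alpha> in \<open>simp_all add: compose_eq\<close>)
  then obtain m where m: "m \<in> M" "lop L2 m = ?f" using right_linear_op_in_M[OF f] by blast
  show ?thesis
    unfolding pi_star_pi_def
  proof (rule theI[of "\<lambda>m. m \<in> M \<and> lop L2 m = ?f" m])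
    show "m' = m" if "m' \<in> M \<and> lop L2 m' = ?f" for m'
      using that m inj_onD[OF lop_inj, of m' m] by simp
  qed (use m in simp)
qed

lemma pi_star_pi_closed: "pi_star_pi G \<xi> \<eta> \<in> M"
  using pi_star_pi_spec by simp

lemma ip_pi_star_pi:
  assumes "\<alpha> \<in> carrier L2" "\<beta> \<in> carrier L2"
  shows "ip L2 \<alpha> (lact L2 (pi_star_pi G \<xi> \<eta>) \<beta>) = ip G (pi_phi G \<xi> \<alpha>) (pi_phi G \<eta> \<beta>)"
proof -
  have "lact L2 (pi_star_pi G \<xi> \<eta>) \<beta> = compose (carrier L2) (adjoint L2 G (pi_phi G \<xi>)) (pi_phi G \<eta>) \<beta>"
    using pi_star_pi_spec L2.lop_apply[OF assms(2), of "pi_star_pi G \<xi> \<eta>"] by simp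
  then show ?thesis
    using assms LG.adjoint_right[OF pi_phi_bounded[OF \<xi>] pi_phi_closed[OF \<eta> assms(2)] assms(1)]
    by (simp add: compose_eq)
qed

end

text \<open>The Gram matrix in question: on \<open>L2\<close> its form is a squared norm in
  \<open>G\<close>. Its positivity in other representations is deduced from this one.\<close>

lemma pi_star_pi_positive:
  fixes n :: nat
  assumes \<xi>: "\<And>i. i < n \<Longrightarrow> \<xi> i \<in> bounded_vectors G" and \<alpha>: "\<And>i. i < n \<Longrightarrow> \<alpha> i \<in> carrier L2"
  shows "(\<Sum>i<n. \<Sum>j<n. ip L2 (\<alpha> i) (lact L2 (pi_star_pi G (\<xi> i) (\<xi> j)) (\<alpha> j))) =
    of_real ((vnorm G (finsum G (\<lambda>i. pi_phi G (\<xi> i) (\<alpha> i)) {..<n}))\<^sup>2)"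
proof -
  let ?u = "\<lambda>i. pi_phi G (\<xi> i) (\<alpha> i)"
  have u: "?u i \<in> carrier G" if "i < n" for i using pi_phi_closed[OF \<xi>[OF that] \<alpha>[OF that]] .
  have w: "finsum G ?u {..<n} \<in> carrier G" using u by (intro G.G.finsum_mem) auto
  have "(\<Sum>i<n. \<Sum>j<n. ip L2 (\<alpha> i) (lact L2 (pi_star_pi G (\<xi> i) (\<xi> j)) (\<alpha> j))) = (\<Sum>i<n. \<Sum>j<n. ip G (?u i) (?u j))"
    using \<xi> \<alpha> by (intro sum.cong refl ip_pi_star_pi) auto
  also have "\<dots> = ip G (finsum G ?u {..<n}) (finsum G ?u {..<n})"
    using u by (intro G.G.ip_finsum_finsum) auto
  finally show ?thesis using w by (simp add: G.G.ip_self)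
qed

end

text \<open>Obtained by applying \<open>positive_normal\<close> on \<open>L2\<close> to vector functionals of \<open>\<sigma>\<close>; the case \<open>B = 0\<close> is the
  complete positivity of \<open>\<sigma>\<close>.\<close>

lemma rep_form_bound:
  fixes n :: nat
  assumes G: "hilbert_space G" and \<sigma>: "normal_rep K M G \<sigma>"
    and B: "B \<in> bounded_ops G G" and comm: "\<And>x \<xi>. \<lbrakk>x \<in> M; \<xi> \<in> carrier G\<rbrakk> \<Longrightarrow> B (\<sigma> x \<xi>) = \<sigma> x (B \<xi>)"
    and c: "\<And>\<xi>. \<xi> \<in> carrier G \<Longrightarrow> vnorm G (B \<xi>) \<le> c * vnorm G \<xi>"
    and m: "\<And>i j. \<lbrakk>i < n; j < n\<rbrakk> \<Longrightarrow> m i j \<in> M"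
    and pos: "\<And>\<alpha>. (\<And>i. i < n \<Longrightarrow> \<alpha> i \<in> carrier L2) \<Longrightarrow>
      (\<Sum>i<n. \<Sum>j<n. ip L2 (\<alpha> i) (lact L2 (m i j) (\<alpha> j))) \<in> \<real>\<^sub>\<ge>\<^sub>0"
    and \<eta>: "\<And>i. i < n \<Longrightarrow> \<eta> i \<in> carrier G"
  shows "of_real (c\<^sup>2) * (\<Sum>i<n. \<Sum>j<n. ip G (\<eta> i) (\<sigma> (m i j) (\<eta> j)))
    - (\<Sum>i<n. \<Sum>j<n. ip G (B (\<eta> i)) (\<sigma> (m i j) (B (\<eta> j)))) \<in> \<real>\<^sub>\<ge>\<^sub>0"
proof -
  interpret G: hilbert_space G by (rule G)
  interpret GG: hilbert_pair G G ..
  have star: "normal_star_map K M G \<sigma>" using \<sigma> by (simp add: normal_rep_def)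
  have \<sigma>b: "\<sigma> x \<in> bounded_ops G G" if "x \<in> M" for x using star that by (auto simp: normal_star_map_def)
  note [simp] = bounded_ops_closed[OF \<sigma>b] bounded_ops_closed[OF B]
  define linv where "linv = inv_into M (lop L2)"
  have linv: "linv (lop L2 x) = x" if "x \<in> M" for x using lop_inj that by (simp add: linv_def)
  \<comment> \<open>The functionals live on the left copy of \<open>M\<close> in \<open>L2\<close>.
    They are normal because both \<sigma> and the inverse of the left action are. The factor
    \<open>c\<^sup>2\<close> may sit in the left, conjugate-linear slot because it is real.\<close>
  define f where "f i j y = ip G (of_real (c\<^sup>2) \<odot>\<^bsub>G\<^esub> \<eta> i) (\<sigma> (linv y) (\<eta> j)) - ip G (B (\<eta> i)) (\<sigma> (linv y) (B (\<eta> j)))" for i j y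
  have f_lop: "f i j (lop L2 x) = of_real (c\<^sup>2) * ip G (\<eta> i) (\<sigma> x (\<eta> j)) - ip G (B (\<eta> i)) (\<sigma> x (B (\<eta> j)))"
    if "i < n" "j < n" "x \<in> M" for i j x
    using that \<eta> by (simp add: f_def linv G.ip_smult_left)
  have "(\<Sum>i<n. \<Sum>j<n. f i j (lop L2 (m i j))) \<in> \<real>\<^sub>\<ge>\<^sub>0"
  proof (rule N.positive_normal[where f = f and a = "\<lambda>i j. lop L2 (m i j)"])
    show "lop L2 (m i j) \<in> lop L2 ` M" if "i < n" "j < n" for i j using m that by simp
  next
    fix \<alpha> assume \<alpha>: "\<And>i. i < n \<Longrightarrow> \<alpha> i \<in> carrier L2"
    have "(\<Sum>i<n. \<Sum>j<n. ip L2 (\<alpha> i) (lop L2 (m i j) (\<alpha> j))) = (\<Sum>i<n. \<Sum>j<n. ip L2 (\<alpha> i) (lact L2 (m i j) (\<alpha> j)))"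
      using \<alpha> by (intro sum.cong refl) auto
    then show "(\<Sum>i<n. \<Sum>j<n. ip L2 (\<alpha> i) (lop L2 (m i j) (\<alpha> j))) \<in> \<real>\<^sub>\<ge>\<^sub>0" using pos[OF \<alpha>] by simp
  next
    fix i j assume ij: "i < n" "j < n"
    have "normal_functional G (bounded_ops G G)
        (\<lambda>y. ip G (of_real (c\<^sup>2) \<odot>\<^bsub>G\<^esub> \<eta> i) (y (\<eta> j)) - ip G (B (\<eta> i)) (y (B (\<eta> j))))"
      using ij \<eta> by (intro G.normal_functional_vector2) auto
    moreover have "normal_map K M G (bounded_ops G G) \<sigma>" using star by (simp add: normal_star_map_def)
    ultimately have "normal_functional K M
        (\<lambda>x. ip G (of_real (c\<^sup>2) \<odot>\<^bsub>G\<^esub> \<eta> i) (\<sigma> x (\<eta> j)) - ip G (B (\<eta> i)) (\<sigma> x (B (\<eta> j))))"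
      unfolding normal_map_def by blast
    moreover have "normal_map L2 (lop L2 ` M) K M linv"
      using L2_left by (simp add: vn_isomorphism_def linv_def)
    ultimately show "normal_functional L2 (lop L2 ` M) (f i j)"
      unfolding normal_map_def f_def by blast
  next
    fix d assume d: "\<And>i. i < n \<Longrightarrow> d i \<in> lop L2 ` M"
    define z where "z i = linv (d i)" for i
    have z: "z i \<in> M" "d i = lop L2 (z i)" if "i < n" for i
      using d[OF that] linv by (auto simp: z_def)
    let ?u = "\<lambda>i. \<sigma> (z i) (\<eta> i)"
    have u: "?u i \<in> carrier G" if "i < n" for i using z \<eta> that by simp
    define w where "w = finsum G ?u {..<n}"
    have w: "w \<in> carrier G" unfolding w_def using u by (intro G.finsum_mem) auto
    have term_eq: "f i j (op_mult L2 (adjoint L2 L2 (d i)) (d j)) = of_real (c\<^sup>2) * ip G (?u i) (?u j) - ip G (B (?u i)) (B (?u j))"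
      if ij: "i < n" "j < n" for i j
    proof -
      let ?x = "op_mult K (adjoint K K (z i)) (z j)"
      note zi = z(1)[OF ij(1)] and zj = z(1)[OF ij(2)]
      have "op_mult L2 (adjoint L2 L2 (d i)) (d j) = lop L2 ?x"
        using L2.lop_rep zi zj z(2)[OF ij(1)] z(2)[OF ij(2)] by (simp add: normal_rep_def normal_star_map_def)
      moreover have x: "?x \<in> M" using zi zj by simp
      have \<sigma>x: "\<sigma> ?x = op_mult G (adjoint G G (\<sigma> (z i))) (\<sigma> (z j))"
        using \<sigma> star zi zj by (simp add: normal_rep_def normal_star_map_def)
      have ip: "ip G \<zeta> (\<sigma> ?x \<zeta>') = ip G (\<sigma> (z i) \<zeta>) (\<sigma> (z j) \<zeta>')" if "\<zeta> \<in> carrier G" "\<zeta>' \<in> carrier G" for \<zeta> \<zeta>'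
        using that zi zj by (simp add: \<sigma>x compose_eq GG.adjoint_right[OF \<sigma>b])
      ultimately show ?thesis
        using ij \<eta> zi zj by (simp add: f_lop[OF ij x] ip comm)
    qed
    have 1: "(\<Sum>i<n. \<Sum>j<n. ip G (?u i) (?u j)) = ip G w w"
      unfolding w_def using u by (intro G.ip_finsum_finsum) auto
    have Bw: "B w = finsum G (\<lambda>i. B (?u i)) {..<n}"
      unfolding w_def using u by (intro GG.bounded_ops_finsum[OF B]) auto
    have 2: "(\<Sum>i<n. \<Sum>j<n. ip G (B (?u i)) (B (?u j))) = ip G (B w) (B w)"
      unfolding Bw using u by (intro G.ip_finsum_finsum) auto
    have "(\<Sum>i<n. \<Sum>j<n. f i j (op_mult L2 (adjoint L2 L2 (d i)) (d j)))
        = (\<Sum>i<n. \<Sum>j<n. of_real (c\<^sup>2) * ip G (?u i) (?u j) - ip G (B (?u i)) (B (?u j)))"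
      by (intro sum.cong refl term_eq) auto
    also have "\<dots> = of_real (c\<^sup>2) * ip G w w - ip G (B w) (B w)"
      unfolding 1[symmetric] 2[symmetric] by (simp add: sum_subtractf sum_distrib_left)
    also have "\<dots> = of_real ((c * vnorm G w)\<^sup>2 - (vnorm G (B w))\<^sup>2)"
      using w by (simp add: G.ip_self power_mult_distrib)
    also have "\<dots> \<in> \<real>\<^sub>\<ge>\<^sub>0" using w c[OF w] by (intro of_real_diff_squares_nonneg) auto
    finally show "(\<Sum>i<n. \<Sum>j<n. f i j (op_mult L2 (adjoint L2 L2 (d i)) (d j))) \<in> \<real>\<^sub>\<ge>\<^sub>0" .
  qed
  also have "(\<Sum>i<n. \<Sum>j<n. f i j (lop L2 (m i j)))
      = (\<Sum>i<n. \<Sum>j<n. of_real (c\<^sup>2) * ip G (\<eta> i) (\<sigma> (m i j) (\<eta> j)) - ip G (B (\<eta> i)) (\<sigma> (m i j) (B (\<eta> j))))"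
    using m by (intro sum.cong refl f_lop) auto
  finally show ?thesis by (simp add: sum_subtractf sum_distrib_left)
qed

lemma rep_positive:
  fixes n :: nat
  assumes G: "hilbert_space G" and \<sigma>: "normal_rep K M G \<sigma>"
    and m: "\<And>i j. \<lbrakk>i < n; j < n\<rbrakk> \<Longrightarrow> m i j \<in> M"
    and pos: "\<And>\<alpha>. (\<And>i. i < n \<Longrightarrow> \<alpha> i \<in> carrier L2) \<Longrightarrow>
      (\<Sum>i<n. \<Sum>j<n. ip L2 (\<alpha> i) (lact L2 (m i j) (\<alpha> j))) \<in> \<real>\<^sub>\<ge>\<^sub>0"
    and \<eta>: "\<And>i. i < n \<Longrightarrow> \<eta> i \<in> carrier G"
  shows "(\<Sum>i<n. \<Sum>j<n. ip G (\<eta> i) (\<sigma> (m i j) (\<eta> j))) \<in> \<real>\<^sub>\<ge>\<^sub>0"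
proof -
  interpret G: hilbert_space G by (rule G)
  interpret GG: hilbert_pair G G ..
  have \<sigma>b: "\<sigma> x \<in> bounded_ops G G" if "x \<in> M" for x
    using \<sigma> that by (auto simp: normal_rep_def normal_star_map_def)
  have z: "\<sigma> x \<zero>\<^bsub>G\<^esub> = \<zero>\<^bsub>G\<^esub>" if "x \<in> M" for x
    using bounded_ops_smult[OF \<sigma>b[OF that], of "\<zero>\<^bsub>G\<^esub>" 0] bounded_ops_closed[OF \<sigma>b[OF that], of "\<zero>\<^bsub>G\<^esub>"]
    by (simp add: G.smult_l_null[simplified])
  let ?B = "\<lambda>\<xi>\<in>carrier G. \<zero>\<^bsub>G\<^esub>"
  have "of_real (1\<^sup>2) * (\<Sum>i<n. \<Sum>j<n. ip G (\<eta> i) (\<sigma> (m i j) (\<eta> j)))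
    - (\<Sum>i<n. \<Sum>j<n. ip G (?B (\<eta> i)) (\<sigma> (m i j) (?B (\<eta> j)))) \<in> \<real>\<^sub>\<ge>\<^sub>0"
  proof (rule rep_form_bound[OF G \<sigma> _ _ _ m pos \<eta>])
    show "?B \<in> bounded_ops G G" by (rule GG.bounded_opsI[where c = 1]) (auto simp: G.smult_r_null[simplified])
    show "?B (\<sigma> x \<xi>) = \<sigma> x (?B \<xi>)" if "x \<in> M" "\<xi> \<in> carrier G" for x \<xi>
      using that bounded_ops_closed[OF \<sigma>b] by (simp add: z)
  qed auto
  then show ?thesis using \<eta> m by (simp add: z)
qed

lemma rep_contraction:
  assumes G: "hilbert_space G" and \<sigma>: "normal_rep K M G \<sigma>" and x: "x \<in> M" and c: "c \<ge> 0"
    and bound: "\<And>\<alpha>. \<alpha> \<in> carrier L2 \<Longrightarrow> vnorm L2 (lact L2 x \<alpha>) \<le> c * vnorm L2 \<alpha>" and \<eta>: "\<eta> \<in> carrier G"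
  shows "vnorm G (\<sigma> x \<eta>) \<le> c * vnorm G \<eta>"
proof -
  interpret G: hilbert_space G by (rule G)
  interpret GG: hilbert_pair G G ..
  have star: "normal_star_map K M G \<sigma>" using \<sigma> by (simp add: normal_rep_def)
  have \<sigma>b: "\<sigma> x \<in> bounded_ops G G" using star x by (auto simp: normal_star_map_def)
  define d where "d = op_add K (op_scale K (of_real (c\<^sup>2)) (op_one K)) (op_scale K (-1) (op_mult K (adjoint K K x) x))"
  have "(\<Sum>i<1::nat. \<Sum>j<1::nat. ip G \<eta> (\<sigma> d \<eta>)) \<in> \<real>\<^sub>\<ge>\<^sub>0"
  proof (rule rep_positive[OF G \<sigma>, where n = 1 and m = "\<lambda>_ _. d" and \<eta> = "\<lambda>_. \<eta>"])
    show "d \<in> M" unfolding d_def using x by simp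
    fix \<alpha> :: "nat \<Rightarrow> 'h" assume "\<And>i. i < 1 \<Longrightarrow> \<alpha> i \<in> carrier L2"
    then have \<alpha>: "\<alpha> 0 \<in> carrier L2" by simp
    have "ip L2 (\<alpha> 0) (lact L2 d (\<alpha> 0)) = of_real (c\<^sup>2) * ip L2 (\<alpha> 0) (\<alpha> 0) - ip L2 (\<alpha> 0) (lact L2 (adjoint K K x) (lact L2 x (\<alpha> 0)))"
      unfolding d_def using x \<alpha> by (simp add: L2.lact_op_add L2.lact_op_scale L2.lact_op_mult L2.G.ip_simps)
    also have "\<dots> = of_real ((c * vnorm L2 (\<alpha> 0))\<^sup>2 - (vnorm L2 (lact L2 x (\<alpha> 0)))\<^sup>2)"
      using x \<alpha> L2.lact_adjoint[OF x \<alpha>, of "lact L2 x (\<alpha> 0)"] by (simp add: L2.G.ip_self power_mult_distrib)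
    also have "\<dots> \<in> \<real>\<^sub>\<ge>\<^sub>0" using bound[OF \<alpha>] x \<alpha> by (intro of_real_diff_squares_nonneg) auto
    finally show "(\<Sum>i<1::nat. \<Sum>j<1::nat. ip L2 (\<alpha> i) (lact L2 d (\<alpha> j))) \<in> \<real>\<^sub>\<ge>\<^sub>0" by simp
  qed (rule \<eta>)
  moreover have "\<sigma> d \<eta> = of_real (c\<^sup>2) \<odot>\<^bsub>G\<^esub> \<eta> \<oplus>\<^bsub>G\<^esub> (-1) \<odot>\<^bsub>G\<^esub> adjoint G G (\<sigma> x) (\<sigma> x \<eta>)"
    using \<sigma> star x \<eta> unfolding d_def
    by (simp add: normal_rep_def normal_star_map_def op_add_def[of G] op_scale_def[of G] op_one_def[of G] compose_eq)
  then have "ip G \<eta> (\<sigma> d \<eta>) = of_real ((c * vnorm G \<eta>)\<^sup>2 - (vnorm G (\<sigma> x \<eta>))\<^sup>2)"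
    using \<eta> GG.adjoint_closed[OF \<sigma>b] GG.adjoint_right[OF \<sigma>b] bounded_ops_closed[OF \<sigma>b \<eta>]
    by (simp add: G.ip_simps G.ip_self power_mult_distrib)
  ultimately have "of_real ((c * vnorm G \<eta>)\<^sup>2 - (vnorm G (\<sigma> x \<eta>))\<^sup>2) \<in> (\<real>\<^sub>\<ge>\<^sub>0 :: complex set)" by simp
  then have "(vnorm G (\<sigma> x \<eta>))\<^sup>2 \<le> (c * vnorm G \<eta>)\<^sup>2" by (subst (asm) nonneg_Reals_of_real_iff) simp
  then show ?thesis by (rule power2_le_imp_le) (use c \<eta> in simp)
qed

end

section \<open>The relative tensor product\<close>

context standard_space
begin

text \<open>Cancellation may remove keys from sums and differences. Summing over any finite superset
  of the keys puts several tensors over one index set; \<open>tensor_form_superset\<close> has the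
  same purpose.\<close>

lemma push_superset:
  assumes "finite A" "Poly_Mapping.keys p \<subseteq> A"
  shows "push f id p = (\<Sum>k\<in>A. Poly_Mapping.single (f k) (Poly_Mapping.lookup p k))"
  unfolding push_def id_apply using assms
  by (intro sum.mono_neutral_left) (auto simp: not_in_keys_iff_lookup_eq_zero)

lemma push_diff: "push f id (p - q) = push f id p - push f id q"
proof -
  let ?A = "Poly_Mapping.keys p \<union> Poly_Mapping.keys q"
  have k: "Poly_Mapping.keys (p - q) \<subseteq> ?A" by (rule keys_diff)
  show ?thesis
    by (simp add: push_superset[of ?A] k lookup_minus single_diff sum_subtractf)
qed

lemma push_single: "push f id (Poly_Mapping.single k c) = Poly_Mapping.single (f k) c"
  by (subst push_superset[of "{k}"]) auto

definition tensor_kernel ::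
    "('k \<Rightarrow> 'k, 'a, 'z) rmod_scheme \<Rightarrow> ('k \<Rightarrow> 'k, 'b, 'y) bimod_scheme \<Rightarrow> 'a \<times> 'b \<Rightarrow> 'a \<times> 'b \<Rightarrow> complex" where
  "tensor_kernel H G k l = ip G (snd k) (lact G (pi_star_pi H (fst k) (fst l)) (snd l))"

lemma tensor_form_superset:
  assumes "finite A" "Poly_Mapping.keys p \<subseteq> A" "finite B" "Poly_Mapping.keys q \<subseteq> B"
  shows "tensor_form H G p q = (\<Sum>k\<in>A. \<Sum>l\<in>B.
    cnj (Poly_Mapping.lookup p k) * Poly_Mapping.lookup q l * tensor_kernel H G k l)"
proof -
  have "tensor_form H G p q = (\<Sum>k\<in>Poly_Mapping.keys p. \<Sum>l\<in>Poly_Mapping.keys q.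
      cnj (Poly_Mapping.lookup p k) * Poly_Mapping.lookup q l * tensor_kernel H G k l)"
    by (simp add: tensor_form_def tensor_kernel_def split_beta)
  also have "\<dots> = (\<Sum>k\<in>Poly_Mapping.keys p. \<Sum>l\<in>B.
      cnj (Poly_Mapping.lookup p k) * Poly_Mapping.lookup q l * tensor_kernel H G k l)"
    using assms by (intro sum.cong refl sum.mono_neutral_left) (auto simp: not_in_keys_iff_lookup_eq_zero)
  also have "\<dots> = (\<Sum>k\<in>A. \<Sum>l\<in>B.
      cnj (Poly_Mapping.lookup p k) * Poly_Mapping.lookup q l * tensor_kernel H G k l)"
    using assms by (intro sum.mono_neutral_left) (auto simp: not_in_keys_iff_lookup_eq_zero)
  finally show ?thesis .
qed

lemma tensor_form_add_left: "tensor_form H G (p + p') q = tensor_form H G p q + tensor_form H G p' q"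
proof -
  let ?A = "Poly_Mapping.keys p \<union> Poly_Mapping.keys p'" and ?B = "Poly_Mapping.keys q"
  show ?thesis
    by (simp add: tensor_form_superset[where A = ?A and B = ?B] Poly_Mapping.keys_add lookup_add
        sum.distrib algebra_simps)
qed

lemma tensor_form_add_right: "tensor_form H G p (q + q') = tensor_form H G p q + tensor_form H G p q'"
proof -
  let ?A = "Poly_Mapping.keys p" and ?B = "Poly_Mapping.keys q \<union> Poly_Mapping.keys q'"
  show ?thesis
    by (simp add: tensor_form_superset[where A = ?A and B = ?B] Poly_Mapping.keys_add lookup_add
        sum.distrib algebra_simps)
qed

lemma tensor_form_zero_left [simp]: "tensor_form H G 0 q = 0"
  using tensor_form_add_left[of H G 0 0 q] by simp

lemma tensor_form_zero_right [simp]: "tensor_form H G p 0 = 0"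
  using tensor_form_add_right[of H G p 0 0] by simp

lemma tensor_form_diff_left: "tensor_form H G (p - p') q = tensor_form H G p q - tensor_form H G p' q"
  using tensor_form_add_left[of H G "p - p'" p' q] by simp

lemma tensor_form_diff_right: "tensor_form H G p (q - q') = tensor_form H G p q - tensor_form H G p q'"
  using tensor_form_add_right[of H G p "q - q'" q'] by simp

lemma tensor_form_single:
  "tensor_form H G (Poly_Mapping.single k c) (Poly_Mapping.single l d) = cnj c * d * tensor_kernel H G k l"
  by (subst tensor_form_superset[of "{k}" _ "{l}"]) auto

text \<open>\<open>f\<close> may identify keys, so the form of the image is expanded over the
  original keys by sesquilinearity instead of over the keys of the image.\<close>

lemma tensor_form_push:
  assumes "finite A" "Poly_Mapping.keys p \<subseteq> A"
  shows "tensor_form H G (push f id p) (push f id p) = (\<Sum>k\<in>A. \<Sum>l\<in>A.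
    cnj (Poly_Mapping.lookup p k) * Poly_Mapping.lookup p l * tensor_kernel H G (f k) (f l))"
proof -
  have left: "tensor_form H G (\<Sum>k\<in>B. g k) q = (\<Sum>k\<in>B. tensor_form H G (g k) q)" if "finite B" for B g q
    using that by (induction B) (auto simp: tensor_form_add_left)
  have right: "tensor_form H G q (\<Sum>k\<in>B. g k) = (\<Sum>k\<in>B. tensor_form H G q (g k))" if "finite B" for B g q
    using that by (induction B) (auto simp: tensor_form_add_right)
  show ?thesis
    unfolding push_superset[OF assms] using assms by (simp add: left right tensor_form_single) (rule sum.swap)
qed

context
  fixes H :: "('k \<Rightarrow> 'k, 'a, 'z) rmod_scheme" and G :: "('k \<Rightarrow> 'k, 'b, 'y) bimod_scheme"
  assumes H: "right_W_module K M H" and G: "W_bimodule K M G"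
begin

interpretation H: right_module K M H by unfold_locales (rule H)
interpretation G: bimodule K M G by unfold_locales (rule G)

text \<open>Positivity is available for matrices indexed by numbers below \<open>n\<close>. The keys
  are enumerated accordingly, and the coefficients are absorbed into the vectors of the second
  factor.\<close>

lemma kernel_form:
  fixes n :: nat
  assumes h: "bij_betw h {..<n} A" and A: "A \<subseteq> B \<times> carrier G"
    and m: "\<And>k l. \<lbrakk>k \<in> A; l \<in> A\<rbrakk> \<Longrightarrow> m k l \<in> M"
  shows "(\<Sum>k\<in>A. \<Sum>l\<in>A. cnj (c k) * c l * ip G (snd k) (lact G (m k l) (snd l)))
    = (\<Sum>i<n. \<Sum>j<n. ip G (c (h i) \<odot>\<^bsub>G\<^esub> snd (h i)) (lact G (m (h i) (h j)) (c (h j) \<odot>\<^bsub>G\<^esub> snd (h j))))"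
proof -
  have hA: "h i \<in> A" if "i < n" for i using h that by (auto simp: bij_betw_def)
  have hG: "snd (h i) \<in> carrier G" if "i < n" for i using hA[OF that] A by auto
  have "(\<Sum>k\<in>A. \<Sum>l\<in>A. cnj (c k) * c l * ip G (snd k) (lact G (m k l) (snd l)))
      = (\<Sum>i<n. \<Sum>l\<in>A. cnj (c (h i)) * c l * ip G (snd (h i)) (lact G (m (h i) l) (snd l)))"
    by (rule sum.reindex_bij_betw[OF h, symmetric])
  also have "\<dots> = (\<Sum>i<n. \<Sum>j<n. cnj (c (h i)) * c (h j) * ip G (snd (h i)) (lact G (m (h i) (h j)) (snd (h j))))"
    by (intro sum.cong refl sum.reindex_bij_betw[OF h, symmetric])
  also have "\<dots> = (\<Sum>i<n. \<Sum>j<n. ip G (c (h i) \<odot>\<^bsub>G\<^esub> snd (h i)) (lact G (m (h i) (h j)) (c (h j) \<odot>\<^bsub>G\<^esub> snd (h j))))"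
    using hG m hA by (intro sum.cong refl) (simp add: G.lact_smult G.G.ip_simps)
  finally show ?thesis .
qed

lemma kernel_positive:
  assumes A: "finite A" "A \<subseteq> B \<times> carrier G"
    and m: "\<And>k l. \<lbrakk>k \<in> A; l \<in> A\<rbrakk> \<Longrightarrow> m k l \<in> M"
    and pos: "\<And>(n::nat) h \<alpha>. \<lbrakk>\<And>i. i < n \<Longrightarrow> h i \<in> A; \<And>i. i < n \<Longrightarrow> \<alpha> i \<in> carrier L2\<rbrakk> \<Longrightarrow>
      (\<Sum>i<n. \<Sum>j<n. ip L2 (\<alpha> i) (lact L2 (m (h i) (h j)) (\<alpha> j))) \<in> \<real>\<^sub>\<ge>\<^sub>0"
  shows "(\<Sum>k\<in>A. \<Sum>l\<in>A. cnj (c k) * c l * ip G (snd k) (lact G (m k l) (snd l))) \<in> \<real>\<^sub>\<ge>\<^sub>0"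
proof -
  define n where "n = card A"
  obtain h where h: "bij_betw h {..<n} A"
    using ex_bij_betw_nat_finite[OF A(1)] by (auto simp: n_def atLeast0LessThan)
  have hA: "h i \<in> A" if "i < n" for i using h that by (auto simp: bij_betw_def)
  have hG: "c (h i) \<odot>\<^bsub>G\<^esub> snd (h i) \<in> carrier G" if "i < n" for i using hA[OF that] A by auto
  have "(\<Sum>i<n. \<Sum>j<n. ip G (c (h i) \<odot>\<^bsub>G\<^esub> snd (h i)) (lop G (m (h i) (h j)) (c (h j) \<odot>\<^bsub>G\<^esub> snd (h j)))) \<in> \<real>\<^sub>\<ge>\<^sub>0"
    by (rule rep_positive[OF G.G.hilbert_space_axioms G.lop_rep, where m = "\<lambda>i j. m (h i) (h j)"
          and \<eta> = "\<lambda>i. c (h i) \<odot>\<^bsub>G\<^esub> snd (h i)"]) (use m hA hG pos in auto)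
  also have "(\<Sum>i<n. \<Sum>j<n. ip G (c (h i) \<odot>\<^bsub>G\<^esub> snd (h i)) (lop G (m (h i) (h j)) (c (h j) \<odot>\<^bsub>G\<^esub> snd (h j))))
      = (\<Sum>i<n. \<Sum>j<n. ip G (c (h i) \<odot>\<^bsub>G\<^esub> snd (h i)) (lact G (m (h i) (h j)) (c (h j) \<odot>\<^bsub>G\<^esub> snd (h j))))"
    using hG by (intro sum.cong refl) simp
  also have "\<dots> = (\<Sum>k\<in>A. \<Sum>l\<in>A. cnj (c k) * c l * ip G (snd k) (lact G (m k l) (snd l)))"
    by (rule kernel_form[OF h A(2) m, symmetric])
  finally show ?thesis .
qed

text \<open>On \<open>L2\<close> the kernel is a Gram matrix; \<open>kernel_positive\<close> moves
  its positivity to \<open>G\<close>. Positivity of the semi-inner product and its Cauchy-Schwarz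
  inequality rest on this.\<close>

lemma tensor_kernel_positive:
  assumes A: "finite A" "A \<subseteq> bounded_vectors H \<times> carrier G"
  shows "(\<Sum>k\<in>A. \<Sum>l\<in>A. cnj (c k) * c l * tensor_kernel H G k l) \<in> \<real>\<^sub>\<ge>\<^sub>0"
  unfolding tensor_kernel_def
proof (rule kernel_positive[OF A])
  show "pi_star_pi H (fst k) (fst l) \<in> M" if "k \<in> A" "l \<in> A" for k l
    using that A by (intro pi_star_pi_closed[OF H]) auto
  fix n :: nat and h \<alpha> assume h: "\<And>i. i < n \<Longrightarrow> h i \<in> A" and \<alpha>: "\<And>i. i < n \<Longrightarrow> \<alpha> i \<in> carrier L2"
  have "fst (h i) \<in> bounded_vectors H" if "i < n" for i using h[OF that] A by auto
  then show "(\<Sum>i<n. \<Sum>j<n. ip L2 (\<alpha> i) (lact L2 (pi_star_pi H (fst (h i)) (fst (h j))) (\<alpha> j))) \<in> \<real>\<^sub>\<ge>\<^sub>0"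
    using pi_star_pi_positive[OF H, of n "\<lambda>i. fst (h i)" \<alpha>] \<alpha>
    by (simp only: nonneg_Reals_of_real_iff) simp
qed

section \<open>The tensor seminorm and classes of Cauchy sequences\<close>

lemma formal_tensors_diff: "\<lbrakk>p \<in> formal_tensors H G; q \<in> formal_tensors H G\<rbrakk> \<Longrightarrow> p - q \<in> formal_tensors H G"
  using keys_diff[of p q] by (auto simp: formal_tensors_def)

lemma formal_tensors_add: "\<lbrakk>p \<in> formal_tensors H G; q \<in> formal_tensors H G\<rbrakk> \<Longrightarrow> p + q \<in> formal_tensors H G"
  using Poly_Mapping.keys_add[of p q] by (auto simp: formal_tensors_def)

lemma tensor_form_self:
  assumes "p \<in> formal_tensors H G"
  shows "tensor_form H G p p \<in> \<real>\<^sub>\<ge>\<^sub>0"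
  using tensor_kernel_positive[of "Poly_Mapping.keys p" "Poly_Mapping.lookup p"] assms
  by (simp add: tensor_form_superset[where A = "Poly_Mapping.keys p" and B = "Poly_Mapping.keys p"] formal_tensors_def)

lemma tensor_seminorm_sq:
  "p \<in> formal_tensors H G \<Longrightarrow> (tensor_seminorm H G p)\<^sup>2 = Re (tensor_form H G p p)"
  using tensor_form_self[of p] by (simp add: tensor_seminorm_def complex_nonneg_Reals_iff)

lemma tensor_seminorm_nonneg: "p \<in> formal_tensors H G \<Longrightarrow> 0 \<le> tensor_seminorm H G p"
  using tensor_form_self[of p] by (simp add: tensor_seminorm_def complex_nonneg_Reals_iff)

lemma tensor_seminorm_zero [simp]: "tensor_seminorm H G 0 = 0"
  by (simp add: tensor_seminorm_def)

lemma tensor_form_Cauchy_Schwarz: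
  assumes p: "p \<in> formal_tensors H G" and q: "q \<in> formal_tensors H G"
  shows "cmod (tensor_form H G p q) \<le> tensor_seminorm H G p * tensor_seminorm H G q"
proof -
  let ?A = "Poly_Mapping.keys p \<union> Poly_Mapping.keys q"
  let ?p = "Poly_Mapping.lookup p" and ?q = "Poly_Mapping.lookup q"
  note sup = tensor_form_superset[where A = ?A and B = ?A]
  have "(cmod (tensor_form H G p q))\<^sup>2 \<le> Re (tensor_form H G p p) * Re (tensor_form H G q q)"
  proof (rule sesquilinear_Cauchy_Schwarz(2)[where b' = "tensor_form H G q p"])
    fix c
    have "(\<Sum>k\<in>?A. \<Sum>l\<in>?A. cnj (?p k + c * ?q k) * (?p l + c * ?q l) * tensor_kernel H G k l) \<in> \<real>\<^sub>\<ge>\<^sub>0"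
      using p q by (intro tensor_kernel_positive) (auto simp: formal_tensors_def)
    also have "(\<Sum>k\<in>?A. \<Sum>l\<in>?A. cnj (?p k + c * ?q k) * (?p l + c * ?q l) * tensor_kernel H G k l)
      = tensor_form H G p p + c * tensor_form H G p q + cnj c * tensor_form H G q p + cnj c * c * tensor_form H G q q"
      by (simp add: sup sum_distrib_left sum.distrib[symmetric] algebra_simps)
    finally show "tensor_form H G p p + c * tensor_form H G p q + cnj c * tensor_form H G q p
      + cnj c * c * tensor_form H G q q \<in> \<real>\<^sub>\<ge>\<^sub>0" .
  qed (rule tensor_form_self[OF q])
  then have "(cmod (tensor_form H G p q))\<^sup>2 \<le> (tensor_seminorm H G p * tensor_seminorm H G q)\<^sup>2"
    using p q by (simp add: power_mult_distrib tensor_seminorm_sq)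
  then show ?thesis by (rule power2_le_imp_le) (use p q tensor_seminorm_nonneg in simp)
qed

lemma tensor_seminorm_triangle:
  assumes p: "p \<in> formal_tensors H G" and q: "q \<in> formal_tensors H G"
  shows "tensor_seminorm H G (p + q) \<le> tensor_seminorm H G p + tensor_seminorm H G q"
proof -
  have "Re (tensor_form H G p q) \<le> tensor_seminorm H G p * tensor_seminorm H G q"
    "Re (tensor_form H G q p) \<le> tensor_seminorm H G p * tensor_seminorm H G q"
    using tensor_form_Cauchy_Schwarz[OF p q] tensor_form_Cauchy_Schwarz[OF q p]
      complex_Re_le_cmod[of "tensor_form H G p q"] complex_Re_le_cmod[of "tensor_form H G q p"]
    by (simp_all add: mult.commute)
  then have "(tensor_seminorm H G (p + q))\<^sup>2 \<le> (tensor_seminorm H G p + tensor_seminorm H G q)\<^sup>2"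
    using p q by (simp add: tensor_seminorm_sq formal_tensors_add tensor_form_add_left tensor_form_add_right power2_sum)
  then show ?thesis by (rule power2_le_imp_le) (use p q tensor_seminorm_nonneg in simp)
qed

lemma tensor_seminorm_diff_triangle:
  assumes "p \<in> formal_tensors H G" "q \<in> formal_tensors H G" "r \<in> formal_tensors H G"
  shows "tensor_seminorm H G (p - r) \<le> tensor_seminorm H G (p - q) + tensor_seminorm H G (q - r)"
  using tensor_seminorm_triangle[of "p - q" "q - r"] assms by (simp add: formal_tensors_diff)

lemma tensor_seminorm_minus_commute: "tensor_seminorm H G (p - q) = tensor_seminorm H G (q - p)"
  by (simp add: tensor_seminorm_def tensor_form_diff_left tensor_form_diff_right)

lemma cauchy_tensorsD: "p \<in> cauchy_tensors H G \<Longrightarrow> p n \<in> formal_tensors H G"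
  by (simp add: cauchy_tensors_def)

lemma tensor_rel_sym: "(p, q) \<in> tensor_rel H G \<Longrightarrow> (q, p) \<in> tensor_rel H G"
  by (simp add: tensor_rel_def tensor_seminorm_minus_commute)

lemma tensor_rel_trans:
  assumes "(p, q) \<in> tensor_rel H G" "(q, r) \<in> tensor_rel H G"
  shows "(p, r) \<in> tensor_rel H G"
proof -
  have c: "p \<in> cauchy_tensors H G" "q \<in> cauchy_tensors H G" "r \<in> cauchy_tensors H G"
    and l: "(\<lambda>n. tensor_seminorm H G (p n - q n)) \<longlonglongrightarrow> 0" "(\<lambda>n. tensor_seminorm H G (q n - r n)) \<longlonglongrightarrow> 0"
    using assms by (auto simp: tensor_rel_def)
  have "(\<lambda>n. tensor_seminorm H G (p n - r n)) \<longlonglongrightarrow> 0"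
  proof (rule tendsto_sandwich[OF _ _ tendsto_const])
    show "(\<lambda>n. tensor_seminorm H G (p n - q n) + tensor_seminorm H G (q n - r n)) \<longlonglongrightarrow> 0"
      using tendsto_add[OF l] by simp
    show "\<forall>\<^sub>F n in sequentially. 0 \<le> tensor_seminorm H G (p n - r n)"
      using c by (intro always_eventually allI tensor_seminorm_nonneg formal_tensors_diff cauchy_tensorsD)
    show "\<forall>\<^sub>F n in sequentially. tensor_seminorm H G (p n - r n)
        \<le> tensor_seminorm H G (p n - q n) + tensor_seminorm H G (q n - r n)"
      using c by (intro always_eventually allI tensor_seminorm_diff_triangle cauchy_tensorsD)
  qed
  then show ?thesis using c by (simp add: tensor_rel_def)
qed

lemma tensor_class_eq: "(p, q) \<in> tensor_rel H G \<Longrightarrow> tensor_rel H G `` {p} = tensor_rel H G `` {q}"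
  using tensor_rel_sym tensor_rel_trans by blast

lemma const_cauchy: "p \<in> formal_tensors H G \<Longrightarrow> (\<lambda>_. p) \<in> cauchy_tensors H G"
  by (simp add: cauchy_tensors_def)

text \<open>Elementary tensors are classes of constant sequences, so continuity of the form is asked
  only for representatives of such classes.\<close>

lemma tensor_form_tendsto:
  assumes p: "p \<in> formal_tensors H G" and q: "q \<in> formal_tensors H G"
    and p': "((\<lambda>_. p), p') \<in> tensor_rel H G" and q': "((\<lambda>_. q), q') \<in> tensor_rel H G"
  shows "(\<lambda>n. tensor_form H G (p' n) (q' n)) \<longlonglongrightarrow> tensor_form H G p q"
proof -
  let ?s = "tensor_seminorm H G"
  have F: "p' n \<in> formal_tensors H G" "q' n \<in> formal_tensors H G" for n
    using p' q' by (auto simp: tensor_rel_def cauchy_tensorsD)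
  have l: "(\<lambda>n. ?s (p - p' n)) \<longlonglongrightarrow> 0" "(\<lambda>n. ?s (q - q' n)) \<longlonglongrightarrow> 0"
    using p' q' by (auto simp: tensor_rel_def)
  show ?thesis
  proof (rule Lim_null[THEN iffD2], rule Lim_null_comparison)
    have "cmod (tensor_form H G (p' n) (q' n) - tensor_form H G p q)
        \<le> ?s (p - p' n) * (?s q + ?s (q - q' n)) + ?s p * ?s (q - q' n)" for n
    proof -
      have "tensor_form H G (p' n) (q' n) - tensor_form H G p q
          = - tensor_form H G (p - p' n) (q' n) - tensor_form H G p (q - q' n)"
        by (simp add: tensor_form_diff_left tensor_form_diff_right)
      then have "cmod (tensor_form H G (p' n) (q' n) - tensor_form H G p q)
          \<le> cmod (tensor_form H G (p - p' n) (q' n)) + cmod (tensor_form H G p (q - q' n))"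
        by (metis norm_minus_cancel norm_triangle_ineq4)
      also have "\<dots> \<le> ?s (p - p' n) * ?s (q' n) + ?s p * ?s (q - q' n)"
        using p q F by (intro add_mono tensor_form_Cauchy_Schwarz formal_tensors_diff) auto
      also have "?s (q' n) \<le> ?s q + ?s (q' n - q)"
        using tensor_seminorm_triangle[of q "q' n - q"] q F by (simp add: formal_tensors_diff)
      then have "?s (p - p' n) * ?s (q' n) \<le> ?s (p - p' n) * (?s q + ?s (q - q' n))"
        using p F tensor_seminorm_minus_commute[of q]
        by (intro mult_left_mono tensor_seminorm_nonneg formal_tensors_diff) auto
      finally show ?thesis by simp
    qed
    then show "\<forall>\<^sub>F n in sequentially. cmod (tensor_form H G (p' n) (q' n) - tensor_form H G p q)
        \<le> ?s (p - p' n) * (?s q + ?s (q - q' n)) + ?s p * ?s (q - q' n)"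
      by (intro always_eventually allI)
    have "(\<lambda>n. ?s (p - p' n) * (?s q + ?s (q - q' n)) + ?s p * ?s (q - q' n)) \<longlonglongrightarrow> 0 * (?s q + 0) + ?s p * 0"
      by (intro tendsto_intros l)
    then show "(\<lambda>n. ?s (p - p' n) * (?s q + ?s (q - q' n)) + ?s p * ?s (q - q' n)) \<longlonglongrightarrow> 0" by simp
  qed
qed

text \<open>The inner product is the element of a union over representatives. All the limits in it
  coincide, and the constant sequences show that it is not empty.\<close>

lemma ip_tensor_class:
  assumes p: "p \<in> formal_tensors H G" and q: "q \<in> formal_tensors H G"
  shows "ip (H \<otimes>\<^sub>R G) (tensor_rel H G `` {\<lambda>_. p}) (tensor_rel H G `` {\<lambda>_. q}) = tensor_form H G p q"
proof -
  let ?A = "tensor_rel H G `` {\<lambda>_. p}" and ?B = "tensor_rel H G `` {\<lambda>_. q}"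
  have lim: "lim (\<lambda>n. tensor_form H G (p' n) (q' n)) = tensor_form H G p q" if "p' \<in> ?A" "q' \<in> ?B" for p' q'
    using tensor_form_tendsto[OF p q] that by (intro limI) auto
  have "(\<lambda>_. p) \<in> ?A" "(\<lambda>_. q) \<in> ?B"
    using p q by (auto simp: tensor_rel_def const_cauchy)
  then have "(\<Union>p'\<in>?A. \<Union>q'\<in>?B. {lim (\<lambda>n. tensor_form H G (p' n) (q' n))}) = {tensor_form H G p q}"
    using lim by auto
  then show ?thesis by (simp add: rel_tensor_def)
qed

text \<open>A map of pairs descends to classes as soon as it is bounded for the seminorm: it then
  preserves Cauchy sequences and equivalence, and the union over representatives is a single
  class.\<close>

lemma push_class:
  assumes p: "p \<in> formal_tensors H G"
    and f: "\<And>k. k \<in> bounded_vectors H \<times> carrier G \<Longrightarrow> f k \<in> bounded_vectors H \<times> carrier G"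
    and c: "c > 0" and bound: "\<And>q. q \<in> formal_tensors H G \<Longrightarrow> tensor_seminorm H G (push f id q) \<le> c * tensor_seminorm H G q"
  shows "(\<Union>q\<in>tensor_rel H G `` {\<lambda>_. p}. tensor_rel H G `` {\<lambda>n. push f id (q n)})
    = tensor_rel H G `` {\<lambda>_. push f id p}"
proof -
  have pf: "push f id q \<in> formal_tensors H G" if "q \<in> formal_tensors H G" for q
  proof -
    have "Poly_Mapping.keys (push f id q) \<subseteq> (\<Union>k\<in>Poly_Mapping.keys q. Poly_Mapping.keys (Poly_Mapping.single (f k) (Poly_Mapping.lookup q k)))"
      unfolding push_def id_apply by (rule keys_sum)
    also have "\<dots> \<subseteq> f ` Poly_Mapping.keys q" by auto
    finally show ?thesis using f that unfolding formal_tensors_def by blast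
  qed
  have eq: "tensor_rel H G `` {\<lambda>n. push f id (q n)} = tensor_rel H G `` {\<lambda>_. push f id p}"
    if "q \<in> tensor_rel H G `` {\<lambda>_. p}" for q
  proof -
    have q: "q \<in> cauchy_tensors H G" and l: "(\<lambda>n. tensor_seminorm H G (p - q n)) \<longlonglongrightarrow> 0"
      using that by (auto simp: tensor_rel_def)
    note qF = cauchy_tensorsD[OF q]
    have "(\<lambda>n. push f id (q n)) \<in> cauchy_tensors H G"
      unfolding cauchy_tensors_def
    proof (intro CollectI conjI allI impI)
      fix e :: real assume "e > 0"
      then have "e / c > 0" using c by simp
      then obtain N where N: "\<forall>m\<ge>N. \<forall>n\<ge>N. tensor_seminorm H G (q m - q n) < e / c"
        using q unfolding cauchy_tensors_def by blast
      have "tensor_seminorm H G (push f id (q m) - push f id (q n)) < e" if "m \<ge> N" "n \<ge> N" for m n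
      proof -
        have "tensor_seminorm H G (push f id (q m - q n)) \<le> c * tensor_seminorm H G (q m - q n)"
          using qF by (intro bound formal_tensors_diff)
        also have "\<dots> < e" using N that c by (simp add: field_simps)
        finally show ?thesis by (simp add: push_diff)
      qed
      then show "\<exists>N. \<forall>m\<ge>N. \<forall>n\<ge>N. tensor_seminorm H G (push f id (q m) - push f id (q n)) < e" by blast
    qed (use pf qF in blast)
    moreover have "(\<lambda>n. tensor_seminorm H G (push f id p - push f id (q n))) \<longlonglongrightarrow> 0"
    proof (rule tendsto_sandwich[OF _ _ tendsto_const])
      show "(\<lambda>n. c * tensor_seminorm H G (p - q n)) \<longlonglongrightarrow> 0" using tendsto_mult_left[OF l, of c] by simp
      show "\<forall>\<^sub>F n in sequentially. 0 \<le> tensor_seminorm H G (push f id p - push f id (q n))"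
        by (intro always_eventually allI tensor_seminorm_nonneg formal_tensors_diff pf p qF)
      show "\<forall>\<^sub>F n in sequentially. tensor_seminorm H G (push f id p - push f id (q n)) \<le> c * tensor_seminorm H G (p - q n)"
        unfolding push_diff[symmetric] using p qF by (intro always_eventually allI bound formal_tensors_diff)
    qed
    ultimately have "((\<lambda>_. push f id p), (\<lambda>n. push f id (q n))) \<in> tensor_rel H G"
      using const_cauchy[OF pf[OF p]] by (simp add: tensor_rel_def)
    then show ?thesis by (rule tensor_class_eq[symmetric])
  qed
  have "(\<lambda>_. p) \<in> tensor_rel H G `` {\<lambda>_. p}"
    using p by (auto simp: tensor_rel_def const_cauchy)
  then show ?thesis using eq by blast
qed

lemma single_formal: "\<lbrakk>\<xi> \<in> bounded_vectors H; \<eta> \<in> carrier G\<rbrakk> \<Longrightarrow> Poly_Mapping.single (\<xi>, \<eta>) c \<in> formal_tensors H G"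
  by (auto simp: formal_tensors_def)

lemma tens_closed:
  assumes "\<xi> \<in> bounded_vectors H" "\<eta> \<in> carrier G"
  shows "tens H G \<xi> \<eta> \<in> carrier (H \<otimes>\<^sub>R G)"
  using const_cauchy[OF single_formal[OF assms]] by (simp add: rel_tensor_def tens_def quotientI)

lemma ip_tens:
  assumes "\<xi> \<in> bounded_vectors H" "\<eta> \<in> carrier G" "\<xi>' \<in> bounded_vectors H" "\<eta>' \<in> carrier G"
  shows "ip (H \<otimes>\<^sub>R G) (tens H G \<xi> \<eta>) (tens H G \<xi>' \<eta>') = ip G \<eta> (lact G (pi_star_pi H \<xi> \<xi>') \<eta>')"
  unfolding tens_def using assms
  by (simp add: ip_tensor_class single_formal tensor_form_single tensor_kernel_def)

lemma seminorm_push_le: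
  assumes q: "q \<in> formal_tensors H G" and c: "c > 0"
    and pos: "of_real (c\<^sup>2) * tensor_form H G q q - tensor_form H G (push f id q) (push f id q) \<in> \<real>\<^sub>\<ge>\<^sub>0"
  shows "tensor_seminorm H G (push f id q) \<le> c * tensor_seminorm H G q"
proof -
  have "Re (tensor_form H G (push f id q) (push f id q)) \<le> c\<^sup>2 * Re (tensor_form H G q q)"
    using pos by (simp add: complex_nonneg_Reals_iff)
  then have "tensor_seminorm H G (push f id q) \<le> sqrt (c\<^sup>2 * Re (tensor_form H G q q))"
    unfolding tensor_seminorm_def by (rule real_sqrt_le_mono)
  then show ?thesis using c by (simp add: tensor_seminorm_def real_sqrt_mult)
qed

text \<open>The seminorm bound is \<open>rep_form_bound\<close> with \<open>B\<close> the right
  action of \<open>x\<close> on \<open>G\<close>, an operator that commutes with the left action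
  there.\<close>

lemma ract_tens:
  assumes \<xi>: "\<xi> \<in> bounded_vectors H" and \<eta>: "\<eta> \<in> carrier G" and x: "x \<in> M"
  shows "ract (H \<otimes>\<^sub>R G) (tens H G \<xi> \<eta>) x = tens H G \<xi> (ract G \<eta> x)"
proof -
  obtain c where c: "c > 0" "\<And>\<zeta>. \<zeta> \<in> carrier G \<Longrightarrow> vnorm G (ract G \<zeta> x) \<le> c * vnorm G \<zeta>"
    by (rule G.ract_bound[OF x]) blast
  let ?f = "\<lambda>(\<xi>, \<eta>). (\<xi>, ract G \<eta> x)"
  have "tensor_seminorm H G (push ?f id q) \<le> c * tensor_seminorm H G q" if q: "q \<in> formal_tensors H G" for q
  proof (rule seminorm_push_le[OF q c(1)])
    let ?A = "Poly_Mapping.keys q" and ?c = "Poly_Mapping.lookup q"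
    have A: "?A \<subseteq> bounded_vectors H \<times> carrier G" using q by (simp add: formal_tensors_def)
    define n where "n = card ?A"
    obtain h where h: "bij_betw h {..<n} ?A"
      using ex_bij_betw_nat_finite[OF finite_keys[of q]] by (auto simp: n_def atLeast0LessThan)
    have hA: "h i \<in> ?A" if "i < n" for i using h that by (auto simp: bij_betw_def)
    have hH: "fst (h i) \<in> bounded_vectors H" and hG: "snd (h i) \<in> carrier G" if "i < n" for i
      using hA[OF that] A by auto
    define \<eta>' where "\<eta>' i = ?c (h i) \<odot>\<^bsub>G\<^esub> snd (h i)" for i
    have \<eta>': "\<eta>' i \<in> carrier G" if "i < n" for i using hG[OF that] by (simp add: \<eta>'_def)
    define m where "m k l = pi_star_pi H (fst k) (fst l)" for k l :: "'a \<times> 'b"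
    have mM: "m k l \<in> M" if "k \<in> ?A" "l \<in> ?A" for k l
      unfolding m_def using that A by (intro pi_star_pi_closed[OF H]) auto
    have "of_real (c\<^sup>2) * (\<Sum>i<n. \<Sum>j<n. ip G (\<eta>' i) (lop G (m (h i) (h j)) (\<eta>' j)))
      - (\<Sum>i<n. \<Sum>j<n. ip G (rop G x (\<eta>' i)) (lop G (m (h i) (h j)) (rop G x (\<eta>' j)))) \<in> \<real>\<^sub>\<ge>\<^sub>0"
    proof (rule rep_form_bound[OF G.G.hilbert_space_axioms G.lop_rep G.rop_bounded[OF x],
          where m = "\<lambda>i j. m (h i) (h j)" and \<eta> = \<eta>' and c = c])
      fix \<alpha> assume \<alpha>: "\<And>i. i < n \<Longrightarrow> \<alpha> i \<in> carrier L2"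
      show "(\<Sum>i<n. \<Sum>j<n. ip L2 (\<alpha> i) (lact L2 (m (h i) (h j)) (\<alpha> j))) \<in> \<real>\<^sub>\<ge>\<^sub>0"
        unfolding m_def using pi_star_pi_positive[OF H, of n "\<lambda>i. fst (h i)" \<alpha>] \<alpha> hH
        by (simp only: nonneg_Reals_of_real_iff) simp
    qed (use x c mM hA \<eta>' in \<open>auto simp: G.lact_ract\<close>)
    moreover have "(\<Sum>i<n. \<Sum>j<n. ip G (\<eta>' i) (lop G (m (h i) (h j)) (\<eta>' j))) = tensor_form H G q q"
    proof -
      have "tensor_form H G q q = (\<Sum>k\<in>?A. \<Sum>l\<in>?A. cnj (?c k) * ?c l * ip G (snd k) (lact G (m k l) (snd l)))"
        by (subst tensor_form_superset[where A = ?A and B = ?A]) (simp_all add: tensor_kernel_def m_def)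
      also have "\<dots> = (\<Sum>i<n. \<Sum>j<n. ip G (\<eta>' i) (lact G (m (h i) (h j)) (\<eta>' j)))"
        unfolding \<eta>'_def by (rule kernel_form[OF h A mM])
      finally show ?thesis using \<eta>' by simp
    qed
    moreover have "(\<Sum>i<n. \<Sum>j<n. ip G (rop G x (\<eta>' i)) (lop G (m (h i) (h j)) (rop G x (\<eta>' j))))
        = tensor_form H G (push ?f id q) (push ?f id q)"
    proof -
      have "tensor_form H G (push ?f id q) (push ?f id q)
          = (\<Sum>k\<in>?A. \<Sum>l\<in>?A. cnj (?c k) * ?c l * ip G (ract G (snd k) x) (lact G (m k l) (ract G (snd l) x)))"
        by (subst tensor_form_push[where A = ?A]) (simp_all add: tensor_kernel_def m_def split_beta)
      also have "\<dots> = (\<Sum>i<n. \<Sum>l\<in>?A. cnj (?c (h i)) * ?c l * ip G (ract G (snd (h i)) x) (lact G (m (h i) l) (ract G (snd l) x)))"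
        by (rule sum.reindex_bij_betw[OF h, symmetric])
      also have "\<dots> = (\<Sum>i<n. \<Sum>j<n. cnj (?c (h i)) * ?c (h j) *
          ip G (ract G (snd (h i)) x) (lact G (m (h i) (h j)) (ract G (snd (h j)) x)))"
        by (intro sum.cong refl sum.reindex_bij_betw[OF h, symmetric])
      also have "\<dots> = (\<Sum>i<n. \<Sum>j<n. ip G (rop G x (\<eta>' i)) (lop G (m (h i) (h j)) (rop G x (\<eta>' j))))"
        using hG mM hA x by (intro sum.cong refl)
          (simp add: \<eta>'_def G.ract_smult G.lact_smult G.G.ip_simps)
      finally show ?thesis ..
    qed
    ultimately show "of_real (c\<^sup>2) * tensor_form H G q q - tensor_form H G (push ?f id q) (push ?f id q) \<in> \<real>\<^sub>\<ge>\<^sub>0"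
      by simp
  qed
  then have "(\<Union>q\<in>tens H G \<xi> \<eta>. tensor_rel H G `` {\<lambda>n. push ?f id (q n)})
      = tensor_rel H G `` {\<lambda>_. push ?f id (Poly_Mapping.single (\<xi>, \<eta>) 1)}"
    unfolding tens_def using x c by (intro push_class single_formal \<xi> \<eta>) auto
  then show ?thesis by (simp add: rel_tensor_def push_single tens_def)
qed

end

section \<open>The left action on the relative tensor product\<close>

lemma bounded_vectors_lact:
  fixes H :: "('k \<Rightarrow> 'k, 'a, 'z) bimod_scheme"
  assumes H: "W_bimodule K M H" and x: "x \<in> M" and \<xi>: "\<xi> \<in> bounded_vectors H"
  shows "lact H x \<xi> \<in> bounded_vectors H"
    and "\<alpha> \<in> carrier L2 \<Longrightarrow> pi_phi H (lact H x \<xi>) \<alpha> = lact H x (pi_phi H \<xi> \<alpha>)"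
proof -
  interpret H: bimodule K M H by unfold_locales (rule H)
  obtain d where d: "d > 0" "\<And>\<zeta>. \<zeta> \<in> carrier H \<Longrightarrow> vnorm H (lact H x \<zeta>) \<le> d * vnorm H \<zeta>"
    by (rule H.lact_bound[OF x]) blast
  obtain c where c: "c > 0" "\<And>y. y \<in> M \<Longrightarrow> vnorm H (ract H \<xi> y) \<le> c * vnorm L2 (ract L2 \<Omega> y)"
    using bounded_vectorsD(2)[OF \<xi>] by blast
  note \<xi>H = bounded_vectorsD(1)[OF \<xi>]
  have le: "vnorm H (ract H (lact H x \<xi>) y) \<le> (d * c) * vnorm L2 (ract L2 \<Omega> y)" if "y \<in> M" for y
  proof -
    have "vnorm H (ract H (lact H x \<xi>) y) \<le> d * vnorm H (ract H \<xi> y)"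
      using d(2)[of "ract H \<xi> y"] that x \<xi>H by (simp add: H.lact_ract)
    also have "\<dots> \<le> d * (c * vnorm L2 (ract L2 \<Omega> y))" using c(2)[OF that] d(1) by (intro mult_left_mono) auto
    finally show ?thesis by simp
  qed
  show *: "lact H x \<xi> \<in> bounded_vectors H"
    unfolding bounded_vectors_def
  proof (intro CollectI conjI exI ballI)
    show "d * c > 0" using d c by simp
  qed (use x \<xi>H le in auto)
  assume \<alpha>: "\<alpha> \<in> carrier L2"
  have "pi_phi H (lact H x \<xi>) = compose (carrier L2) (lop H x) (pi_phi H \<xi>)"
  proof (rule pi_phi_eqI[OF H.right_module *])
    show "compose (carrier L2) (lop H x) (pi_phi H \<xi>) \<in> bounded_ops L2 H"
      by (rule compose_bounded_ops[OF L2.G.hilbert_space_axioms H.G.hilbert_space_axioms H.G.hilbert_space_axioms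
            pi_phi_bounded[OF H.right_module \<xi>] H.lop_bounded[OF x]])
  qed (use x \<xi>H in \<open>simp add: compose_eq pi_phi_Omega[OF H.right_module \<xi>] H.lact_ract\<close>)
  then show "pi_phi H (lact H x \<xi>) \<alpha> = lact H x (pi_phi H \<xi> \<alpha>)"
    using \<alpha> by (simp add: compose_eq pi_phi_closed[OF H.right_module \<xi>])
qed

lemma bi_tensor_simps:
  "carrier (H \<otimes>\<^sub>B G) = carrier (H \<otimes>\<^sub>R G)" "ip (H \<otimes>\<^sub>B G) = ip (H \<otimes>\<^sub>R G)" "ract (H \<otimes>\<^sub>B G) = ract (H \<otimes>\<^sub>R G)"
  "lact (H \<otimes>\<^sub>B G) x A = (\<Union>p\<in>A. tensor_rel H G `` {\<lambda>n. push (\<lambda>(\<xi>, \<eta>). (lact H x \<xi>, \<eta>)) id (p n)})"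
  by (simp_all add: bi_tensor_def rmod.extend_def bimod.fields_def)

lemma lact_tens:
  fixes H :: "('k \<Rightarrow> 'k, 'a, 'z) bimod_scheme" and G :: "('k \<Rightarrow> 'k, 'b, 'y) bimod_scheme"
  assumes H: "W_bimodule K M H" and G: "W_bimodule K M G"
    and \<xi>: "\<xi> \<in> bounded_vectors H" and \<eta>: "\<eta> \<in> carrier G" and x: "x \<in> M"
  shows "lact (H \<otimes>\<^sub>B G) x (tens H G \<xi> \<eta>) = tens H G (lact H x \<xi>) \<eta>"
proof -
  interpret H: bimodule K M H by unfold_locales (rule H)
  interpret G: bimodule K M G by unfold_locales (rule G)
  note Hr = H.right_module
  obtain c where c: "c > 0" "\<And>\<zeta>. \<zeta> \<in> carrier H \<Longrightarrow> vnorm H (lact H x \<zeta>) \<le> c * vnorm H \<zeta>"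
    by (rule H.lact_bound[OF x]) blast
  let ?f = "\<lambda>(\<xi>, \<eta>). (lact H x \<xi>, \<eta>)"
  have "tensor_seminorm H G (push ?f id q) \<le> c * tensor_seminorm H G q" if q: "q \<in> formal_tensors H G" for q
  proof (rule seminorm_push_le[OF Hr G q c(1)])
    let ?A = "Poly_Mapping.keys q" and ?c = "Poly_Mapping.lookup q"
    have A: "?A \<subseteq> bounded_vectors H \<times> carrier G" using q by (simp add: formal_tensors_def)
    define m where "m k l = op_add K (op_scale K (of_real (c\<^sup>2)) (pi_star_pi H (fst k) (fst l)))
      (op_scale K (-1) (pi_star_pi H (lact H x (fst k)) (lact H x (fst l))))" for k l :: "'a \<times> 'b"
    have p: "pi_star_pi H (fst k) (fst l) \<in> M" "pi_star_pi H (lact H x (fst k)) (lact H x (fst l)) \<in> M"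
      if "k \<in> ?A" "l \<in> ?A" for k l
      using that A bounded_vectors_lact(1)[OF H x] by (auto intro!: pi_star_pi_closed[OF Hr])
    have mM: "m k l \<in> M" if "k \<in> ?A" "l \<in> ?A" for k l
      unfolding m_def using p[OF that] by simp
    have m_lact: "ip G (snd k) (lact G (m k l) (snd l))
        = of_real (c\<^sup>2) * tensor_kernel H G k l - tensor_kernel H G (?f k) (?f l)" if "k \<in> ?A" "l \<in> ?A" for k l
    proof -
      have "snd k \<in> carrier G" "snd l \<in> carrier G" using that A by auto
      then show ?thesis
        unfolding m_def tensor_kernel_def using p[OF that]
        by (simp add: G.lact_op_add G.lact_op_scale G.G.ip_simps split_beta)
    qed
    have "(\<Sum>k\<in>?A. \<Sum>l\<in>?A. cnj (?c k) * ?c l * ip G (snd k) (lact G (m k l) (snd l))) \<in> \<real>\<^sub>\<ge>\<^sub>0"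
    proof (rule kernel_positive[OF Hr G finite_keys A mM])
      fix n :: nat and h \<alpha> assume h: "\<And>i. i < n \<Longrightarrow> h i \<in> ?A" and \<alpha>: "\<And>i. i < n \<Longrightarrow> \<alpha> i \<in> carrier L2"
      have hH: "fst (h i) \<in> bounded_vectors H" if "i < n" for i using h[OF that] A by auto
      let ?u = "\<lambda>i. pi_phi H (fst (h i)) (\<alpha> i)"
      have u: "?u i \<in> carrier H" if "i < n" for i using pi_phi_closed[OF Hr hH[OF that] \<alpha>[OF that]] .
      define w where "w = finsum H ?u {..<n}"
      have w: "w \<in> carrier H" unfolding w_def using u by (intro H.G.finsum_mem) auto
      have xw: "lact H x w = finsum H (\<lambda>i. lact H x (?u i)) {..<n}"
      proof -
        have "lact H x w = finsum H (\<lambda>i. lop H x (?u i)) {..<n}"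
          using H.GG.bounded_ops_finsum[OF H.lop_bounded[OF x], of "{..<n}" ?u] u w unfolding w_def by simp
        also have "\<dots> = finsum H (\<lambda>i. lact H x (?u i)) {..<n}"
          using u x by (intro H.G.M.finsum_cong') auto
        finally show ?thesis .
      qed
      have 1: "(\<Sum>i<n. \<Sum>j<n. ip L2 (\<alpha> i) (lact L2 (pi_star_pi H (fst (h i)) (fst (h j))) (\<alpha> j))) = of_real ((vnorm H w)\<^sup>2)"
        unfolding w_def by (rule pi_star_pi_positive[OF Hr]) (use hH \<alpha> in auto)
      have "(\<Sum>i<n. \<Sum>j<n. ip L2 (\<alpha> i) (lact L2 (pi_star_pi H (lact H x (fst (h i))) (lact H x (fst (h j)))) (\<alpha> j)))
          = of_real ((vnorm H (finsum H (\<lambda>i. pi_phi H (lact H x (fst (h i))) (\<alpha> i)) {..<n}))\<^sup>2)"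
        by (rule pi_star_pi_positive[OF Hr]) (use hH \<alpha> bounded_vectors_lact(1)[OF H x] in auto)
      also have "finsum H (\<lambda>i. pi_phi H (lact H x (fst (h i))) (\<alpha> i)) {..<n} = lact H x w"
        unfolding xw using hH \<alpha> u x by (intro H.G.M.finsum_cong') (auto simp: bounded_vectors_lact(2)[OF H x])
      finally have 2: "(\<Sum>i<n. \<Sum>j<n. ip L2 (\<alpha> i) (lact L2 (pi_star_pi H (lact H x (fst (h i))) (lact H x (fst (h j)))) (\<alpha> j)))
          = of_real ((vnorm H (lact H x w))\<^sup>2)" .
      have "(\<Sum>i<n. \<Sum>j<n. ip L2 (\<alpha> i) (lact L2 (m (h i) (h j)) (\<alpha> j)))
        = (\<Sum>i<n. \<Sum>j<n. of_real (c\<^sup>2) * ip L2 (\<alpha> i) (lact L2 (pi_star_pi H (fst (h i)) (fst (h j))) (\<alpha> j))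
           - ip L2 (\<alpha> i) (lact L2 (pi_star_pi H (lact H x (fst (h i))) (lact H x (fst (h j)))) (\<alpha> j)))"
        unfolding m_def using p h \<alpha>
        by (intro sum.cong refl) (simp add: L2.lact_op_add L2.lact_op_scale L2.G.ip_simps)
      also have "\<dots> = of_real (c\<^sup>2) * of_real ((vnorm H w)\<^sup>2) - of_real ((vnorm H (lact H x w))\<^sup>2)"
        unfolding 1[symmetric] 2[symmetric] by (simp add: sum_subtractf sum_distrib_left)
      also have "\<dots> = of_real ((c * vnorm H w)\<^sup>2 - (vnorm H (lact H x w))\<^sup>2)"
        by (simp add: power_mult_distrib)
      also have "\<dots> \<in> \<real>\<^sub>\<ge>\<^sub>0" using w x c(2)[OF w] by (intro of_real_diff_squares_nonneg) auto
      finally show "(\<Sum>i<n. \<Sum>j<n. ip L2 (\<alpha> i) (lact L2 (m (h i) (h j)) (\<alpha> j))) \<in> \<real>\<^sub>\<ge>\<^sub>0" .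
    qed
    also have "(\<Sum>k\<in>?A. \<Sum>l\<in>?A. cnj (?c k) * ?c l * ip G (snd k) (lact G (m k l) (snd l)))
      = (\<Sum>k\<in>?A. \<Sum>l\<in>?A. of_real (c\<^sup>2) * (cnj (?c k) * ?c l * tensor_kernel H G k l)
          - cnj (?c k) * ?c l * tensor_kernel H G (?f k) (?f l))"
      by (intro sum.cong refl) (simp add: m_lact algebra_simps)
    also have "\<dots> = of_real (c\<^sup>2) * tensor_form H G q q - tensor_form H G (push ?f id q) (push ?f id q)"
      by (simp add: tensor_form_push[where A = ?A] tensor_form_superset[where A = ?A and B = ?A and p = q and q = q]
          sum_subtractf sum_distrib_left)
    finally show "of_real (c\<^sup>2) * tensor_form H G q q - tensor_form H G (push ?f id q) (push ?f id q) \<in> \<real>\<^sub>\<ge>\<^sub>0" .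
  qed
  then have "(\<Union>q\<in>tens H G \<xi> \<eta>. tensor_rel H G `` {\<lambda>n. push ?f id (q n)})
      = tensor_rel H G `` {\<lambda>_. push ?f id (Poly_Mapping.single (\<xi>, \<eta>) 1)}"
    unfolding tens_def using c bounded_vectors_lact(1)[OF H x] by (intro push_class[OF Hr G] single_formal[OF Hr G] \<xi> \<eta>) auto
  then show ?thesis by (simp add: bi_tensor_simps push_single tens_def)
qed

end

section \<open>The semigroup of a unital unit\<close>

text \<open>Nested intervals: right continuity alone provides arbitrarily short intervals of small
  oscillation.\<close>

lemma right_continuous_imp_continuity_point:
  fixes d :: "real \<Rightarrow> real \<Rightarrow> real"
  assumes d: "\<And>r u. \<lbrakk>0 \<le> r; 0 \<le> u\<rbrakk> \<Longrightarrow> d r u = d u r"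
      "\<And>r u v. \<lbrakk>0 \<le> r; 0 \<le> u; 0 \<le> v\<rbrakk> \<Longrightarrow> d r v \<le> d r u + d u v"
    and right: "\<And>r e. \<lbrakk>0 \<le> r; 0 < e\<rbrakk> \<Longrightarrow> \<exists>\<delta>>0. \<forall>u. r \<le> u \<and> u < r + \<delta> \<longrightarrow> d u r < e"
    and ab: "0 \<le> a" "a < b"
  obtains p where "a < p" "p < b" "\<And>e. e > 0 \<Longrightarrow> \<exists>\<delta>>0. \<forall>u. \<bar>u - p\<bar> < \<delta> \<longrightarrow> 0 \<le> u \<and> d u p < e"
proof -
  define Q where "Q e I J \<longleftrightarrow> fst I < fst J \<and> fst J < snd J \<and> snd J < snd I \<and>
    (\<forall>u v. fst J \<le> u \<and> u \<le> snd J \<and> fst J \<le> v \<and> v \<le> snd J \<longrightarrow> d u v < e)" for e :: real and I J :: "real \<times> real"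
  have ex: "\<exists>J. Q e I J" if I: "0 \<le> fst I" "fst I < snd I" and e: "e > 0" for e I
  proof -
    define r where "r = (fst I + snd I) / 2"
    have r: "fst I < r" "r < snd I" using I by (auto simp: r_def)
    have e2: "0 < e / 2" using e by simp
    have r0: "0 \<le> r" using I r by linarith
    obtain \<delta> where \<delta>: "\<delta> > 0" "\<forall>u. r \<le> u \<and> u < r + \<delta> \<longrightarrow> d u r < e / 2"
      using right[OF r0 e2] by blast
    \<comment> \<open>Half of \<open>m\<close> is added to \<open>r\<close> below, which leaves the
      new interval strictly inside the old one and within reach of the right continuity at
      \<open>r\<close>.\<close>
    define m where "m = min \<delta> (snd I - r)"
    have m: "m > 0" "m \<le> \<delta>" "m \<le> snd I - r" using r \<delta>(1) by (auto simp: m_def)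
    define s where "s = r + m / 2"
    have s: "r < s" "s < snd I" "s < r + \<delta>" using m r unfolding s_def by linarith+
    have "d u v < e" if "r \<le> u" "u \<le> s" "r \<le> v" "v \<le> s" for u v
    proof -
      have nn: "0 \<le> r" "0 \<le> u" "0 \<le> v" using I r that by linarith+
      have "u < r + \<delta>" "v < r + \<delta>" using that s by linarith+
      then have "d u r < e / 2" "d v r < e / 2" using \<delta>(2) that by blast+
      then show ?thesis using d(2)[OF nn(2,1,3)] d(1)[OF nn(1,3)] by linarith
    qed
    then have "Q e I (r, s)" using r s by (simp add: Q_def)
    then show ?thesis by blast
  qed
  define I where "I = rec_nat (a, b) (\<lambda>n I. SOME J. Q (1 / real (Suc n)) I J)"
  have I0: "I 0 = (a, b)" and IS: "I (Suc n) = (SOME J. Q (1 / real (Suc n)) (I n) J)" for n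
    by (simp_all add: I_def)
  have inv: "0 \<le> fst (I n) \<and> fst (I n) < snd (I n)" and Q: "Q (1 / real (Suc n)) (I n) (I (Suc n))" for n
  proof -
    have step: "Q (1 / real (Suc n)) (I n) (I (Suc n))" if "0 \<le> fst (I n) \<and> fst (I n) < snd (I n)" for n
      unfolding IS using that by (intro someI_ex[OF ex]) auto
    show inv: "0 \<le> fst (I n) \<and> fst (I n) < snd (I n)" for n
    proof (induction n)
      case (Suc n)
      then show ?case using step[OF Suc] by (simp add: Q_def)
    qed (use ab in \<open>simp add: I0\<close>)
    show "Q (1 / real (Suc n)) (I n) (I (Suc n))" by (rule step[OF inv])
  qed
  have inc: "incseq (\<lambda>n. fst (I n))" and dec: "decseq (\<lambda>n. snd (I n))"
    using Q by (auto intro!: incseq_SucI decseq_SucI simp: Q_def less_imp_le)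
  have le: "fst (I m) \<le> snd (I n)" for m n
    using incseqD[OF inc, of m "max m n"] decseqD[OF dec, of n "max m n"] inv[of "max m n"] by simp
  define p where "p = (SUP n. fst (I n))"
  have bdd: "bdd_above (range (\<lambda>n. fst (I n)))" using le[of _ 0] by (auto intro!: bdd_aboveI)
  have p1: "fst (I n) \<le> p" for n unfolding p_def by (rule cSUP_upper[OF _ bdd]) simp
  have p2: "p \<le> snd (I n)" for n unfolding p_def by (rule cSUP_least) (auto intro: le)
  \<comment> \<open>The strict nesting in \<open>Q\<close> makes \<open>p\<close> an interior point
    of every interval. This is where control on both sides of \<open>p\<close> comes from.\<close>
  have p: "fst (I n) < p" "p < snd (I n)" for n
    using p1[of "Suc n"] p2[of "Suc n"] Q[of n] by (auto simp: Q_def)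
  show ?thesis
  proof
    show "a < p" "p < b" using p[of 0] by (simp_all add: I0)
    fix e :: real assume "e > 0"
    then obtain n where n: "inverse (real (Suc n)) < e" using reals_Archimedean by blast
    let ?J = "I (Suc n)"
    show "\<exists>\<delta>>0. \<forall>u. \<bar>u - p\<bar> < \<delta> \<longrightarrow> 0 \<le> u \<and> d u p < e"
    proof (intro exI[of _ "min (p - fst ?J) (snd ?J - p)"] conjI allI impI)
      show "min (p - fst ?J) (snd ?J - p) > 0" using p[of "Suc n"] by simp
      fix u assume u: "\<bar>u - p\<bar> < min (p - fst ?J) (snd ?J - p)"
      then have uJ: "fst ?J \<le> u" "u \<le> snd ?J" by auto
      then show "0 \<le> u" using inv[of "Suc n"] by linarith
      have "d u p < 1 / real (Suc n)"
        using Q[of n] uJ p[of "Suc n"] by (simp add: Q_def less_imp_le)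
      then show "d u p < e" using n by (simp add: inverse_eq_divide)
    qed
  qed
qed

section \<open>From convergence at Omega to normal functionals\<close>

context standard_space
begin

lemma normal_functional_lop_inv:
  assumes "normal_functional K M \<omega>"
  shows "normal_functional L2 (lop L2 ` M) (\<lambda>y. \<omega> (inv_into M (lop L2) y))"
  using L2_left assms by (simp add: vn_isomorphism_def normal_map_def)

lemma normal_functional_L2_vector:
  assumes "\<xi> \<in> carrier L2" "\<eta> \<in> carrier L2"
  shows "normal_functional K M (\<lambda>x. ip L2 \<xi> (lact L2 x \<eta>))"
proof -
  have "normal_functional L2 (bounded_ops L2 L2) (\<lambda>y. ip L2 \<xi> (y \<eta>))"
    using assms by (intro L2.G.normal_functional_vector) auto
  then have "normal_functional K M (\<lambda>x. ip L2 \<xi> (lop L2 x \<eta>))"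
    using L2.lop_star_map unfolding normal_star_map_def normal_map_def by blast
  then show ?thesis using assms by simp
qed

text \<open>The right action commutes with \<open>M\<close>, so convergence at
  \<open>\<Omega>\<close> gives convergence at each \<open>\<Omega>\<close> z. These vectors are
  dense and the operators uniformly bounded, which yields strong convergence on \<open>L2\<close>;
  bounded strong convergence passes to normal functionals.\<close>

lemma normal_functional_tendsto_Omega:
  assumes \<omega>: "normal_functional K M \<omega>" and x: "\<And>r. x r \<in> M" and y: "y \<in> M"
    and C: "\<And>r \<alpha>. \<alpha> \<in> carrier L2 \<Longrightarrow> vnorm L2 (lact L2 (x r) \<alpha>) \<le> C * vnorm L2 \<alpha>" "C \<ge> 0"
    and lim: "((\<lambda>r. vnorm L2 (lact L2 (x r) \<Omega> \<ominus>\<^bsub>L2\<^esub> lact L2 y \<Omega>)) \<longlongrightarrow> 0) F" and F: "F \<noteq> bot"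
  shows "((\<lambda>r. \<omega> (x r)) \<longlongrightarrow> \<omega> y) F"
proof -
  obtain C' where C': "C' > 0" "\<And>\<alpha>. \<alpha> \<in> carrier L2 \<Longrightarrow> vnorm L2 (lact L2 y \<alpha>) \<le> C' * vnorm L2 \<alpha>"
    by (rule L2.lact_bound[OF y]) blast
  have strong: "((\<lambda>r. vnorm L2 (lact L2 (x r) \<eta> \<ominus>\<^bsub>L2\<^esub> lact L2 y \<eta>)) \<longlongrightarrow> 0) F" if \<eta>: "\<eta> \<in> carrier L2" for \<eta>
  proof (rule tendstoI)
    fix e :: real assume e: "e > 0"
    \<comment> \<open>Replacing \<eta> by \<open>\<Omega>\<close> z costs at most e/2 in both
      operators together, and the other half is left for the convergence at \<open>\<Omega>\<close>
      z.\<close>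
    define \<delta> where "\<delta> = e / (2 * (C + C'))"
    have "C + C' > 0" using C(2) C'(1) by simp
    then have \<delta>: "\<delta> > 0" "(C + C') * \<delta> = e / 2" using e by (auto simp: \<delta>_def divide_simps)
    obtain z where z: "z \<in> M" "vnorm L2 (ract L2 \<Omega> z \<ominus>\<^bsub>L2\<^esub> \<eta>) < \<delta>" using Omega_dense[OF \<eta> \<delta>(1)] by blast
    let ?w = "ract L2 \<Omega> z"
    have w: "?w \<in> carrier L2" using z by simp
    obtain c where c: "c > 0" "\<And>\<xi>. \<xi> \<in> carrier L2 \<Longrightarrow> vnorm L2 (ract L2 \<xi> z) \<le> c * vnorm L2 \<xi>"
      by (rule L2.ract_bound[OF z(1)]) blast
    have "e / (2 * c) > 0" using e c by simp
    from order_tendstoD(2)[OF lim this]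
    show "\<forall>\<^sub>F r in F. dist (vnorm L2 (lact L2 (x r) \<eta> \<ominus>\<^bsub>L2\<^esub> lact L2 y \<eta>)) 0 < e"
    proof eventually_elim
      case (elim r)
      note m = x[of r] y z(1) w \<eta>
      have "lact L2 (x r) ?w \<ominus>\<^bsub>L2\<^esub> lact L2 y ?w = ract L2 (lact L2 (x r) \<Omega> \<ominus>\<^bsub>L2\<^esub> lact L2 y \<Omega>) z"
        using m by (simp add: L2.ract_diff L2.lact_ract)
      then have "vnorm L2 (lact L2 (x r) ?w \<ominus>\<^bsub>L2\<^esub> lact L2 y ?w) \<le> c * vnorm L2 (lact L2 (x r) \<Omega> \<ominus>\<^bsub>L2\<^esub> lact L2 y \<Omega>)"
        using m by (simp add: c)
      also have "\<dots> < e / 2" using elim c(1) by (simp add: field_simps)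
      finally have 1: "vnorm L2 (lact L2 (x r) ?w \<ominus>\<^bsub>L2\<^esub> lact L2 y ?w) < e / 2" .
      have "vnorm L2 (lact L2 (x r) \<eta> \<ominus>\<^bsub>L2\<^esub> lact L2 (x r) ?w) \<le> C * vnorm L2 (?w \<ominus>\<^bsub>L2\<^esub> \<eta>)"
        using C(1)[of "\<eta> \<ominus>\<^bsub>L2\<^esub> ?w" r] m by (simp add: L2.lact_diff L2.G.vnorm_minus_commute)
      moreover have "vnorm L2 (lact L2 y ?w \<ominus>\<^bsub>L2\<^esub> lact L2 y \<eta>) \<le> C' * vnorm L2 (?w \<ominus>\<^bsub>L2\<^esub> \<eta>)"
        using C'(2)[of "?w \<ominus>\<^bsub>L2\<^esub> \<eta>"] m by (simp add: L2.lact_diff)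
      moreover have "C * vnorm L2 (?w \<ominus>\<^bsub>L2\<^esub> \<eta>) + C' * vnorm L2 (?w \<ominus>\<^bsub>L2\<^esub> \<eta>) \<le> e / 2"
        unfolding \<delta>(2)[symmetric] distrib_right[symmetric] using z(2) C(2) C'(1) by (intro mult_left_mono) auto
      moreover have "vnorm L2 (lact L2 (x r) \<eta> \<ominus>\<^bsub>L2\<^esub> lact L2 y \<eta>)
          \<le> vnorm L2 (lact L2 (x r) \<eta> \<ominus>\<^bsub>L2\<^esub> lact L2 (x r) ?w) + vnorm L2 (lact L2 (x r) ?w \<ominus>\<^bsub>L2\<^esub> lact L2 y \<eta>)"
        using m by (intro L2.G.vnorm_diff_triangle) auto
      moreover have "vnorm L2 (lact L2 (x r) ?w \<ominus>\<^bsub>L2\<^esub> lact L2 y \<eta>)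
          \<le> vnorm L2 (lact L2 (x r) ?w \<ominus>\<^bsub>L2\<^esub> lact L2 y ?w) + vnorm L2 (lact L2 y ?w \<ominus>\<^bsub>L2\<^esub> lact L2 y \<eta>)"
        using m by (intro L2.G.vnorm_diff_triangle) auto
      moreover have "0 \<le> vnorm L2 (lact L2 (x r) \<eta> \<ominus>\<^bsub>L2\<^esub> lact L2 y \<eta>)" using m by simp
      ultimately show ?case using 1 by (simp add: dist_real_def)
    qed
  qed
  have linv: "inv_into M (lop L2) (lop L2 z) = z" if "z \<in> M" for z using lop_inj that by simp
  have "((\<lambda>r. \<omega> (inv_into M (lop L2) (lop L2 (x r)))) \<longlongrightarrow> \<omega> (inv_into M (lop L2) (lop L2 y))) F"
  proof (rule L2.G.normal_functional_tendsto[OF normal_functional_lop_inv[OF \<omega>] _ _ _ _ _ F])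
    show "lop L2 ` M \<subseteq> bounded_ops L2 L2" using L2.lop_bounded by blast
    show "vnorm L2 (lop L2 (x r) \<xi>) \<le> C * vnorm L2 \<xi>" if "\<xi> \<in> carrier L2" for r \<xi> using C(1)[OF that] that by simp
    fix \<xi> \<eta> assume \<xi>: "\<xi> \<in> carrier L2" and \<eta>: "\<eta> \<in> carrier L2"
    have "((\<lambda>r. ip L2 \<xi> (lact L2 (x r) \<eta>)) \<longlongrightarrow> ip L2 \<xi> (lact L2 y \<eta>)) F"
    proof (rule Lim_null[THEN iffD2], rule Lim_null_comparison)
      have "cmod (ip L2 \<xi> (lact L2 (x r) \<eta>) - ip L2 \<xi> (lact L2 y \<eta>)) \<le> vnorm L2 \<xi> * vnorm L2 (lact L2 (x r) \<eta> \<ominus>\<^bsub>L2\<^esub> lact L2 y \<eta>)" for r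
        using L2.G.Cauchy_Schwarz[of \<xi> "lact L2 (x r) \<eta> \<ominus>\<^bsub>L2\<^esub> lact L2 y \<eta>"] \<xi> \<eta> x[of r] y by simp
      then show "\<forall>\<^sub>F r in F. cmod (ip L2 \<xi> (lact L2 (x r) \<eta>) - ip L2 \<xi> (lact L2 y \<eta>)) \<le> vnorm L2 \<xi> * vnorm L2 (lact L2 (x r) \<eta> \<ominus>\<^bsub>L2\<^esub> lact L2 y \<eta>)"
        by (intro always_eventually allI)
      show "((\<lambda>r. vnorm L2 \<xi> * vnorm L2 (lact L2 (x r) \<eta> \<ominus>\<^bsub>L2\<^esub> lact L2 y \<eta>)) \<longlongrightarrow> 0) F"
        using tendsto_mult_left[OF strong[OF \<eta>], of "vnorm L2 \<xi>"] by simp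
    qed
    then show "((\<lambda>r. ip L2 \<xi> (lop L2 (x r) \<eta>)) \<longlongrightarrow> ip L2 \<xi> (lop L2 y \<eta>)) F" using \<eta> by simp
  qed (use x y in auto)
  then show ?thesis using x y by (simp add: linv)
qed

text \<open>A normal functional on all bounded operators restricts to one on \<open>M\<close>.
  Regarding the defining action on \<open>K\<close> as a normal representation lets
  \<open>rep_positive\<close> carry positivity from \<open>L2\<close> to \<open>K\<close>.\<close>

lemma identity_rep: "normal_rep K M K (\<lambda>x. x)"
proof -
  have "normal_map K M K (bounded_ops K K) (\<lambda>x. x)"
    unfolding normal_map_def
  proof (intro allI impI)
    fix \<omega> assume \<omega>: "normal_functional K (bounded_ops K K) \<omega>"
    obtain \<xi> \<eta> where "\<forall>n. \<xi> n \<in> carrier K \<and> \<eta> n \<in> carrier K"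
      "summable (\<lambda>n. (vnorm K (\<xi> n))\<^sup>2)" "summable (\<lambda>n. (vnorm K (\<eta> n))\<^sup>2)"
      and sums: "\<forall>x\<in>bounded_ops K K. (\<lambda>n. ip K (\<xi> n) (x (\<eta> n))) sums \<omega> x"
      by (rule normal_functionalE[OF \<omega>])
    moreover have "\<forall>x\<in>M. (\<lambda>n. ip K (\<xi> n) (x (\<eta> n))) sums \<omega> x"
      by (intro ballI bspec[OF sums] M_bounded)
    ultimately show "normal_functional K M \<omega>"
      unfolding normal_functional_def by (intro exI[of _ \<xi>] exI[of _ \<eta>] conjI)
  qed
  then show ?thesis by (auto simp: normal_rep_def normal_star_map_def M_bounded)
qed

end

section \<open>The maps of the semigroup are normal, unital and completely positive\<close>

context unit_inductive_limit
begin

abbreviation T :: "real \<Rightarrow> ('k \<Rightarrow> 'k) \<Rightarrow> ('k \<Rightarrow> 'k)" where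
  "T \<equiv> unit_semigroup \<Xi>"

abbreviation unit_map :: "real \<Rightarrow> 'h \<Rightarrow> 'h" where
  "unit_map t \<equiv> pi_phi (H t) (\<Xi> t)"

lemma Xi_bounded: "0 \<le> t \<Longrightarrow> \<Xi> t \<in> bounded_vectors (H t)"
  and Xi_0: "\<Xi> 0 = \<Omega>"
  and Xi_mult: "\<lbrakk>0 \<le> s; 0 \<le> t\<rbrakk> \<Longrightarrow> U s t (tens (H s) (H t) (\<Xi> s) (\<Xi> t)) = \<Xi> (s + t)"
  using unit by (simp_all add: phi_unit_def)

context
  fixes t :: real assumes t: "0 \<le> t"
begin

interpretation Ht: bimodule K M "H t" by unfold_locales (rule H_bimodule[OF t])

lemma Xi_closed: "\<Xi> t \<in> carrier (H t)"
  using bounded_vectorsD(1)[OF Xi_bounded[OF t]] .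

lemma unit_map_closed: "\<alpha> \<in> carrier L2 \<Longrightarrow> unit_map t \<alpha> \<in> carrier (H t)"
  by (rule pi_phi_closed[OF Ht.right_module Xi_bounded[OF t]])

lemma T_closed: "x \<in> M \<Longrightarrow> T t x \<in> M"
  unfolding unit_semigroup_def using bounded_vectors_lact(1)[OF Ht.bimodule] Xi_bounded[OF t]
  by (intro pi_star_pi_closed[OF Ht.right_module]) auto

lemma ip_T:
  assumes "x \<in> M" "\<alpha> \<in> carrier L2" "\<beta> \<in> carrier L2"
  shows "ip L2 \<alpha> (lact L2 (T t x) \<beta>) = ip (H t) (unit_map t \<alpha>) (lact (H t) x (unit_map t \<beta>))"
  unfolding unit_semigroup_def
  using ip_pi_star_pi[OF Ht.right_module Xi_bounded[OF t] bounded_vectors_lact(1)[OF Ht.bimodule assms(1) Xi_bounded[OF t]] assms(2,3)]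
    bounded_vectors_lact(2)[OF Ht.bimodule assms(1) Xi_bounded[OF t] assms(3)] by simp

lemma ip_unit_map:
  assumes "\<alpha> \<in> carrier L2" "\<beta> \<in> carrier L2"
  shows "ip (H t) (unit_map t \<alpha>) (unit_map t \<beta>) = ip L2 \<alpha> \<beta>"
  using ip_pi_star_pi[OF Ht.right_module Xi_bounded[OF t] Xi_bounded[OF t] assms] unital t assms
  by (simp add: unital_def)

lemma vnorm_unit_map: "\<alpha> \<in> carrier L2 \<Longrightarrow> vnorm (H t) (unit_map t \<alpha>) = vnorm L2 \<alpha>"
  by (simp add: vnorm_def ip_unit_map)

lemma unit_map_Omega: "x \<in> M \<Longrightarrow> unit_map t (ract L2 \<Omega> x) = ract (H t) (\<Xi> t) x"
  by (rule pi_phi_Omega[OF Ht.right_module Xi_bounded[OF t]])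

lemma unit_map_Omega_self: "unit_map t \<Omega> = \<Xi> t"
  by (rule pi_phi_self[OF Ht.right_module Xi_bounded[OF t]])

text \<open>A bound for \<open>x\<close> on \<open>L2\<close> persists on \<open>H t\<close> by
  \<open>rep_contraction\<close>, and compression by an isometry does not increase it. That
  \<open>c\<close> is independent of \<open>t\<close> is what makes the semigroup uniformly bounded
  on each element.\<close>

lemma vnorm_T_le:
  assumes x: "x \<in> M" and c: "c \<ge> 0" "\<And>\<alpha>. \<alpha> \<in> carrier L2 \<Longrightarrow> vnorm L2 (lact L2 x \<alpha>) \<le> c * vnorm L2 \<alpha>"
    and \<alpha>: "\<alpha> \<in> carrier L2"
  shows "vnorm L2 (lact L2 (T t x) \<alpha>) \<le> c * vnorm L2 \<alpha>"
proof -
  let ?v = "lact L2 (T t x) \<alpha>"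
  have v: "?v \<in> carrier L2" using T_closed[OF x] \<alpha> by simp
  have "vnorm (H t) (lop (H t) x (unit_map t \<alpha>)) \<le> c * vnorm (H t) (unit_map t \<alpha>)"
    by (rule rep_contraction[OF Ht.G.hilbert_space_axioms Ht.lop_rep x c]) (auto intro: unit_map_closed[OF \<alpha>])
  then have le: "vnorm (H t) (lact (H t) x (unit_map t \<alpha>)) \<le> c * vnorm L2 \<alpha>"
    using unit_map_closed[OF \<alpha>] by (simp add: vnorm_unit_map[OF \<alpha>])
  have "(vnorm L2 ?v)\<^sup>2 = Re (ip (H t) (unit_map t ?v) (lact (H t) x (unit_map t \<alpha>)))"
    using v by (simp add: L2.G.vnorm_sq ip_T[OF x v \<alpha>])
  also have "\<dots> \<le> cmod (ip (H t) (unit_map t ?v) (lact (H t) x (unit_map t \<alpha>)))" by (rule complex_Re_le_cmod)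
  also have "\<dots> \<le> vnorm (H t) (unit_map t ?v) * vnorm (H t) (lact (H t) x (unit_map t \<alpha>))"
    using x unit_map_closed v \<alpha> by (intro Ht.G.Cauchy_Schwarz) auto
  also have "\<dots> \<le> vnorm L2 ?v * (c * vnorm L2 \<alpha>)"
    unfolding vnorm_unit_map[OF v] using le v by (intro mult_left_mono) auto
  finally have "vnorm L2 ?v * vnorm L2 ?v \<le> vnorm L2 ?v * (c * vnorm L2 \<alpha>)" by (simp add: power2_eq_square)
  then show ?thesis by (rule mult_self_le_imp_le) (use v \<alpha> c(1) in auto)
qed

lemma T_add: "\<lbrakk>x \<in> M; y \<in> M\<rbrakk> \<Longrightarrow> T t (op_add K x y) = op_add K (T t x) (T t y)"
  by (rule lop_eqI)
    (simp_all add: T_closed ip_T L2.lact_op_add Ht.lact_op_add unit_map_closed L2.G.ip_add Ht.G.ip_add)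

lemma T_scale: "x \<in> M \<Longrightarrow> T t (op_scale K c x) = op_scale K c (T t x)"
  by (rule lop_eqI)
    (simp_all add: T_closed ip_T L2.lact_op_scale Ht.lact_op_scale unit_map_closed L2.G.ip_smult Ht.G.ip_smult)

lemma T_one: "T t (op_one K) = op_one K"
  by (rule lop_eqI) (simp_all add: T_closed ip_T unit_map_closed ip_unit_map)

text \<open>The vectors representing the functional are moved to \<open>H t\<close> by the isometry,
  which keeps them square-summable; normality of the left action on \<open>H t\<close> does the
  rest.\<close>

lemma T_normal: "normal_map K M K M (T t)"
  unfolding normal_map_def
proof (intro allI impI)
  fix \<omega> assume \<omega>: "normal_functional K M \<omega>"
  obtain \<xi> \<eta> where mem: "\<forall>n. \<xi> n \<in> carrier L2 \<and> \<eta> n \<in> carrier L2"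
    and s: "summable (\<lambda>n. (vnorm L2 (\<xi> n))\<^sup>2)" "summable (\<lambda>n. (vnorm L2 (\<eta> n))\<^sup>2)"
    and sums: "\<forall>y\<in>lop L2 ` M. (\<lambda>n. ip L2 (\<xi> n) (y (\<eta> n))) sums \<omega> (inv_into M (lop L2) y)"
    by (rule normal_functionalE[OF normal_functional_lop_inv[OF \<omega>]])
  have m: "\<xi> n \<in> carrier L2" "\<eta> n \<in> carrier L2" for n using mem by auto
  have m': "unit_map t (\<xi> n) \<in> carrier (H t)" "unit_map t (\<eta> n) \<in> carrier (H t)" for n using unit_map_closed m by auto
  have sT: "(\<lambda>n. ip (H t) (unit_map t (\<xi> n)) (lact (H t) x (unit_map t (\<eta> n)))) sums \<omega> (T t x)" if x: "x \<in> M" for x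
  proof -
    have "(\<lambda>n. ip L2 (\<xi> n) (lop L2 (T t x) (\<eta> n))) sums \<omega> (inv_into M (lop L2) (lop L2 (T t x)))"
      by (rule bspec[OF sums]) (use T_closed[OF x] in blast)
    then show ?thesis using x m T_closed[OF x] lop_inj by (simp add: ip_T)
  qed
  \<comment> \<open>Defined on all bounded operators of \<open>H t\<close>, since normality of the
    left action concerns functionals of these.\<close>
  define \<omega>' where "\<omega>' y = suminf (\<lambda>n. ip (H t) (unit_map t (\<xi> n)) (y (unit_map t (\<eta> n))))" for y
  have s': "summable (\<lambda>n. (vnorm (H t) (unit_map t (\<xi> n)))\<^sup>2)" "summable (\<lambda>n. (vnorm (H t) (unit_map t (\<eta> n)))\<^sup>2)"
    using s m by (simp_all add: vnorm_unit_map)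
  have "normal_functional (H t) (bounded_ops (H t) (H t)) \<omega>'"
    unfolding normal_functional_def
  proof (intro exI conjI ballI)
    fix y assume y: "y \<in> bounded_ops (H t) (H t)"
    obtain c where c: "c > 0" "\<And>\<zeta>. \<zeta> \<in> carrier (H t) \<Longrightarrow> vnorm (H t) (y \<zeta>) \<le> c * vnorm (H t) \<zeta>"
      by (rule Ht.GG.bounded_ops_bound[OF y]) blast
    have "summable (\<lambda>n. ip (H t) (unit_map t (\<xi> n)) (y (unit_map t (\<eta> n))))"
    proof (rule summable_comparison_test')
      show "summable (\<lambda>n. c * (vnorm (H t) (unit_map t (\<xi> n)) * vnorm (H t) (unit_map t (\<eta> n))))"
        by (rule summable_mult[OF Ht.G.summable_vnorm_mult[OF m' s']])
      fix n
      have "cmod (ip (H t) (unit_map t (\<xi> n)) (y (unit_map t (\<eta> n)))) \<le> vnorm (H t) (unit_map t (\<xi> n)) * vnorm (H t) (y (unit_map t (\<eta> n)))"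
        using m' bounded_ops_closed[OF y] by (intro Ht.G.Cauchy_Schwarz) auto
      also have "\<dots> \<le> vnorm (H t) (unit_map t (\<xi> n)) * (c * vnorm (H t) (unit_map t (\<eta> n)))"
        using m' c by (intro mult_left_mono) auto
      finally show "cmod (ip (H t) (unit_map t (\<xi> n)) (y (unit_map t (\<eta> n)))) \<le> c * (vnorm (H t) (unit_map t (\<xi> n)) * vnorm (H t) (unit_map t (\<eta> n)))"
        by (simp add: mult_ac)
    qed
    then show "(\<lambda>n. ip (H t) (unit_map t (\<xi> n)) (y (unit_map t (\<eta> n)))) sums \<omega>' y"
      unfolding \<omega>'_def by (rule summable_sums)
  qed (use m' s' in auto)
  then have nf: "normal_functional K M (\<lambda>x. \<omega>' (lop (H t) x))"
    using Ht.lop_star_map unfolding normal_star_map_def normal_map_def by blast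
  have eq: "\<omega>' (lop (H t) x) = \<omega> (T t x)" if "x \<in> M" for x
    unfolding \<omega>'_def using sums_unique[OF sT[OF that]] m' by simp
  show "normal_functional K M (\<lambda>x. \<omega> (T t x))"
    by (rule normal_functional_cong[OF eq nf])
qed

text \<open>Two transports. \<open>positive_normal\<close> reduces the matrix to the form c* c on
  \<open>K\<close>. The image of c* c under \<open>T t\<close> has on \<open>L2\<close> a form equal
  to a squared norm in \<open>H t\<close>, and \<open>rep_positive\<close> brings this back to
  \<open>K\<close>.\<close>

lemma T_completely_positive: "completely_positive K M (T t)"
  unfolding completely_positive_def
proof (intro allI impI)
  fix n :: nat and a \<eta>
  assume a: "\<forall>i<n. \<forall>j<n. a i j \<in> M"
    and pos: "\<forall>\<eta>. (\<forall>i<n. \<eta> i \<in> carrier K) \<longrightarrow> (\<Sum>i<n. \<Sum>j<n. ip K (\<eta> i) (a i j (\<eta> j))) \<in> \<real>\<^sub>\<ge>\<^sub>0"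
    and \<eta>: "\<forall>i<n. \<eta> i \<in> carrier K"
  show "(\<Sum>i<n. \<Sum>j<n. ip K (\<eta> i) (T t (a i j) (\<eta> j))) \<in> \<real>\<^sub>\<ge>\<^sub>0"
  proof (rule positive_normal[where f = "\<lambda>i j x. ip K (\<eta> i) (T t x (\<eta> j))" and a = a])
    fix i j assume "i < n" "j < n"
    then have "normal_functional K M (\<lambda>x. ip K (\<eta> i) (x (\<eta> j)))"
      using \<eta> M_bounded by (intro K.normal_functional_vector) auto
    then show "normal_functional K M (\<lambda>x. ip K (\<eta> i) (T t x (\<eta> j)))"
      using T_normal unfolding normal_map_def by blast
  next
    fix c assume c: "\<And>i. i < n \<Longrightarrow> c i \<in> M"
    have cc: "op_mult K (adjoint K K (c i)) (c j) \<in> M" if "i < n" "j < n" for i j using c that by simp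
    show "(\<Sum>i<n. \<Sum>j<n. ip K (\<eta> i) (T t (op_mult K (adjoint K K (c i)) (c j)) (\<eta> j))) \<in> \<real>\<^sub>\<ge>\<^sub>0"
    proof (rule rep_positive[OF K.hilbert_space_axioms identity_rep,
          where m = "\<lambda>i j. T t (op_mult K (adjoint K K (c i)) (c j))" and \<eta> = \<eta>])
      fix \<alpha> assume \<alpha>: "\<And>i. i < n \<Longrightarrow> \<alpha> i \<in> carrier L2"
      let ?u = "\<lambda>i. lact (H t) (c i) (unit_map t (\<alpha> i))"
      have u: "?u i \<in> carrier (H t)" if "i < n" for i using c \<alpha> that unit_map_closed by simp
      have w: "finsum (H t) ?u {..<n} \<in> carrier (H t)" using u by (intro Ht.G.finsum_mem) auto
      have "(\<Sum>i<n. \<Sum>j<n. ip L2 (\<alpha> i) (lact L2 (T t (op_mult K (adjoint K K (c i)) (c j))) (\<alpha> j)))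
          = (\<Sum>i<n. \<Sum>j<n. ip (H t) (?u i) (?u j))"
        using \<alpha> c unit_map_closed
        by (intro sum.cong refl) (simp add: ip_T Ht.lact_op_mult Ht.lact_adjoint)
      also have "\<dots> = ip (H t) (finsum (H t) ?u {..<n}) (finsum (H t) ?u {..<n})"
        using u by (intro Ht.G.ip_finsum_finsum) auto
      also have "\<dots> \<in> \<real>\<^sub>\<ge>\<^sub>0" by (rule Ht.G.ip_self_nonneg_Reals[OF w])
      finally show "(\<Sum>i<n. \<Sum>j<n. ip L2 (\<alpha> i) (lact L2 (T t (op_mult K (adjoint K K (c i)) (c j))) (\<alpha> j))) \<in> \<real>\<^sub>\<ge>\<^sub>0" .
    qed (use cc T_closed \<eta> in auto)
  qed (use a pos in auto)
qed

lemma T_normal_ucp: "normal_ucp K M (T t)"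
  unfolding normal_ucp_def
  using T_closed T_add T_scale T_one T_completely_positive T_normal by blast

text \<open>Both maps preserve inner products and, by \<open>U_right\<close>, agree on
  \<open>\<Omega> M\<close>, which is dense. This identification yields
  \<open>kappa_0\<close>.\<close>

lemma connecting_unit_map:
  assumes \<eta>: "\<eta> \<in> carrier L2"
  shows "connecting \<Xi> t 0 \<eta> = unit_map t \<eta>"
proof -
  have H0: "W_bimodule K M (H 0)" by (rule H_bimodule) simp
  let ?c = "\<lambda>\<eta>. U t 0 (tens (H t) (H 0) (\<Xi> t) \<eta>)"
  have U: "isometric_map (H t \<otimes>\<^sub>B H 0) (H t) (U t 0)"
    using U_unitary[OF t order_refl] by (simp add: bimodule_unitary_def unitary_map_def)
  have tens: "tens (H t) (H 0) (\<Xi> t) \<zeta> \<in> carrier (H t \<otimes>\<^sub>B H 0)" if "\<zeta> \<in> carrier L2" for \<zeta>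
    using that tens_closed[OF Ht.right_module H0 Xi_bounded[OF t], of \<zeta>] by (simp add: bi_tensor_simps H_0)
  have c_closed: "?c \<zeta> \<in> carrier (H t)" if "\<zeta> \<in> carrier L2" for \<zeta>
    using U tens[OF that] by (auto simp: isometric_map_def linear_map_def)
  have ip_c: "ip (H t) (?c \<zeta>) (?c \<zeta>') = ip L2 \<zeta> \<zeta>'" if "\<zeta> \<in> carrier L2" "\<zeta>' \<in> carrier L2" for \<zeta> \<zeta>'
  proof -
    have "ip (H t) (?c \<zeta>) (?c \<zeta>') = ip (H t \<otimes>\<^sub>B H 0) (tens (H t) (H 0) (\<Xi> t) \<zeta>) (tens (H t) (H 0) (\<Xi> t) \<zeta>')"
      using U tens[OF that(1)] tens[OF that(2)] by (simp add: isometric_map_def)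
    also have "\<dots> = ip (H 0) \<zeta> (lact (H 0) (pi_star_pi (H t) (\<Xi> t) (\<Xi> t)) \<zeta>')"
      using that ip_tens[OF Ht.right_module H0 Xi_bounded[OF t] _ Xi_bounded[OF t], of \<zeta> \<zeta>']
      by (simp add: bi_tensor_simps H_0)
    finally show ?thesis using that unital t by (simp add: unital_def H_0)
  qed
  have c_Omega: "?c (ract L2 \<Omega> y) = unit_map t (ract L2 \<Omega> y)" if "y \<in> M" for y
    using U_right[OF t that Xi_bounded[OF t]] that by (simp add: unit_map_Omega)
  interpret LH: hilbert_pair L2 "H t" ..
  note pb = pi_phi_bounded[OF Ht.right_module Xi_bounded[OF t]]
  \<comment> \<open>\<open>?c\<close> is known to preserve inner products but has not been shown to
    be linear, so \<open>bounded_ops_eq_on_Omega\<close> does not apply to it. Instead the mixed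
    inner products are computed and the squared distance of the two images is seen to
    vanish.\<close>
  have "adjoint L2 (H t) (unit_map t) (?c \<eta>) = adjoint L2 (H t) (unit_map t) (unit_map t \<eta>)"
  proof (rule Omega_total)
    fix y assume y: "y \<in> M"
    have "ip (H t) (unit_map t (ract L2 \<Omega> y)) (?c \<eta>) = ip L2 (ract L2 \<Omega> y) \<eta>"
      unfolding c_Omega[OF y, symmetric] using y \<eta> by (simp add: ip_c)
    then show "ip L2 (ract L2 \<Omega> y) (adjoint L2 (H t) (unit_map t) (?c \<eta>)) = ip L2 (ract L2 \<Omega> y) (adjoint L2 (H t) (unit_map t) (unit_map t \<eta>))"
      using y \<eta> c_closed unit_map_closed by (simp add: LH.adjoint_right[OF pb] ip_unit_map)
  qed (use \<eta> c_closed unit_map_closed in \<open>simp_all add: LH.adjoint_closed[OF pb]\<close>)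
  then have "ip (H t) (unit_map t \<eta>) (?c \<eta>) = ip L2 \<eta> \<eta>"
    using LH.adjoint_right[OF pb c_closed[OF \<eta>] \<eta>] LH.adjoint_right[OF pb unit_map_closed[OF \<eta>] \<eta>] ip_unit_map[OF \<eta> \<eta>] by simp
  moreover from this have "ip (H t) (?c \<eta>) (unit_map t \<eta>) = ip L2 \<eta> \<eta>"
    using Ht.G.ip_cnj[OF unit_map_closed[OF \<eta>] c_closed[OF \<eta>]] L2.G.ip_cnj[OF \<eta> \<eta>] by simp
  ultimately have "ip (H t) (?c \<eta> \<ominus>\<^bsub>H t\<^esub> unit_map t \<eta>) (?c \<eta> \<ominus>\<^bsub>H t\<^esub> unit_map t \<eta>) = 0"
    using \<eta> c_closed[OF \<eta>] unit_map_closed[OF \<eta>] by (simp add: ip_c ip_unit_map)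
  then have "?c \<eta> \<ominus>\<^bsub>H t\<^esub> unit_map t \<eta> = \<zero>\<^bsub>H t\<^esub>"
    using c_closed[OF \<eta>] unit_map_closed[OF \<eta>] by (intro Ht.G.ip_definite) auto
  then show ?thesis using c_closed[OF \<eta>] unit_map_closed[OF \<eta>] by (simp add: connecting_def)
qed

lemma kappa_closed: "\<zeta> \<in> carrier (H t) \<Longrightarrow> \<kappa> t \<zeta> \<in> carrier HH"
  using limit t by (auto simp: inductive_limit_def isometric_map_def linear_map_def)

lemma kappa_0:
  assumes "\<eta> \<in> carrier L2"
  shows "\<kappa> 0 \<eta> = \<kappa> t (unit_map t \<eta>)"
proof -
  have "\<forall>\<zeta>\<in>carrier (H 0). \<kappa> t (connecting \<Xi> t 0 \<zeta>) = \<kappa> 0 \<zeta>"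
    using limit[unfolded inductive_limit_def, THEN conjunct2, THEN conjunct2, THEN conjunct1,
        THEN spec, of 0, THEN spec, of t] t by simp
  from bspec[OF this, of \<eta>] show ?thesis using assms by (simp add: connecting_unit_map H_0)
qed

lemma vnorm_kappa_diff:
  assumes "\<zeta> \<in> carrier (H t)" "\<zeta>' \<in> carrier (H t)"
  shows "vnorm HH (\<kappa> t \<zeta> \<ominus>\<^bsub>HH\<^esub> \<kappa> t \<zeta>') = vnorm (H t) (\<zeta> \<ominus>\<^bsub>H t\<^esub> \<zeta>')"
proof -
  have iso: "isometric_map (H t) HH (\<kappa> t)" and HH: "hilbert_space HH"
    using limit t by (auto simp: inductive_limit_def right_W_module_def)
  interpret HHH: hilbert_pair "H t" HH using HH by (simp add: hilbert_pair_def Ht.G.hilbert_space_axioms)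
  have "\<kappa> t \<zeta> \<ominus>\<^bsub>HH\<^esub> \<kappa> t \<zeta>' = \<kappa> t (\<zeta> \<ominus>\<^bsub>H t\<^esub> \<zeta>')"
    using HHH.linear_map_diff[OF _ assms] iso by (simp add: isometric_map_def)
  then show ?thesis using iso assms by (simp add: vnorm_def isometric_map_def)
qed

text \<open>By \<open>kappa_0\<close> this is the distance occurring in the limit condition, pulled
  back to \<open>H t\<close>, where the left action and the isometry can be compared
  directly.\<close>

definition defect :: "('k \<Rightarrow> 'k) \<Rightarrow> real" where
  "defect x = vnorm (H t) (lact (H t) x (\<Xi> t) \<ominus>\<^bsub>H t\<^esub> unit_map t (lact L2 x \<Omega>))"

lemma vnorm_kappa_defect:
  assumes "x \<in> M"
  shows "vnorm HH (\<kappa> t (lact (H t) x (\<Xi> t)) \<ominus>\<^bsub>HH\<^esub> \<kappa> 0 (lact L2 x \<Omega>)) = defect x"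
  unfolding defect_def using assms Xi_closed unit_map_closed by (simp add: kappa_0 vnorm_kappa_diff)

lemma defect_nonneg: "x \<in> M \<Longrightarrow> 0 \<le> defect x"
  unfolding defect_def using Xi_closed unit_map_closed by simp

lemma defect_sq:
  assumes x: "x \<in> M"
  shows "(defect x)\<^sup>2 = Re (\<phi> (T t (op_mult K (adjoint K K x) x)))
    - 2 * Re (ip L2 (lact L2 x \<Omega>) (lact L2 (T t x) \<Omega>)) + (vnorm L2 (lact L2 x \<Omega>))\<^sup>2"
proof -
  let ?w = "lact L2 x \<Omega>" and ?v = "lact (H t) x (\<Xi> t)"
  have m: "?w \<in> carrier L2" "?v \<in> carrier (H t)" "unit_map t ?w \<in> carrier (H t)" using x Xi_closed unit_map_closed by auto
  have "\<phi> (T t (op_mult K (adjoint K K x) x)) = ip (H t) (\<Xi> t) (lact (H t) (op_mult K (adjoint K K x) x) (\<Xi> t))"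
    using x T_closed by (simp add: Omega_state ip_T unit_map_Omega_self)
  also have "\<dots> = ip (H t) ?v ?v"
    using x Xi_closed by (simp add: Ht.lact_op_mult Ht.lact_adjoint)
  finally have 1: "\<phi> (T t (op_mult K (adjoint K K x) x)) = of_real ((vnorm (H t) ?v)\<^sup>2)" using m by (simp add: Ht.G.ip_self)
  have "ip L2 ?w (lact L2 (T t x) \<Omega>) = ip (H t) (unit_map t ?w) ?v"
    using x m by (simp add: ip_T unit_map_Omega_self)
  also have "\<dots> = cnj (ip (H t) ?v (unit_map t ?w))" using m by (intro Ht.G.ip_cnj) auto
  finally have 2: "Re (ip L2 ?w (lact L2 (T t x) \<Omega>)) = Re (ip (H t) ?v (unit_map t ?w))" by simp
  show ?thesis
    unfolding defect_def 2 using m by (simp add: Ht.G.vnorm_diff_sq 1 vnorm_unit_map)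
qed

text \<open>The adjoint of \<open>unit_map t\<close> sends x \<Xi>(t) to
  \<open>T\<^sub>t(x) \<Omega>\<close> and, by isometry, the image of x \<open>\<Omega>\<close> back
  to x \<open>\<Omega>\<close>. It is a contraction, so distances shrink.\<close>

lemma vnorm_T_diff_le_defect:
  assumes x: "x \<in> M"
  shows "vnorm L2 (lact L2 (T t x) \<Omega> \<ominus>\<^bsub>L2\<^esub> lact L2 x \<Omega>) \<le> defect x"
proof -
  let ?v = "lact L2 (T t x) \<Omega> \<ominus>\<^bsub>L2\<^esub> lact L2 x \<Omega>"
  let ?u = "lact (H t) x (\<Xi> t) \<ominus>\<^bsub>H t\<^esub> unit_map t (lact L2 x \<Omega>)"
  have m: "lact L2 x \<Omega> \<in> carrier L2" "lact L2 (T t x) \<Omega> \<in> carrier L2" "?v \<in> carrier L2"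
    "lact (H t) x (\<Xi> t) \<in> carrier (H t)" "unit_map t (lact L2 x \<Omega>) \<in> carrier (H t)" "unit_map t ?v \<in> carrier (H t)" "?u \<in> carrier (H t)"
    using x T_closed[OF x] Xi_closed unit_map_closed by auto
  have "ip L2 ?v ?v = ip L2 ?v (lact L2 (T t x) \<Omega>) - ip L2 ?v (lact L2 x \<Omega>)"
    by (rule L2.G.ip_diff_right) (use m in auto)
  also have "\<dots> = ip (H t) (unit_map t ?v) (lact (H t) x (\<Xi> t)) - ip (H t) (unit_map t ?v) (unit_map t (lact L2 x \<Omega>))"
    using ip_T[OF x m(3) Omega_closed] ip_unit_map[OF m(3) m(1)] by (simp add: unit_map_Omega_self)
  also have "\<dots> = ip (H t) (unit_map t ?v) ?u"
    by (rule Ht.G.ip_diff_right[symmetric]) (use m in auto)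
  finally have "(vnorm L2 ?v)\<^sup>2 = Re (ip (H t) (unit_map t ?v) ?u)" using L2.G.vnorm_sq[OF m(3)] by simp
  also have "\<dots> \<le> vnorm (H t) (unit_map t ?v) * vnorm (H t) ?u"
    using Ht.G.Cauchy_Schwarz[OF m(6,7)] complex_Re_le_cmod[of "ip (H t) (unit_map t ?v) ?u"] by linarith
  finally have "vnorm L2 ?v * vnorm L2 ?v \<le> vnorm L2 ?v * defect x"
    by (simp add: power2_eq_square vnorm_unit_map[OF m(3)] defect_def)
  then show ?thesis by (rule mult_self_le_imp_le) (use m(3) defect_nonneg[OF x] in auto)
qed

end

text \<open>The unit starts at \<open>\<Omega>\<close>, whose associated operator is the identity of
  \<open>L2\<close> by uniqueness.\<close>

lemma T_zero:
  assumes "x \<in> M" shows "T 0 x = x"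
proof -
  have "pi_phi L2 \<Omega> = op_one L2"
    using Xi_bounded[of 0] by (intro pi_phi_eqI[OF L2.right_module] N.op_one_bounded) (auto simp: Xi_0 H_0)
  then have "unit_map 0 \<alpha> = \<alpha>" if "\<alpha> \<in> carrier L2" for \<alpha> using that by (simp add: H_0 Xi_0)
  then show ?thesis
    using assms by (intro lop_eqI) (auto simp: T_closed ip_T H_0)
qed

text \<open>\<open>T\<^sub>s\<^sub>+\<^sub>t\<close> is computed from \<open>\<xi>(t + s) = U (\<xi>(t) \<phi>\<^sup>-\<^sup>1\<^sup>/\<^sup>2 \<xi>(s))\<close>: the inner product of the tensor product
  puts \<open>T\<^sub>t x\<close> between the two factors \<open>\<xi>(s)\<close>.\<close>

lemma T_semigroup:
  assumes st: "0 \<le> s" "0 \<le> t" and x: "x \<in> M"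
  shows "T s (T t x) = T (s + t) x"
proof (rule M_eqI_Omega)
  have ts: "0 \<le> t + s" using st by simp
  show "T s (T t x) \<in> M" "T (s + t) x \<in> M" using st x ts by (simp_all add: T_closed)
  interpret Hs: bimodule K M "H s" by unfold_locales (rule H_bimodule[OF st(1)])
  interpret Ht: bimodule K M "H t" by unfold_locales (rule H_bimodule[OF st(2)])
  fix y z assume y: "y \<in> M" and z: "z \<in> M"
  let ?V = "U t s" and ?X = "H t \<otimes>\<^sub>B H s"
  have V: "isometric_map ?X (H (t + s)) ?V" "left_linear M ?X (H (t + s)) ?V" "right_linear M ?X (H (t + s)) ?V"
    using U_unitary[OF st(2,1)] by (auto simp: bimodule_unitary_def unitary_map_def)
  note bt = Xi_bounded[OF st(2)] and bxt = bounded_vectors_lact(1)[OF Ht.bimodule x Xi_bounded[OF st(2)]]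
  have tens: "tens (H t) (H s) \<xi> \<eta> \<in> carrier ?X" if "\<xi> \<in> bounded_vectors (H t)" "\<eta> \<in> carrier (H s)" for \<xi> \<eta>
    using that by (simp add: bi_tensor_simps tens_closed[OF Ht.right_module Hs.bimodule])
  have right: "ract (H (t + s)) (\<Xi> (t + s)) w = ?V (tens (H t) (H s) (\<Xi> t) (ract (H s) (\<Xi> s) w))" if w: "w \<in> M" for w
  proof -
    have "ract (H (t + s)) (\<Xi> (t + s)) w = ?V (ract ?X (tens (H t) (H s) (\<Xi> t) (\<Xi> s)) w)"
      using V(3) w tens[OF bt Xi_closed[OF st(1)]] by (simp add: right_linear_def Xi_mult[OF st(2,1), symmetric])
    then show ?thesis
      by (simp add: bi_tensor_simps ract_tens[OF Ht.right_module Hs.bimodule bt Xi_closed[OF st(1)] w])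
  qed
  have ry: "ract (H s) (\<Xi> s) y \<in> carrier (H s)" and rz: "ract (H s) (\<Xi> s) z \<in> carrier (H s)"
    using y z Xi_closed[OF st(1)] by auto
  have "lact (H (t + s)) x (?V (tens (H t) (H s) (\<Xi> t) (ract (H s) (\<Xi> s) z)))
      = ?V (lact ?X x (tens (H t) (H s) (\<Xi> t) (ract (H s) (\<Xi> s) z)))"
    using V(2) x tens[OF bt rz] by (simp add: left_linear_def)
  also have "lact ?X x (tens (H t) (H s) (\<Xi> t) (ract (H s) (\<Xi> s) z)) = tens (H t) (H s) (lact (H t) x (\<Xi> t)) (ract (H s) (\<Xi> s) z)"
    by (rule lact_tens[OF Ht.bimodule Hs.bimodule bt rz x])
  finally have left: "lact (H (t + s)) x (ract (H (t + s)) (\<Xi> (t + s)) z)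
      = ?V (tens (H t) (H s) (lact (H t) x (\<Xi> t)) (ract (H s) (\<Xi> s) z))"
    using right[OF z] by simp
  have "ip L2 (ract L2 \<Omega> y) (lact L2 (T (t + s) x) (ract L2 \<Omega> z))
      = ip (H (t + s)) (ract (H (t + s)) (\<Xi> (t + s)) y) (lact (H (t + s)) x (ract (H (t + s)) (\<Xi> (t + s)) z))"
    using x y z ts by (simp add: ip_T unit_map_Omega)
  also have "\<dots> = ip ?X (tens (H t) (H s) (\<Xi> t) (ract (H s) (\<Xi> s) y)) (tens (H t) (H s) (lact (H t) x (\<Xi> t)) (ract (H s) (\<Xi> s) z))"
    unfolding left right[OF y] using V(1) tens[OF bt ry] tens[OF bxt rz] by (simp add: isometric_map_def)
  also have "\<dots> = ip (H s) (ract (H s) (\<Xi> s) y) (lact (H s) (T t x) (ract (H s) (\<Xi> s) z))"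
    by (simp add: bi_tensor_simps ip_tens[OF Ht.right_module Hs.bimodule bt ry bxt rz] unit_semigroup_def)
  also have "\<dots> = ip L2 (ract L2 \<Omega> y) (lact L2 (T s (T t x)) (ract L2 \<Omega> z))"
    using st x y z by (simp add: ip_T unit_map_Omega T_closed)
  finally show "ip L2 (ract L2 \<Omega> y) (lact L2 (T s (T t x)) (ract L2 \<Omega> z)) = ip L2 (ract L2 \<Omega> y) (lact L2 (T (s + t) x) (ract L2 \<Omega> z))"
    by (simp add: add.commute)
qed

section \<open>The two implications\<close>

lemma limitin_iff_defect:
  assumes x: "x \<in> M"
  shows "limitin (norm_topology HH) (\<lambda>t. \<kappa> t (lact (H t) x (\<Xi> t))) (\<kappa> 0 (lact L2 x \<Omega>)) (at_right 0)
    \<longleftrightarrow> ((\<lambda>t. defect t x) \<longlongrightarrow> 0) (at_right 0)"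
proof -
  interpret HH: hilbert_space HH using limit by (simp add: inductive_limit_def right_W_module_def)
  have ev: "\<forall>\<^sub>F t in at_right (0::real). 0 \<le> t" by (auto simp: eventually_at_filter)
  have mem: "lact (H t) x (\<Xi> t) \<in> carrier (H t)" if t: "0 \<le> t" for t
  proof -
    interpret Ht: bimodule K M "H t" by unfold_locales (rule H_bimodule[OF t])
    show ?thesis using x Xi_closed[OF t] by simp
  qed
  have "\<forall>\<^sub>F t in at_right 0. \<kappa> t (lact (H t) x (\<Xi> t)) \<in> carrier HH"
    using ev by eventually_elim (simp add: kappa_closed mem)
  moreover have "\<kappa> 0 (lact L2 x \<Omega>) \<in> carrier HH" using x by (intro kappa_closed) (auto simp: H_0)
  ultimately have "limitin (norm_topology HH) (\<lambda>t. \<kappa> t (lact (H t) x (\<Xi> t))) (\<kappa> 0 (lact L2 x \<Omega>)) (at_right 0)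
    \<longleftrightarrow> ((\<lambda>t. vnorm HH (\<kappa> t (lact (H t) x (\<Xi> t)) \<ominus>\<^bsub>HH\<^esub> \<kappa> 0 (lact L2 x \<Omega>))) \<longlongrightarrow> 0) (at_right 0)"
    by (rule HH.limitin_norm_topology)
  also have "\<dots> \<longleftrightarrow> ((\<lambda>t. defect t x) \<longlongrightarrow> 0) (at_right 0)"
    using ev by (intro tendsto_cong) (auto simp: vnorm_kappa_defect x elim!: eventually_mono)
  finally show ?thesis .
qed

lemma defect_tendsto_if_CP0:
  assumes cp: "CP0_semigroup K M T" and x: "x \<in> M"
  shows "((\<lambda>t. defect t x) \<longlongrightarrow> 0) (at_right 0)"
proof -
  have lim: "((\<lambda>t. \<omega> (T t y)) \<longlongrightarrow> \<omega> y) (at_right 0)" if "y \<in> M" "normal_functional K M \<omega>" for y \<omega>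
  proof -
    from cp[unfolded CP0_semigroup_def, THEN conjunct2, THEN conjunct2, THEN conjunct2,
        THEN bspec, OF that(1), THEN spec, THEN mp, OF that(2)]
    have "continuous_on {0..} (\<lambda>t. \<omega> (T t y))" .
    then have "((\<lambda>t. \<omega> (T t y)) \<longlongrightarrow> \<omega> (T 0 y)) (at 0 within {0..})" by (auto simp: continuous_on_def)
    then show ?thesis using T_zero[OF that(1)] by (simp add: at_within_Ici_at_right)
  qed
  let ?w = "lact L2 x \<Omega>" and ?xx = "op_mult K (adjoint K K x) x"
  have w: "?w \<in> carrier L2" using x by simp
  have "((\<lambda>t. \<phi> (T t ?xx)) \<longlongrightarrow> \<phi> ?xx) (at_right 0)"
    using x state by (intro lim) (auto simp: faithful_normal_state_def)
  moreover have "((\<lambda>t. ip L2 ?w (lact L2 (T t x) \<Omega>)) \<longlongrightarrow> ip L2 ?w (lact L2 x \<Omega>)) (at_right 0)"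
    by (rule lim[OF x normal_functional_L2_vector[OF w Omega_closed]])
  ultimately have "((\<lambda>t. Re (\<phi> (T t ?xx)) - 2 * Re (ip L2 ?w (lact L2 (T t x) \<Omega>)) + (vnorm L2 ?w)\<^sup>2)
      \<longlongrightarrow> Re (\<phi> ?xx) - 2 * Re (ip L2 ?w ?w) + (vnorm L2 ?w)\<^sup>2) (at_right 0)"
    by (intro tendsto_intros)
  also have "\<phi> ?xx = ip L2 ?w ?w" using x by (simp add: Omega_state L2.lact_op_mult L2.lact_adjoint)
  finally have "((\<lambda>t. Re (\<phi> (T t ?xx)) - 2 * Re (ip L2 ?w (lact L2 (T t x) \<Omega>)) + (vnorm L2 ?w)\<^sup>2) \<longlongrightarrow> 0) (at_right 0)"
    using L2.G.vnorm_sq[OF w] by simp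
  then have "((\<lambda>t. (defect t x)\<^sup>2) \<longlongrightarrow> 0) (at_right 0)"
    by (rule Lim_transform_eventually) (auto simp: eventually_at_filter defect_sq x)
  \<comment> \<open>The root of the square is the absolute value: \<open>defect t x\<close> is known
    to be nonnegative only for t at least 0.\<close>
  then have "((\<lambda>t. sqrt ((defect t x)\<^sup>2)) \<longlongrightarrow> sqrt 0) (at_right 0)" by (rule tendsto_real_sqrt)
  then have "((\<lambda>t. \<bar>defect t x\<bar>) \<longlongrightarrow> 0) (at_right 0)" by simp
  then show ?thesis by (rule tendsto_rabs_zero_cancel)
qed

text \<open>Continuity from the left: by the semigroup law, two-sided continuity of \<open>r \<mapsto> T\<^sub>r x\<close> at one point
  \<open>p\<close> of \<open>]0, t\<^sub>0[\<close> implies continuity at \<open>t\<^sub>0\<close>.\<close>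

lemma CP0_if_defect_tendsto:
  assumes lim: "\<And>x. x \<in> M \<Longrightarrow> ((\<lambda>t. defect t x) \<longlongrightarrow> 0) (at_right 0)"
  shows "CP0_semigroup K M T"
proof -
  have cont: "continuous_on {0..} (\<lambda>t. \<omega> (T t x))" if x: "x \<in> M" and \<omega>: "normal_functional K M \<omega>" for x \<omega>
  proof -
    define F where "F r = lact L2 (T r x) \<Omega>" for r
    have F: "F r \<in> carrier L2" if "0 \<le> r" for r using T_closed[OF that x] by (simp add: F_def)
    obtain C where C: "C > 0" "\<And>\<alpha>. \<alpha> \<in> carrier L2 \<Longrightarrow> vnorm L2 (lact L2 x \<alpha>) \<le> C * vnorm L2 \<alpha>"
      by (rule L2.lact_bound[OF x]) blast
    \<comment> \<open>The assumption is used at the element \<open>T r x\<close>; by the semigroup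
      law its defect after a time h bounds the step from r to r + h.\<close>
    have right: "\<exists>\<delta>>0. \<forall>u. r \<le> u \<and> u < r + \<delta> \<longrightarrow> vnorm L2 (F u \<ominus>\<^bsub>L2\<^esub> F r) < e" if r: "0 \<le> r" and e: "0 < e" for r e
    proof -
      have "\<forall>\<^sub>F h in at_right 0. defect h (T r x) < e"
        using lim[OF T_closed[OF r x]] e by (rule order_tendstoD(2))
      then obtain \<delta> where \<delta>: "\<delta> > 0" "\<And>h. 0 < h \<Longrightarrow> h < \<delta> \<Longrightarrow> defect h (T r x) < e"
        by (auto simp: eventually_at_right_field)
      have "vnorm L2 (F u \<ominus>\<^bsub>L2\<^esub> F r) < e" if u: "r \<le> u" "u < r + \<delta>" for u
      proof (cases "u = r")
        case True
        then show ?thesis using F[OF r] e by (simp add: L2.G.vnorm_eq_0[THEN iffD2])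
      next
        case False
        then have h: "0 < u - r" "u - r < \<delta>" using u by auto
        have "T (u - r) (T r x) = T u x" using T_semigroup[of "u - r" r x] h r x by simp
        then have "vnorm L2 (F u \<ominus>\<^bsub>L2\<^esub> F r) \<le> defect (u - r) (T r x)"
          using vnorm_T_diff_le_defect[of "u - r" "T r x"] T_closed[OF r x] h by (simp add: F_def)
        also have "\<dots> < e" using \<delta>(2) h by simp
        finally show ?thesis .
      qed
      then show ?thesis using \<delta>(1) by blast
    qed
    \<comment> \<open>The convergence lemma asks for a family in \<open>M\<close> at every index,
      whereas \<open>T\<close> is controlled only at nonnegative times; hence the cut-off by
      \<open>max 0\<close>, which is removed eventually. \<open>g\<close> is the identity at time 0
      and a shift at positive times.\<close>
    have net: "((\<lambda>r. \<omega>' (T (max 0 (g r)) x)) \<longlongrightarrow> \<omega>' (T p x)) B"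
      if p: "0 \<le> p" and \<omega>': "normal_functional K M \<omega>'" and B: "B \<noteq> bot"
        and conv: "((\<lambda>r. vnorm L2 (F (max 0 (g r)) \<ominus>\<^bsub>L2\<^esub> F p)) \<longlongrightarrow> 0) B" for p \<omega>' B and g :: "real \<Rightarrow> real"
    proof (rule normal_functional_tendsto_Omega[OF \<omega>'])
      show "((\<lambda>r. vnorm L2 (lact L2 (T (max 0 (g r)) x) \<Omega> \<ominus>\<^bsub>L2\<^esub> lact L2 (T p x) \<Omega>)) \<longlongrightarrow> 0) B"
        using conv by (simp add: F_def)
      show "vnorm L2 (lact L2 (T (max 0 (g r)) x) \<alpha>) \<le> C * vnorm L2 \<alpha>" if "\<alpha> \<in> carrier L2" for r \<alpha>
        using that C x by (intro vnorm_T_le) auto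
    qed (use x p C(1) B T_closed in auto)
    show ?thesis
      unfolding continuous_on_def
    proof
      fix t0 :: real assume "t0 \<in> {0..}"
      then consider "t0 = 0" | "t0 > 0" by fastforce
      then show "((\<lambda>t. \<omega> (T t x)) \<longlongrightarrow> \<omega> (T t0 x)) (at t0 within {0..})"
      proof cases
        case 1
        have "((\<lambda>r. vnorm L2 (F (max 0 r) \<ominus>\<^bsub>L2\<^esub> F 0)) \<longlongrightarrow> 0) (at_right 0)"
        proof (rule tendstoI)
          fix e :: real assume "e > 0"
          from right[OF order_refl this] obtain \<delta> where "\<delta> > 0" "\<And>u. 0 \<le> u \<Longrightarrow> u < \<delta> \<Longrightarrow> vnorm L2 (F u \<ominus>\<^bsub>L2\<^esub> F 0) < e"
            by auto
          then show "\<forall>\<^sub>F r in at_right 0. dist (vnorm L2 (F (max 0 r) \<ominus>\<^bsub>L2\<^esub> F 0)) 0 < e"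
            unfolding eventually_at_right_field using F by (intro exI[of _ \<delta>]) (auto simp: dist_real_def)
        qed
        then have "((\<lambda>r. \<omega> (T (max 0 r) x)) \<longlongrightarrow> \<omega> (T 0 x)) (at_right 0)"
          by (rule net[of 0 \<omega> "at_right 0" "\<lambda>r. r", OF order_refl \<omega> trivial_limit_at_right_real])
        then have "((\<lambda>r. \<omega> (T r x)) \<longlongrightarrow> \<omega> (T 0 x)) (at_right 0)"
          by (rule Lim_transform_eventually) (auto simp: eventually_at_filter max_def)
        then show ?thesis by (simp add: 1 at_within_Ici_at_right)
      next
        case 2
        obtain p where p: "0 < p" "p < t0" "\<And>e. e > 0 \<Longrightarrow> \<exists>\<delta>>0. \<forall>u. \<bar>u - p\<bar> < \<delta> \<longrightarrow> 0 \<le> u \<and> vnorm L2 (F u \<ominus>\<^bsub>L2\<^esub> F p) < e"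
        proof (rule right_continuous_imp_continuity_point[where d = "\<lambda>u r. vnorm L2 (F u \<ominus>\<^bsub>L2\<^esub> F r)" and a = 0 and b = t0])
          show "vnorm L2 (F r \<ominus>\<^bsub>L2\<^esub> F u) = vnorm L2 (F u \<ominus>\<^bsub>L2\<^esub> F r)" if "0 \<le> r" "0 \<le> u" for r u
            using F that by (intro L2.G.vnorm_minus_commute) auto
          show "vnorm L2 (F r \<ominus>\<^bsub>L2\<^esub> F v) \<le> vnorm L2 (F r \<ominus>\<^bsub>L2\<^esub> F u) + vnorm L2 (F u \<ominus>\<^bsub>L2\<^esub> F v)"
            if "0 \<le> r" "0 \<le> u" "0 \<le> v" for r u v
            using F that by (intro L2.G.vnorm_diff_triangle) auto
        qed (use right 2 in auto)
        define q where "q = t0 - p"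
        have q: "q > 0" "q < t0" using p by (auto simp: q_def)
        have "((\<lambda>r. vnorm L2 (F (max 0 (r - q)) \<ominus>\<^bsub>L2\<^esub> F p)) \<longlongrightarrow> 0) (at t0)"
        proof (rule tendstoI)
          fix e :: real assume "e > 0"
          from p(3)[OF this] obtain \<delta> where \<delta>: "\<delta> > 0" "\<And>u. \<bar>u - p\<bar> < \<delta> \<Longrightarrow> 0 \<le> u \<and> vnorm L2 (F u \<ominus>\<^bsub>L2\<^esub> F p) < e"
            by blast
          have "dist (vnorm L2 (F (max 0 (r - q)) \<ominus>\<^bsub>L2\<^esub> F p)) 0 < e" if "dist r t0 < \<delta>" for r
          proof -
            have "\<bar>(r - q) - p\<bar> < \<delta>" using that by (simp add: dist_real_def q_def)
            from \<delta>(2)[OF this] show ?thesis using F p(1) by (simp add: dist_real_def max_def)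
          qed
          then show "\<forall>\<^sub>F r in at t0. dist (vnorm L2 (F (max 0 (r - q)) \<ominus>\<^bsub>L2\<^esub> F p)) 0 < e"
            unfolding eventually_at using \<delta>(1) by blast
        qed
        \<comment> \<open>The continuity at \<open>p\<close> is now used for the functional \<omega>
          composed with \<open>T q\<close>; since q + p is \<open>t0\<close>, the semigroup law
          turns it into continuity of \<omega> along the semigroup at \<open>t0\<close>.\<close>
        moreover have "normal_functional K M (\<lambda>x. \<omega> (T q x))"
          using T_normal[of q] q \<omega> by (simp add: normal_map_def)
        ultimately have "((\<lambda>r. \<omega> (T q (T (max 0 (r - q)) x))) \<longlongrightarrow> \<omega> (T q (T p x))) (at t0)"
          by (intro net[of p "\<lambda>x. \<omega> (T q x)" "at t0" "\<lambda>r. r - q", OF less_imp_le[OF p(1)] _ trivial_limit_at])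
        moreover have "T q (T p x) = T t0 x" using T_semigroup[of q p x] q p(1) x by (simp add: q_def)
        moreover have "\<forall>\<^sub>F r in at t0. \<omega> (T q (T (max 0 (r - q)) x)) = \<omega> (T r x)"
        proof -
          have "\<forall>\<^sub>F r in at t0. q < r" using q(2) by (rule order_tendstoD(1)[OF tendsto_ident_at])
          then show ?thesis
          proof eventually_elim
            case (elim r)
            then show ?case using T_semigroup[of q "r - q" x] q(1) x by (simp add: max_def)
          qed
        qed
        ultimately have "((\<lambda>r. \<omega> (T r x)) \<longlongrightarrow> \<omega> (T t0 x)) (at t0)"
          by (simp add: Lim_transform_eventually)
        then show ?thesis by (rule tendsto_within_subset) simp
      qed
    qed
  qed
  show ?thesis
    unfolding CP0_semigroup_def
    by (intro conjI allI impI ballI) (simp_all add: T_normal_ucp T_zero T_semigroup cont)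
qed

text \<open>The characterisation of \<open>V t\<close> at s = 0, where \<open>U 0 t\<close> is the
  canonical identification.\<close>

lemma limit_unitary_unit:
  assumes t: "0 \<le> t" and x: "x \<in> M"
  shows "V t (tens HH (H t) (\<kappa> 0 (lact L2 x \<Omega>)) (\<Xi> t)) = \<kappa> t (lact (H t) x (\<Xi> t))"
proof -
  have "\<Omega> \<in> bounded_vectors L2" using Xi_bounded[of 0] by (simp add: Xi_0 H_0)
  then have "lact L2 x \<Omega> \<in> bounded_vectors (H 0)"
    using bounded_vectors_lact(1)[OF L2.bimodule x] by (simp add: H_0)
  then have "V t (tens HH (H t) (\<kappa> 0 (lact L2 x \<Omega>)) (\<Xi> t)) = \<kappa> (0 + t) (U 0 t (tens (H 0) (H t) (lact L2 x \<Omega>) (\<Xi> t)))"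
    using unitaries t Xi_closed[OF t] by (simp only: limit_unitaries_def order_refl)
  then show ?thesis using U_left[OF t x Xi_closed[OF t]] by simp
qed

end

theorem theorem4p2:
  fixes K :: "'k hilb"
    and L2 :: "('k \<Rightarrow> 'k, 'h) bimod"
    and HH :: "('k \<Rightarrow> 'k, 'g) rmod"
  assumes "unit_inductive_limit K M \<phi> L2 J P \<Omega> H U \<Xi> HH \<kappa> V"
  shows "(\<forall>t\<ge>0. \<forall>x\<in>M.
       V t (standard_space.tens M L2 \<Omega> HH (H t) (\<kappa> 0 (lact L2 x \<Omega>)) (\<Xi> t)) =
         \<kappa> t (lact (H t) x (\<Xi> t))) \<and>
     (CP0_semigroup K M (product_system.unit_semigroup M L2 \<Omega> H \<Xi>) \<longleftrightarrow>
       (\<forall>x\<in>M. limitin (norm_topology HH) (\<lambda>t. \<kappa> t (lact (H t) x (\<Xi> t)))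
          (\<kappa> 0 (lact L2 x \<Omega>)) (at_right 0)))"
proof -
  interpret unit_inductive_limit K M \<phi> L2 J P \<Omega> H U \<Xi> HH \<kappa> V by (rule assms)
  have "CP0_semigroup K M T \<longleftrightarrow> (\<forall>x\<in>M. ((\<lambda>t. defect t x) \<longlongrightarrow> 0) (at_right 0))"
    by (intro iffI ballI) (rule defect_tendsto_if_CP0, assumption+, rule CP0_if_defect_tendsto, erule bspec)
  also have "\<dots> \<longleftrightarrow> (\<forall>x\<in>M. limitin (norm_topology HH) (\<lambda>t. \<kappa> t (lact (H t) x (\<Xi> t)))
      (\<kappa> 0 (lact L2 x \<Omega>)) (at_right 0))"
    by (intro ball_cong refl limitin_iff_defect[symmetric])
  finally show ?thesis using limit_unitary_unit by (intro conjI allI impI ballI)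
qed

end
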